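(* Let $F\in\mathcal{C}^2_{\mathbb{X}_n}\cap L^2(\Omega)$ be such that $\mathbb{E}[F]=0$ and $\mathrm{Var}(F)=1$. For $p,q,r,s,t>1$ with $\frac1p+\frac1q+\frac1r=\frac1s+\frac1t=1$ and for any continuous functions $g_k$, $1\le k\le n$, satisfying $\mathbb{E}|g_k(X_k)|<\infty$, $\mathbb{E}[g_k(X_k)]=0$ and $\nabla_F:=\sum_{k=1}^n\partial_kF\,\mathcal{L}_kg_k\neq0$ a.s., we have $$I(F\|Z)\le 3\Big\|F-\sum_{k=1}^ng_k(X_k)\Big\|_2^2+3\Big\|\sum_{k=1}^ng_k(X_k)\Big\|_{2p}^2\|\nabla_F^{-1}\|_{2q}^2\|1-\nabla_F\|_{2r}^2+3\|\nabla_F^{-1}\|_{4s}^4\Big\|\sum_{k=1}^n\partial_k\nabla_F\,\mathcal{L}_kg_k\Big\|_{2t}^2,$$ provided that the norms on the right-hand side are finite.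
   Context: Setting. $(X_k)_{k\ge1}$ are independent real random variables (not necessarily identically distributed) with $\mathbb{E}[X_k]=0$, $\mathrm{Var}(X_k)=1$. Each $X_k$ has a density $p_k$ supported on a connected interval $I_k\subseteq\mathbb{R}$ (taken open), $p_k$ being positive and differentiable on $I_k$ and zero outside. $\mathbb{X}_n=(X_1,\dots,X_n)$, with range $I_1\times\cdots\times I_n$; $\|X\|_p=(\mathbb{E}|X|^p)^{1/p}$, and $L^p(\Omega)$ is the space of random variables with $\|X\|_p<\infty$. $\mathcal{C}^k_{\mathbb{X}_n}$ is the set of random variables $F(\mathbb{X}_n)$ with $F$ a $k$-times continuously differentiable function on the range of $\mathbb{X}_n$; one writes $F$ for $F(\mathbb{X}_n)$, and $\partial_kF$ for the partial derivative in the $k$-th variable evaluated at $\mathbb{X}_n$. For a function $g_k$ with $\mathbb{E}|g_k(X_k)|<\infty$ and $\mathbb{E}[g_k(X_k)]=0$: $\mathcal{L}_kg_k=\mathcal{L}_kg_k(X_k):=\frac{1}{p_k(X_k)}\int_{X_k}^\infty g_k(x)p_k(x)\,dx$. The quantity $\partial_k\nabla_F$ is the $k$-th partial derivative of $\nabla_F$ viewed as a function of $\mathbb{X}_n$. Fisher information distance: $Z\sim N(0,1)$. For $F$ with mean $0$, variance $1$ and absolutely continuous density $p_F$, with score function $\rho_F=p_F'/p_F$, $I(F\|Z)=\mathbb{E}[(\rho_F(F)+F)^2]$. (Under the theorem's hypotheses $F$ has such a density; this is part of the assertion.) *)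

theory Defs
  imports "HOL-Probability.Probability"
begin

text \<open>The random vector \<open>(X\<^sub>1, \<dots>, X\<^sub>n)\<close> is indexed by a finite type \<open>'n\<close>, with \<open>n = CARD('n)\<close>.\<close>

definition rvec :: "('n::finite \<Rightarrow> 'a \<Rightarrow> real) \<Rightarrow> 'a \<Rightarrow> real ^ 'n" where
  "rvec X \<omega> = (\<chi> k. X k \<omega>)"

definition prod_range :: "('n::finite \<Rightarrow> real set) \<Rightarrow> (real ^ 'n) set" where
  "prod_range I = {x. \<forall>k. x $ k \<in> I k}"

definition partial :: "'n::finite \<Rightarrow> (real ^ 'n \<Rightarrow> real) \<Rightarrow> real ^ 'n \<Rightarrow> real" where
  "partial k f x = deriv (\<lambda>t. f (\<chi> j. if j = k then t else x $ j)) (x $ k)"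

text \<open>\<open>m\<close>-times continuous differentiability; only meant for open \<open>S\<close>.\<close>

primrec Ck_on :: "nat \<Rightarrow> (real ^ 'n::finite) set \<Rightarrow> (real ^ 'n \<Rightarrow> real) \<Rightarrow> bool" where
  "Ck_on 0 S f \<longleftrightarrow> continuous_on S f"
| "Ck_on (Suc m) S f \<longleftrightarrow> (\<forall>x\<in>S. f differentiable (at x)) \<and> (\<forall>k. Ck_on m S (partial k f))"

text \<open>The norm \<open>(E |Y|\<^sup>p)\<^sup>1\<^sup>/\<^sup>p\<close> for real \<open>p > 0\<close>, with value \<open>\<infinity>\<close> if the moment is infinite.
  The extended nonnegative integral does not see the values of \<open>Y\<close> on null sets, so \<open>Y\<close> may
  be arbitrary (even non-measurable) where the random vector leaves its range.\<close>

definition Lp_norm :: "'a measure \<Rightarrow> real \<Rightarrow> ('a \<Rightarrow> real) \<Rightarrow> ennreal" where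
  "Lp_norm M p Y =
    (let m = (\<integral>\<^sup>+ \<omega>. ennreal (\<bar>Y \<omega>\<bar> powr p) \<partial>M)
     in if m = \<infinity> then \<infinity> else ennreal (enn2real m powr (1 / p)))"

text \<open>\<open>stein_L d g\<close> is the operator \<open>\<L>\<^sub>k\<close> for a random variable with density \<open>d\<close>.\<close>

definition stein_L :: "(real \<Rightarrow> real) \<Rightarrow> (real \<Rightarrow> real) \<Rightarrow> real \<Rightarrow> real" where
  "stein_L d g x = (LBINT y:{x..}. g y * d y) / d x"

definition nabla ::
  "('n::finite \<Rightarrow> real \<Rightarrow> real) \<Rightarrow> ('n \<Rightarrow> real \<Rightarrow> real) \<Rightarrow> (real ^ 'n \<Rightarrow> real) \<Rightarrow> real ^ 'n \<Rightarrow> real"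
where
  "nabla d g F x = (\<Sum>k\<in>UNIV. partial k F x * stein_L (d k) (g k) (x $ k))"

definition absolutely_continuous_fun :: "(real \<Rightarrow> real) \<Rightarrow> bool" where
  "absolutely_continuous_fun f \<longleftrightarrow>
    (\<forall>\<epsilon>>0. \<exists>\<delta>>0. \<forall>(m::nat) a b.
      (\<forall>i<m. a i \<le> b i) \<and> disjoint_family_on (\<lambda>i. {a i<..<b i}) {..<m} \<and>
      (\<Sum>i<m. b i - a i) < \<delta>
      \<longrightarrow> (\<Sum>i<m. \<bar>f (b i) - f (a i)\<bar>) < \<epsilon>)"

definition has_ac_density :: "'a measure \<Rightarrow> ('a \<Rightarrow> real) \<Rightarrow> (real \<Rightarrow> real) \<Rightarrow> bool" where
  "has_ac_density M Y d \<longleftrightarrow>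
    (\<forall>x. 0 \<le> d x) \<and> absolutely_continuous_fun d \<and>
    distributed M lborel Y (\<lambda>x. ennreal (d x))"

text \<open>The derivative of an absolutely continuous density exists almost everywhere, so its score
  function is determined almost surely under the law of the random variable.\<close>

definition score :: "(real \<Rightarrow> real) \<Rightarrow> real \<Rightarrow> real" where
  "score d x = deriv d x / d x"

text \<open>Fisher information distance to the standard normal law of a random variable \<open>Y\<close> with mean 0,
  variance 1 and absolutely continuous density \<open>d\<close> (which \<open>Y\<close> determines uniquely).\<close>

definition fisher_distance :: "'a measure \<Rightarrow> ('a \<Rightarrow> real) \<Rightarrow> (real \<Rightarrow> real) \<Rightarrow> ennreal" where
  "fisher_distance M Y d = (\<integral>\<^sup>+ \<omega>. ennreal ((score d (Y \<omega>) + Y \<omega>)\<^sup>2) \<partial>M)"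

end

theory Submission
  imports Defs
begin

text \<open>Write \<open>S = \<Sum>k. g\<^sub>k(X\<^sub>k)\<close>, let \<open>N\<close> be the random variable \<open>\<nabla>\<^sub>F\<close>, let \<open>T\<close> be the sum of the
  \<open>\<partial>\<^sub>k N * \<L>\<^sub>k g\<^sub>k\<close>, and put \<open>\<Theta> = S / N + T / N\<^sup>2\<close>. Everything rests on the identity
  \<open>E \<phi>'(F) = E \<phi>(F) \<Theta>\<close> for bounded \<open>C\<^sup>1\<close> functions \<open>\<phi>\<close> with bounded derivative (\<open>ibp_weight_F\<close>).

  It determines the law of \<open>F\<close>. Test functions whose derivatives approximate the indicator function
  of an interval show that \<open>p(y) = E(\<Theta>; F > y)\<close> is a density of \<open>F\<close>. Moreover
  \<open>p(b) - p(a) = - E(\<Theta>; a < F \<le> b)\<close>, so \<open>p\<close> is absolutely continuous and the score of \<open>F\<close>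
  is minus the conditional mean of \<open>\<Theta>\<close> given \<open>F\<close>. Thus \<open>\<rho>\<^sub>F(F) + F\<close> is the conditional mean of
  \<open>F - \<Theta>\<close>, and Jensen's inequality bounds the Fisher distance by \<open>E (F - \<Theta>)\<^sup>2\<close>
  (\<open>ibp_weight_fisher_distance_le\<close>). Finally \<open>F - \<Theta> = (F - S) - S (1 - N) / N - T / N\<^sup>2\<close>; the
  inequality \<open>(x - y - z)\<^sup>2 \<le> 3 (x\<^sup>2 + y\<^sup>2 + z\<^sup>2)\<close> and Hoelder's inequality give the three terms of the bound.

  The identity is integration by parts. The function \<open>p\<^sub>k \<L>\<^sub>k g\<^sub>k\<close> has derivative \<open>- g\<^sub>k p\<^sub>k\<close>, and it
  vanishes at both ends of \<open>I\<^sub>k\<close> because \<open>g\<^sub>k(X\<^sub>k)\<close> has mean zero. Hence, for bounded \<open>U\<close>, the sum of the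
  \<open>\<partial>\<^sub>k U * \<L>\<^sub>k g\<^sub>k\<close> has the same mean as \<open>U S\<close> (\<open>stein_integration_by_parts\<close>). With \<open>U = \<phi>(F) / N\<close> this is
  the identity, by the chain rule and \<open>N = \<Sum>k. \<partial>\<^sub>k F * \<L>\<^sub>k g\<^sub>k\<close>. Since \<open>N\<close> may vanish somewhere, \<open>1 / N\<close> is first
  replaced by \<open>N / (N\<^sup>2 + \<epsilon>)\<close>, and \<open>\<epsilon>\<close> tends to zero by dominated convergence.

  One point needs care. The densities are differentiable, but their derivatives need not be locally
  integrable, and neither need be the single terms \<open>\<partial>\<^sub>k U * \<L>\<^sub>k g\<^sub>k\<close>, in which a derivative of
  \<open>\<L>\<^sub>k g\<^sub>k\<close> occurs through \<open>N\<close>. Only their sum is integrable, by the assumption on \<open>T\<close>, so integrating by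
  parts in one variable at a time is not possible. The sum is, however, a divergence, and a divergence
  theorem on boxes (\<open>divergence_theorem_box\<close>) holds for every vector field that is differentiable at each
  point and whose divergence is integrable.\<close>

section \<open>Hoelder's inequality\<close>

text \<open>The weighted inequality between geometric and arithmetic mean is convexity of the exponential
  function at the points \<open>ln (y i)\<close>; if some \<open>y i\<close> is zero, the left-hand side vanishes.\<close>

lemma weighted_geometric_mean_le:
  fixes w y :: "'i \<Rightarrow> real"
  assumes fin: "finite I" and w: "\<And>i. i \<in> I \<Longrightarrow> 0 < w i" "(\<Sum>i\<in>I. w i) = 1"
    and y: "\<And>i. i \<in> I \<Longrightarrow> 0 \<le> y i"
  shows "(\<Prod>i\<in>I. y i powr w i) \<le> (\<Sum>i\<in>I. w i * y i)"
proof (cases "\<exists>i\<in>I. y i = 0")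
  case True
  then obtain i where i: "i \<in> I" "y i = 0" by blast
  then have "(\<Prod>i\<in>I. y i powr w i) = 0" using fin by (intro prod_zero) auto
  also have "0 \<le> (\<Sum>i\<in>I. w i * y i)" by (intro sum_nonneg mult_nonneg_nonneg) (use w y in \<open>auto intro: less_imp_le\<close>)
  finally show ?thesis .
next
  case False
  then have pos: "0 < y i" if "i \<in> I" for i using y[OF that] that by force
  have ne: "I \<noteq> {}" using w(2) by auto
  have "(\<Prod>i\<in>I. y i powr w i) = exp (\<Sum>i\<in>I. w i *\<^sub>R ln (y i))"
    unfolding exp_sum[OF fin]
  proof (rule prod.cong[OF refl])
    show "y i powr w i = exp (w i *\<^sub>R ln (y i))" if "i \<in> I" for i
      using pos[OF that] by (simp add: powr_def)
  qed
  also have "\<dots> \<le> (\<Sum>i\<in>I. w i * exp (ln (y i)))"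
    by (rule convex_on_sum[OF fin ne exp_convex]) (use w in \<open>simp_all add: less_imp_le\<close>)
  also have "\<dots> = (\<Sum>i\<in>I. w i * y i)" using pos by (intro sum.cong) simp_all
  finally show ?thesis .
qed

text \<open>Hoelder's inequality for finitely many factors, with \<open>w i\<close> the reciprocal of the exponent of
  \<open>f i\<close>. After normalising every factor to have \<open>m i = 1\<close>, the weighted mean inequality bounds the
  product pointwise by a convex combination of functions with integral one.\<close>

lemma nn_integral_prod_le:
  fixes f :: "'i \<Rightarrow> 'a \<Rightarrow> real"
  assumes fin: "finite I" and w: "\<And>i. i \<in> I \<Longrightarrow> 0 < w i" "(\<Sum>i\<in>I. w i) = 1"
    and fm: "\<And>i. i \<in> I \<Longrightarrow> f i \<in> borel_measurable M" and f0: "\<And>i x. i \<in> I \<Longrightarrow> 0 \<le> f i x"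
    and m: "\<And>i. i \<in> I \<Longrightarrow> (\<integral>\<^sup>+x. ennreal (f i x powr (1 / w i)) \<partial>M) = ennreal (m i)" "\<And>i. i \<in> I \<Longrightarrow> 0 \<le> m i"
  shows "(\<integral>\<^sup>+x. ennreal (\<Prod>i\<in>I. f i x) \<partial>M) \<le> ennreal (\<Prod>i\<in>I. m i powr w i)"
proof (cases "\<exists>i\<in>I. m i = 0")
  case True
  then obtain i where i: "i \<in> I" "m i = 0" by blast
  have "(\<integral>\<^sup>+x. ennreal (f i x powr (1 / w i)) \<partial>M) = 0" using m(1)[OF i(1)] i(2) by simp
  then have "AE x in M. ennreal (f i x powr (1 / w i)) = 0"
    using fm[OF i(1)] by (subst (asm) nn_integral_0_iff_AE) simp_all
  then have "AE x in M. ennreal (\<Prod>i\<in>I. f i x) = 0"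
  proof eventually_elim
    case (elim x)
    then have "f i x = 0" using f0[OF i(1), of x] by (simp add: ennreal_eq_0_iff powr_def split: if_splits)
    then have "(\<Prod>i\<in>I. f i x) = 0" using i(1) by (intro prod_zero[OF fin]) blast
    then show ?case by simp
  qed
  then have "(\<integral>\<^sup>+x. ennreal (\<Prod>i\<in>I. f i x) \<partial>M) = (\<integral>\<^sup>+x. 0 \<partial>M)" by (rule nn_integral_cong_AE)
  then show ?thesis by simp
next
  case False
  then have pos: "0 < m i" if "i \<in> I" for i using m(2)[OF that] that by force
  let ?P = "\<Prod>i\<in>I. m i powr w i"
  have P0: "0 < ?P"
  proof (rule prod_pos)
    show "0 < m i powr w i" if "i \<in> I" for i using pos[OF that] by simp
  qed
  \<comment> \<open>the mean inequality at \<open>y i = f i x powr (1 / w i) / m i\<close>, multiplied by \<open>?P\<close>\<close>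
  have pt: "(\<Prod>i\<in>I. f i x) \<le> ?P * (\<Sum>i\<in>I. (w i / m i) * f i x powr (1 / w i))" for x
  proof -
    have "(\<Prod>i\<in>I. f i x) = (\<Prod>i\<in>I. m i powr w i * (f i x powr (1 / w i) / m i) powr w i)"
    proof (rule prod.cong[OF refl])
      fix i assume i: "i \<in> I"
      have "(f i x powr (1 / w i) / m i) powr w i = (f i x powr (1 / w i)) powr w i / m i powr w i"
        by (rule powr_divide)
      also have "(f i x powr (1 / w i)) powr w i = f i x"
        using f0[OF i] w(1)[OF i] by (simp add: powr_powr)
      finally show "f i x = m i powr w i * (f i x powr (1 / w i) / m i) powr w i" using pos[OF i] by simp
    qed
    also have "\<dots> = ?P * (\<Prod>i\<in>I. (f i x powr (1 / w i) / m i) powr w i)" by (rule prod.distrib)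
    also have "\<dots> \<le> ?P * (\<Sum>i\<in>I. w i * (f i x powr (1 / w i) / m i))"
      by (intro mult_left_mono weighted_geometric_mean_le[OF fin w] less_imp_le[OF P0]) (use pos in \<open>auto intro!: divide_nonneg_pos\<close>)
    finally show ?thesis by simp
  qed
  have "(\<integral>\<^sup>+x. ennreal (\<Prod>i\<in>I. f i x) \<partial>M) \<le> (\<integral>\<^sup>+x. ennreal ?P * (\<Sum>i\<in>I. ennreal (w i / m i) * ennreal (f i x powr (1 / w i))) \<partial>M)"
  proof (rule nn_integral_mono)
    fix x
    have "ennreal (\<Prod>i\<in>I. f i x) \<le> ennreal (?P * (\<Sum>i\<in>I. (w i / m i) * f i x powr (1 / w i)))"
      by (rule ennreal_leI[OF pt])
    also have "\<dots> = ennreal ?P * ennreal (\<Sum>i\<in>I. (w i / m i) * f i x powr (1 / w i))"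
      by (rule ennreal_mult') (rule less_imp_le[OF P0])
    also have "ennreal (\<Sum>i\<in>I. (w i / m i) * f i x powr (1 / w i)) = (\<Sum>i\<in>I. ennreal ((w i / m i) * f i x powr (1 / w i)))"
      by (rule sum_ennreal[symmetric]) (simp add: less_imp_le[OF pos] less_imp_le[OF w(1)])
    also have "\<dots> = (\<Sum>i\<in>I. ennreal (w i / m i) * ennreal (f i x powr (1 / w i)))"
      by (intro sum.cong refl ennreal_mult') (simp add: less_imp_le[OF pos] less_imp_le[OF w(1)])
    finally show "ennreal (\<Prod>i\<in>I. f i x) \<le> ennreal ?P * (\<Sum>i\<in>I. ennreal (w i / m i) * ennreal (f i x powr (1 / w i)))" .
  qed
  also have "\<dots> = ennreal ?P * (\<integral>\<^sup>+x. (\<Sum>i\<in>I. ennreal (w i / m i) * ennreal (f i x powr (1 / w i))) \<partial>M)"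
    by (rule nn_integral_cmult) (use fm in measurable)
  also have "(\<integral>\<^sup>+x. (\<Sum>i\<in>I. ennreal (w i / m i) * ennreal (f i x powr (1 / w i))) \<partial>M)
      = (\<Sum>i\<in>I. \<integral>\<^sup>+x. ennreal (w i / m i) * ennreal (f i x powr (1 / w i)) \<partial>M)"
    by (rule nn_integral_sum) (use fm in measurable)
  also have "\<dots> = (\<Sum>i\<in>I. ennreal (w i))"
  proof (rule sum.cong[OF refl])
    fix i assume i: "i \<in> I"
    have "(\<integral>\<^sup>+x. ennreal (w i / m i) * ennreal (f i x powr (1 / w i)) \<partial>M) = ennreal (w i / m i) * ennreal (m i)"
      unfolding m(1)[OF i, symmetric] by (rule nn_integral_cmult) (use fm[OF i] in measurable)
    also have "\<dots> = ennreal (w i)"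
      using pos[OF i] w(1)[OF i] by (simp add: ennreal_mult'[symmetric])
    finally show "(\<integral>\<^sup>+x. ennreal (w i / m i) * ennreal (f i x powr (1 / w i)) \<partial>M) = ennreal (w i)" .
  qed
  also have "\<dots> = 1" using sum_ennreal[of I w] w by (simp add: less_imp_le)
  finally show ?thesis by simp
qed

lemma Lp_norm_cong_AE:
  "AE \<omega> in M. Y \<omega> = Z \<omega> \<Longrightarrow> Lp_norm M p Y = Lp_norm M p Z"
  unfolding Lp_norm_def by (subst nn_integral_cong_AE[where v="\<lambda>\<omega>. ennreal (\<bar>Z \<omega>\<bar> powr p)"]) auto

text \<open>Translates a power of an \<open>L\<^sup>p\<close> norm into the form in which Hoelder's inequality produces
  it: the \<open>k\<close>-th power of the norm of exponent \<open>k / w\<close> is the \<open>w\<close>-th power of a moment.\<close>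

lemma Lp_norm_power:
  assumes fin: "Lp_norm M p Y < \<infinity>" and w: "0 < w" and p: "p = real k / w" and k: "0 < k"
  obtains m where "0 \<le> m" "(\<integral>\<^sup>+\<omega>. ennreal ((\<bar>Y \<omega>\<bar> ^ k) powr (1 / w)) \<partial>M) = ennreal m"
    "Lp_norm M p Y ^ k = ennreal (m powr w)"
proof -
  let ?m = "\<integral>\<^sup>+\<omega>. ennreal (\<bar>Y \<omega>\<bar> powr p) \<partial>M"
  have m: "?m \<noteq> \<infinity>" "Lp_norm M p Y = ennreal (enn2real ?m powr (1 / p))"
    using fin unfolding Lp_norm_def by (auto simp: Let_def split: if_splits)
  have "(\<bar>Y \<omega>\<bar> ^ k) powr (1 / w) = \<bar>Y \<omega>\<bar> powr p" for \<omega>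
  proof (cases "Y \<omega> = 0")
    case False
    then show ?thesis using p by (simp add: powr_realpow[symmetric] powr_powr)
  qed (use k in simp)
  then have "(\<integral>\<^sup>+\<omega>. ennreal ((\<bar>Y \<omega>\<bar> ^ k) powr (1 / w)) \<partial>M) = ennreal (enn2real ?m)"
    using m(1) by (simp add: ennreal_enn2real_if)
  moreover have "Lp_norm M p Y ^ k = ennreal (enn2real ?m powr w)"
  proof (cases "enn2real ?m = 0")
    case True
    then show ?thesis using m(2) k by (simp add: power_0_left)
  next
    case False
    then have "(enn2real ?m powr (1 / p)) ^ k = enn2real ?m powr (1 / p * real k)"
      by (simp add: powr_realpow[symmetric] powr_powr)
    also have "1 / p * real k = w" using p w k by simp
    finally show ?thesis unfolding m(2) by (simp add: ennreal_power)
  qed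
  ultimately show thesis by (intro that[of "enn2real ?m"]) simp_all
qed

lemma Hoelder_Lp_norm:
  fixes Y :: "'i \<Rightarrow> 'a \<Rightarrow> real"
  assumes fin: "finite I" and w: "\<And>i. i \<in> I \<Longrightarrow> 0 < w i" "(\<Sum>i\<in>I. w i) = 1"
    and Y: "\<And>i. i \<in> I \<Longrightarrow> Y i \<in> borel_measurable M"
    and k: "\<And>i. i \<in> I \<Longrightarrow> 0 < k i"
    and L: "\<And>i. i \<in> I \<Longrightarrow> Lp_norm M (real (k i) / w i) (Y i) < \<infinity>"
  shows "(\<integral>\<^sup>+\<omega>. ennreal (\<Prod>i\<in>I. \<bar>Y i \<omega>\<bar> ^ k i) \<partial>M) \<le> (\<Prod>i\<in>I. Lp_norm M (real (k i) / w i) (Y i) ^ k i)"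
proof -
  have "\<forall>i\<in>I. \<exists>m\<ge>0. (\<integral>\<^sup>+\<omega>. ennreal ((\<bar>Y i \<omega>\<bar> ^ k i) powr (1 / w i)) \<partial>M) = ennreal m \<and>
    Lp_norm M (real (k i) / w i) (Y i) ^ k i = ennreal (m powr w i)"
  proof
    fix i assume i: "i \<in> I"
    obtain m where "0 \<le> m" "(\<integral>\<^sup>+\<omega>. ennreal ((\<bar>Y i \<omega>\<bar> ^ k i) powr (1 / w i)) \<partial>M) = ennreal m"
      "Lp_norm M (real (k i) / w i) (Y i) ^ k i = ennreal (m powr w i)"
      by (rule Lp_norm_power[OF L[OF i] w(1)[OF i] refl k[OF i]]) (rule that)
    then show "\<exists>m\<ge>0. (\<integral>\<^sup>+\<omega>. ennreal ((\<bar>Y i \<omega>\<bar> ^ k i) powr (1 / w i)) \<partial>M) = ennreal m \<and>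
      Lp_norm M (real (k i) / w i) (Y i) ^ k i = ennreal (m powr w i)" by blast
  qed
  from bchoice[OF this] obtain m where m: "\<And>i. i \<in> I \<Longrightarrow> 0 \<le> m i"
    "\<And>i. i \<in> I \<Longrightarrow> (\<integral>\<^sup>+\<omega>. ennreal ((\<bar>Y i \<omega>\<bar> ^ k i) powr (1 / w i)) \<partial>M) = ennreal (m i)"
    "\<And>i. i \<in> I \<Longrightarrow> Lp_norm M (real (k i) / w i) (Y i) ^ k i = ennreal (m i powr w i)" by blast
  have "(\<integral>\<^sup>+\<omega>. ennreal (\<Prod>i\<in>I. \<bar>Y i \<omega>\<bar> ^ k i) \<partial>M) \<le> ennreal (\<Prod>i\<in>I. m i powr w i)"
    by (rule nn_integral_prod_le[OF fin w _ _ m(2) m(1)]) (use Y in \<open>simp_all\<close>)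
  also have "\<dots> = (\<Prod>i\<in>I. Lp_norm M (real (k i) / w i) (Y i) ^ k i)"
    using m(3) by (simp add: prod_ennreal[symmetric])
  finally show ?thesis .
qed

corollary Hoelder_Lp_norm_2:
  assumes "0 < s" "0 < t" "1 / s + 1 / t = (1::real)"
    and "Y \<in> borel_measurable M" "Z \<in> borel_measurable M" "0 < k" "0 < l"
    and "Lp_norm M (real k * s) Y < \<infinity>" "Lp_norm M (real l * t) Z < \<infinity>"
  shows "(\<integral>\<^sup>+\<omega>. ennreal (\<bar>Y \<omega>\<bar> ^ k * \<bar>Z \<omega>\<bar> ^ l) \<partial>M) \<le> Lp_norm M (real k * s) Y ^ k * Lp_norm M (real l * t) Z ^ l"
proof -
  have "(\<integral>\<^sup>+\<omega>. ennreal (\<Prod>i\<in>{True, False}. \<bar>(if i then Y else Z) \<omega>\<bar> ^ (if i then k else l)) \<partial>M)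
    \<le> (\<Prod>i\<in>{True, False}. Lp_norm M (real (if i then k else l) / (if i then 1 / s else 1 / t)) (if i then Y else Z) ^ (if i then k else l))"
    by (rule Hoelder_Lp_norm) (use assms in auto)
  then show ?thesis by simp
qed

corollary Hoelder_Lp_norm_3:
  assumes "0 < p" "0 < q" "0 < r" "1 / p + 1 / q + 1 / r = (1::real)"
    and "Y \<in> borel_measurable M" "Z \<in> borel_measurable M" "W \<in> borel_measurable M" "0 < k"
    and "Lp_norm M (real k * p) Y < \<infinity>" "Lp_norm M (real k * q) Z < \<infinity>" "Lp_norm M (real k * r) W < \<infinity>"
  shows "(\<integral>\<^sup>+\<omega>. ennreal (\<bar>Y \<omega>\<bar> ^ k * \<bar>Z \<omega>\<bar> ^ k * \<bar>W \<omega>\<bar> ^ k) \<partial>M)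
    \<le> Lp_norm M (real k * p) Y ^ k * Lp_norm M (real k * q) Z ^ k * Lp_norm M (real k * r) W ^ k"
proof -
  let ?w = "\<lambda>i::nat. if i = 0 then 1 / p else if i = 1 then 1 / q else 1 / r"
  let ?Y = "\<lambda>i::nat. if i = 0 then Y else if i = 1 then Z else W"
  have "(\<integral>\<^sup>+\<omega>. ennreal (\<Prod>i\<in>{0, 1, 2}. \<bar>?Y i \<omega>\<bar> ^ k) \<partial>M) \<le> (\<Prod>i\<in>{0, 1, 2}. Lp_norm M (real k / ?w i) (?Y i) ^ k)"
    by (rule Hoelder_Lp_norm) (use assms in auto)
  then show ?thesis by (simp add: mult.assoc)
qed

section \<open>The divergence theorem for differentiable vector fields\<close>

text \<open>The divergence theorem is needed for a vector field that is differentiable at every point, while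
  its partial derivatives need not be integrable, only its divergence is. Under these hypotheses Fubini's
  theorem cannot reduce the statement to one dimension. The argument is that of Goursat: the flux
  through the boundary is additive under bisection of a box, and through a small box of bounded shape
  around a point it is the divergence there times the volume, up to an error that is small compared to
  the volume. Riemann sums over such boxes, subordinate to a gauge, approximate the integral of the divergence.\<close>

definition face_proj :: "'a::euclidean_space \<Rightarrow> real \<Rightarrow> 'a \<Rightarrow> 'a" where
  "face_proj i c x = x + (c - x \<bullet> i) *\<^sub>R i"

lemma face_proj_inner:
  assumes "i \<in> Basis" "j \<in> Basis"
  shows "face_proj i c x \<bullet> j = (if j = i then c else x \<bullet> j)"
  using assms by (auto simp: face_proj_def inner_add_left inner_Basis)

lemma face_proj_translate:
  "i \<in> Basis \<Longrightarrow> face_proj i c (x + t *\<^sub>R i) = face_proj i c x"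
  by (simp add: face_proj_def inner_add_left algebra_simps)

text \<open>The flux out of a box. An integral over the face where coordinate \<open>i\<close> equals \<open>c\<close> is written as
  an integral over the whole box of a function independent of coordinate \<open>i\<close>, divided by the length of
  the box in direction \<open>i\<close>, which avoids measures on hyperplanes.\<close>

definition box_flux :: "('a::euclidean_space \<Rightarrow> 'a) \<Rightarrow> 'a \<Rightarrow> 'a \<Rightarrow> real" where
  "box_flux v a b = (\<Sum>i\<in>Basis. integral (cbox a b)
     (\<lambda>x. v (face_proj i (b \<bullet> i) x) \<bullet> i - v (face_proj i (a \<bullet> i) x) \<bullet> i) / (b \<bullet> i - a \<bullet> i))"

lemma face_proj_in_cbox:
  assumes "i \<in> Basis" "x \<in> cbox a b" "a \<bullet> i \<le> c" "c \<le> b \<bullet> i"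
  shows "face_proj i c x \<in> cbox a b"
  using assms by (auto simp: mem_box face_proj_inner)

lemma continuous_on_face:
  assumes "continuous_on (cbox a b) v" "i \<in> Basis" "a \<bullet> i \<le> c" "c \<le> b \<bullet> i"
    "T \<subseteq> cbox a b"
  shows "continuous_on T (\<lambda>x. v (face_proj i c x) \<bullet> i)"
proof -
  have "continuous_on (cbox a b) (\<lambda>x. v (face_proj i c x))"
  proof (rule continuous_on_compose2[OF assms(1)])
    show "continuous_on (cbox a b) (face_proj i c)"
      unfolding face_proj_def[abs_def] by (intro continuous_intros)
  qed (use assms in \<open>auto intro: face_proj_in_cbox\<close>)
  then have "continuous_on (cbox a b) (\<lambda>x. v (face_proj i c x) \<bullet> i)"
    by (intro continuous_intros)
  then show ?thesis
    using assms(5) continuous_on_subset by blast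
qed

lemma cbox_split_mid:
  assumes "i \<in> Basis" "a \<bullet> i \<le> m" "m \<le> b \<bullet> i"
  shows "cbox a b \<inter> {x. x \<bullet> i \<le> m} = cbox a (face_proj i m b)"
    and "cbox a b \<inter> {x. x \<bullet> i \<ge> m} = cbox (face_proj i m a) b"
proof -
  have "x \<in> cbox a (face_proj i m b) \<longleftrightarrow> x \<in> cbox a b \<and> x \<bullet> i \<le> m" for x
  proof
    assume x: "x \<in> cbox a (face_proj i m b)"
    then have *: "a \<bullet> j \<le> x \<bullet> j \<and> x \<bullet> j \<le> (if j = i then m else b \<bullet> j)" if "j \<in> Basis" for j
      using that assms(1) by (auto simp: mem_box face_proj_inner)
    have "x \<bullet> j \<le> b \<bullet> j" if "j \<in> Basis" for j
      using *[OF that] assms(3) by (cases "j = i") auto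
    then show "x \<in> cbox a b \<and> x \<bullet> i \<le> m"
      using * *[OF assms(1)] assms(1) by (auto simp: mem_box)
  qed (use assms(1) in \<open>auto simp: mem_box face_proj_inner\<close>)
  moreover have "x \<in> cbox (face_proj i m a) b \<longleftrightarrow> x \<in> cbox a b \<and> m \<le> x \<bullet> i" for x
  proof
    assume x: "x \<in> cbox (face_proj i m a) b"
    then have *: "x \<bullet> j \<le> b \<bullet> j \<and> (if j = i then m else a \<bullet> j) \<le> x \<bullet> j" if "j \<in> Basis" for j
      using that assms(1) by (auto simp: mem_box face_proj_inner)
    have "a \<bullet> j \<le> x \<bullet> j" if "j \<in> Basis" for j
      using *[OF that] assms(2) by (cases "j = i") auto
    then show "x \<in> cbox a b \<and> m \<le> x \<bullet> i"
      using * *[OF assms(1)] assms(1) by (auto simp: mem_box)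
  qed (use assms(1) in \<open>auto simp: mem_box face_proj_inner\<close>)
  ultimately show "cbox a b \<inter> {x. x \<bullet> i \<le> m} = cbox a (face_proj i m b)"
    and "cbox a b \<inter> {x. x \<bullet> i \<ge> m} = cbox (face_proj i m a) b"
    by blast+
qed

text \<open>A function that does not depend on coordinate \<open>i\<close> has the same integral over both halves of a
  box cut in the middle of that coordinate, because the halves are translates of each other.\<close>

lemma integral_face_half:
  fixes w :: "'a::euclidean_space \<Rightarrow> real"
  assumes i: "i \<in> Basis" and ab: "a \<bullet> i \<le> b \<bullet> i"
    and m: "m = (a \<bullet> i + b \<bullet> i) / 2"
    and w: "w integrable_on cbox a b"
    and inv: "\<And>x t. w (x + t *\<^sub>R i) = w x"
  shows "integral (cbox a (face_proj i m b)) w = integral (cbox a b) w / 2"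
    and "integral (cbox (face_proj i m a) b) w = integral (cbox a b) w / 2"
proof -
  let ?t = "(b \<bullet> i - a \<bullet> i) / 2"
  let ?L = "cbox a (face_proj i m b)" and ?R = "cbox (face_proj i m a) b"
  have am: "a \<bullet> i \<le> m" "m \<le> b \<bullet> i" using ab m by (auto simp: field_simps)
  have sum: "integral (cbox a b) w = integral ?L w + integral ?R w"
    using integral_split[OF w i, of m] cbox_split_mid[OF i am] by simp
  have eqR: "a + ?t *\<^sub>R i = face_proj i m a" "face_proj i m b + ?t *\<^sub>R i = b"
    by (rule euclidean_eqI; use i m in \<open>auto simp: face_proj_inner inner_add_left inner_Basis field_simps\<close>)+
  have "integral ?R w = integral ?L (w \<circ> (+) (?t *\<^sub>R i))"
    using integral_shift_cbox_plus[of a "face_proj i m b" w "?t *\<^sub>R i"] eqR by simp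
  also have "w \<circ> (+) (?t *\<^sub>R i) = w" using inv by (auto simp: fun_eq_iff add.commute)
  finally show "integral ?L w = integral (cbox a b) w / 2" "integral ?R w = integral (cbox a b) w / 2"
    using sum by auto
qed

text \<open>In directions other than \<open>j\<close> the face integrals add up. In direction \<open>j\<close> the two contributions
  of the common face cancel, and for the outer faces the factor two from dividing by half the length makes up for
  integrating over half of the box.\<close>

lemma box_flux_bisect:
  fixes v :: "'a::euclidean_space \<Rightarrow> 'a"
  assumes cont: "continuous_on (cbox a b) v" and ab: "\<And>i. i \<in> Basis \<Longrightarrow> a \<bullet> i < b \<bullet> i"
    and j: "j \<in> Basis" and m: "m = (a \<bullet> j + b \<bullet> j) / 2"
  shows "box_flux v a b = box_flux v a (face_proj j m b) + box_flux v (face_proj j m a) b"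
proof -
  let ?L = "cbox a (face_proj j m b)" and ?R = "cbox (face_proj j m a) b"
  have am: "a \<bullet> j \<le> m" "m \<le> b \<bullet> j" using ab[OF j] m by (auto simp: field_simps)
  note sp = cbox_split_mid[OF j am]
  have int: "(\<lambda>x. v (face_proj i c x) \<bullet> i) integrable_on cbox a b"
    if "i \<in> Basis" "a \<bullet> i \<le> c" "c \<le> b \<bullet> i" for i c
    by (rule integrable_continuous[OF continuous_on_face[OF cont that]]) simp
  have "integral (cbox a b) (\<lambda>x. v (face_proj i (b \<bullet> i) x) \<bullet> i - v (face_proj i (a \<bullet> i) x) \<bullet> i) / (b \<bullet> i - a \<bullet> i)
     = integral ?L (\<lambda>x. v (face_proj i (face_proj j m b \<bullet> i) x) \<bullet> i - v (face_proj i (a \<bullet> i) x) \<bullet> i) / (face_proj j m b \<bullet> i - a \<bullet> i)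
     + integral ?R (\<lambda>x. v (face_proj i (b \<bullet> i) x) \<bullet> i - v (face_proj i (face_proj j m a \<bullet> i) x) \<bullet> i) / (b \<bullet> i - face_proj j m a \<bullet> i)"
    (is "?A i = ?B i + ?C i") if i: "i \<in> Basis" for i
  proof (cases "i = j")
    case False
    have "(\<lambda>x. v (face_proj i (b \<bullet> i) x) \<bullet> i - v (face_proj i (a \<bullet> i) x) \<bullet> i) integrable_on cbox a b"
      by (intro integrable_diff int i) (use ab[OF i] in auto)
    from integral_split[OF this j, of m] sp False i j show ?thesis
      by (simp add: face_proj_inner add_divide_distrib)
  next
    case True
    let ?w = "\<lambda>c x. v (face_proj j c x) \<bullet> j"
    have inv: "?w c (x + t *\<^sub>R j) = ?w c x" for c x t
      by (simp add: face_proj_translate j)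
    have wi: "?w c integrable_on cbox a b" if "a \<bullet> j \<le> c" "c \<le> b \<bullet> j" for c
      using int[OF j that] .
    have wL: "?w c integrable_on ?L" and wR: "?w c integrable_on ?R" if "a \<bullet> j \<le> c" "c \<le> b \<bullet> j" for c
      using integrable_split[OF wi[OF that] j, of m] sp by auto
    have half: "integral ?L (?w c) = integral (cbox a b) (?w c) / 2"
       "integral ?R (?w c) = integral (cbox a b) (?w c) / 2" if "a \<bullet> j \<le> c" "c \<le> b \<bullet> j" for c
      using integral_face_half[OF j less_imp_le[OF ab[OF j]] m wi[OF that] inv] by auto
    have ab': "a \<bullet> j \<le> b \<bullet> j" using ab[OF j] by simp
    have d: "m - a \<bullet> j = (b \<bullet> j - a \<bullet> j) / 2" "b \<bullet> j - m = (b \<bullet> j - a \<bullet> j) / 2"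
      by (auto simp: m field_simps)
    have fj: "face_proj j m b \<bullet> j = m" "face_proj j m a \<bullet> j = m" using j by (auto simp: face_proj_inner)
    have B: "?B j = (integral ?L (?w m) - integral ?L (?w (a \<bullet> j))) / ((b \<bullet> j - a \<bullet> j) / 2)"
      unfolding fj d using am ab' by (subst Henstock_Kurzweil_Integration.integral_diff) (auto intro: wL)
    have C: "?C j = (integral ?R (?w (b \<bullet> j)) - integral ?R (?w m)) / ((b \<bullet> j - a \<bullet> j) / 2)"
      unfolding fj d using am ab' by (subst Henstock_Kurzweil_Integration.integral_diff) (auto intro: wR)
    have A: "?A j = (integral (cbox a b) (?w (b \<bullet> j)) - integral (cbox a b) (?w (a \<bullet> j))) / (b \<bullet> j - a \<bullet> j)"
      using ab' by (simp add: Henstock_Kurzweil_Integration.integral_diff wi)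
    have "(z - x) / l = (y / 2 - x / 2) / (l / 2) + (z / 2 - y / 2) / (l / 2)" if "l \<noteq> 0" for x y z l :: real
      using that by (simp add: field_simps)
    then show ?thesis
      unfolding True A B C half[OF am] half[OF order_refl ab'] half[OF ab' order_refl]
      using ab[OF j] by simp
  qed
  then show ?thesis
    unfolding box_flux_def by (simp add: sum.distrib)
qed

text \<open>An element that belongs to both divisions lies in the cutting hyperplane and has no volume, so
  that it may be counted twice.\<close>

lemma tagged_sum_bisect:
  fixes f :: "'a::euclidean_space \<Rightarrow> real"
  assumes j: "j \<in> Basis" and am: "a \<bullet> j \<le> m" "m \<le> b \<bullet> j"
    and p1: "p1 tagged_division_of cbox a (face_proj j m b)"
    and p2: "p2 tagged_division_of cbox (face_proj j m a) b"
  shows "(p1 \<union> p2) tagged_division_of cbox a b"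
    and "(\<Sum>(x,K)\<in>p1 \<union> p2. measure lborel K * f x) = (\<Sum>(x,K)\<in>p1. measure lborel K * f x) + (\<Sum>(x,K)\<in>p2. measure lborel K * f x)"
proof -
  note sp = cbox_split_mid[OF j am]
  show "(p1 \<union> p2) tagged_division_of cbox a b"
    by (rule tagged_division_Un_interval[OF _ _ j, where c=m]) (use p1 p2 sp in auto)
  have "measure lborel K = 0" if m1: "(x, K) \<in> p1" and m2: "(x, K) \<in> p2" for x K
  proof -
    have "K \<subseteq> {x. x \<bullet> j \<le> m}" "K \<subseteq> {x. x \<bullet> j \<ge> m}"
      using tagged_division_ofD(3)[OF p1 m1] tagged_division_ofD(3)[OF p2 m2] sp by blast+
    then have K: "x \<bullet> j = m" if "x \<in> K" for x using that by force
    obtain c d where cd: "K = cbox c d" using tagged_division_ofD(4)[OF p1 m1] by blast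
    have "c \<in> K" "d \<in> K" if "K \<noteq> {}" using that unfolding cd by (auto simp: box_ne_empty mem_box)
    then have "c \<bullet> j = d \<bullet> j" if "K \<noteq> {}" using that K[of c] K[of d] by simp
    then show ?thesis using cd j
      by (cases "K = {}") (auto simp: content_eq_0 intro!: bexI[of _ j])
  qed
  then show "(\<Sum>(x,K)\<in>p1 \<union> p2. measure lborel K * f x) = (\<Sum>(x,K)\<in>p1. measure lborel K * f x) + (\<Sum>(x,K)\<in>p2. measure lborel K * f x)"
    by (intro sum.union_inter_neutral tagged_division_ofD(1)[OF p1] tagged_division_ofD(1)[OF p2]) auto
qed


text \<open>The constant and the linear part of \<open>v\<close> have flux exactly \<open>\<Sum>i. L i \<bullet> i\<close> times the volume.
  The remainder is small compared to the size of the box, and the sum of the side ratios controls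
  the area of the faces in terms of the volume.\<close>

lemma box_flux_near_divergence:
  fixes v :: "'a::euclidean_space \<Rightarrow> 'a"
  assumes cont: "continuous_on (cbox c d) v" and cd: "\<And>i. i \<in> Basis \<Longrightarrow> c \<bullet> i < d \<bullet> i"
    and lin: "linear L" and e: "0 \<le> e"
    and app: "\<And>y. y \<in> cbox c d \<Longrightarrow> norm (v y - v x - L (y - x)) \<le> e * (\<Sum>i\<in>Basis. d \<bullet> i - c \<bullet> i)"
  shows "\<bar>box_flux v c d - measure lborel (cbox c d) * (\<Sum>i\<in>Basis. L i \<bullet> i)\<bar>
     \<le> 2 * e * (\<Sum>i\<in>Basis. (\<Sum>j\<in>Basis. d \<bullet> j - c \<bullet> j) / (d \<bullet> i - c \<bullet> i)) * measure lborel (cbox c d)"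
proof -
  let ?S = "\<Sum>i\<in>Basis. d \<bullet> i - c \<bullet> i"
  let ?h = "\<lambda>i x. v (face_proj i (d \<bullet> i) x) \<bullet> i - v (face_proj i (c \<bullet> i) x) \<bullet> i"
  let ?m = "measure lborel (cbox c d)"
  have scale: "\<bar>X / l - m * k\<bar> \<le> 2 * e * (S / l) * m"
    if le: "\<bar>X - m * (l * k)\<bar> \<le> (2 * e * S) * m" and l: "0 < l" for X m l k S :: real
  proof -
    have "X / l - m * k = (X - m * (l * k)) / l" using l by (simp add: field_simps)
    then have "\<bar>X / l - m * k\<bar> = \<bar>X - m * (l * k)\<bar> / l" using l by simp
    also have "\<dots> \<le> (2 * e * S) * m / l" using le l by (intro divide_right_mono) auto
    finally show ?thesis by simp
  qed
  have main: "\<bar>integral (cbox c d) (?h i) / (d \<bullet> i - c \<bullet> i) - ?m * (L i \<bullet> i)\<bar> \<le> 2 * e * (?S / (d \<bullet> i - c \<bullet> i)) * ?m"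
    if i: "i \<in> Basis" for i
  proof -
    have l: "0 < d \<bullet> i - c \<bullet> i" using cd[OF i] by simp
    have int: "?h i integrable_on cbox c d"
      by (intro integrable_diff integrable_continuous continuous_on_face[OF cont i]) (use cd[OF i] in auto)
    have pt: "norm (?h i y - (d \<bullet> i - c \<bullet> i) * (L i \<bullet> i)) \<le> 2 * e * ?S" if y: "y \<in> cbox c d" for y
    proof -
      let ?u = "face_proj i (d \<bullet> i) y" and ?w = "face_proj i (c \<bullet> i) y"
      have mem: "?u \<in> cbox c d" "?w \<in> cbox c d"
        using face_proj_in_cbox[OF i y] cd[OF i] by auto
      have "(?u - x) - (?w - x) = (d \<bullet> i - c \<bullet> i) *\<^sub>R i"
        by (simp add: face_proj_def algebra_simps)
      then have "L (?u - x) - L (?w - x) = (d \<bullet> i - c \<bullet> i) *\<^sub>R L i"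
        by (simp only: linear_diff[OF lin, symmetric] linear_scale[OF lin])
      then have "(L (?u - x) - L (?w - x)) \<bullet> i = (d \<bullet> i - c \<bullet> i) * (L i \<bullet> i)"
        by simp
      then have eq: "?h i y - (d \<bullet> i - c \<bullet> i) * (L i \<bullet> i) =
        ((v ?u - v x - L (?u - x)) - (v ?w - v x - L (?w - x))) \<bullet> i"
        by (simp add: inner_diff_left)
      have "norm (?h i y - (d \<bullet> i - c \<bullet> i) * (L i \<bullet> i)) \<le> norm ((v ?u - v x - L (?u - x)) - (v ?w - v x - L (?w - x)))"
        unfolding eq real_norm_def by (rule Basis_le_norm[OF i])
      also have "\<dots> \<le> e * ?S + e * ?S"
        by (rule order_trans[OF norm_triangle_ineq4 add_mono[OF app[OF mem(1)] app[OF mem(2)]]])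
      finally show ?thesis by simp
    qed
    have S0: "0 \<le> ?S" by (intro sum_nonneg) (simp add: cd less_imp_le)
    have ic: "integral (cbox c d) (\<lambda>y. ?h i y - (d \<bullet> i - c \<bullet> i) * (L i \<bullet> i)) = integral (cbox c d) (?h i) - ?m * ((d \<bullet> i - c \<bullet> i) * (L i \<bullet> i))"
      unfolding Henstock_Kurzweil_Integration.integral_diff[OF int integrable_const] by simp
    have "norm (integral (cbox c d) (\<lambda>y. ?h i y - (d \<bullet> i - c \<bullet> i) * (L i \<bullet> i))) \<le> (2 * e * ?S) * ?m"
    proof (rule integrable_bound)
      show "0 \<le> 2 * e * ?S" using e S0 by simp
      show "(\<lambda>y. ?h i y - (d \<bullet> i - c \<bullet> i) * (L i \<bullet> i)) integrable_on cbox c d"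
        by (rule integrable_diff[OF int integrable_const])
    qed (rule pt)
    then have "\<bar>integral (cbox c d) (?h i) - ?m * ((d \<bullet> i - c \<bullet> i) * (L i \<bullet> i))\<bar> \<le> (2 * e * ?S) * ?m"
      unfolding ic real_norm_def .
    from scale[OF this l] show ?thesis .
  qed
  have eq: "box_flux v c d - ?m * (\<Sum>i\<in>Basis. L i \<bullet> i) = (\<Sum>i\<in>Basis. integral (cbox c d) (?h i) / (d \<bullet> i - c \<bullet> i) - ?m * (L i \<bullet> i))"
    unfolding box_flux_def sum_subtractf sum_distrib_left ..
  have "\<bar>box_flux v c d - ?m * (\<Sum>i\<in>Basis. L i \<bullet> i)\<bar> \<le> (\<Sum>i\<in>Basis. 2 * e * (?S / (d \<bullet> i - c \<bullet> i)) * ?m)"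
    unfolding eq by (rule order_trans[OF sum_abs sum_mono]) (rule main)
  then show ?thesis by (simp only: sum_distrib_left sum_distrib_right)
qed

text \<open>Bisecting every coordinate in turn shrinks the box without changing its shape, so that the
  ratios of its sides stay bounded.\<close>

lemma bisection_box:
  fixes a b :: "'a::euclidean_space"
  assumes split: "\<And>c d j. cbox c d \<subseteq> cbox a b \<Longrightarrow> (\<And>i. i \<in> Basis \<Longrightarrow> c \<bullet> i < d \<bullet> i) \<Longrightarrow> j \<in> Basis \<Longrightarrow>
      G c (face_proj j ((c \<bullet> j + d \<bullet> j) / 2) d) \<Longrightarrow> G (face_proj j ((c \<bullet> j + d \<bullet> j) / 2) c) d \<Longrightarrow> G c d"
    and c: "cbox c d \<subseteq> cbox a b" "\<And>i. i \<in> Basis \<Longrightarrow> c \<bullet> i < d \<bullet> i" "\<not> G c d"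
  shows "\<exists>c' d'. cbox c' d' \<subseteq> cbox c d \<and> d' - c' = (d - c) /\<^sub>R 2 \<and> \<not> G c' d'"
proof -
  have "\<exists>c' d'. cbox c' d' \<subseteq> cbox c d \<and> (\<forall>i\<in>Basis. d' \<bullet> i - c' \<bullet> i = (d \<bullet> i - c \<bullet> i) / (if i \<in> A then 2 else 1)) \<and> \<not> G c' d'"
    if "finite A" "A \<subseteq> Basis" for A
    using that
  proof (induction A)
    case empty
    then show ?case using c by (intro exI[of _ c] exI[of _ d]) auto
  next
    case (insert j A)
    then obtain c' d' where IH: "cbox c' d' \<subseteq> cbox c d" "\<not> G c' d'"
      "\<And>i. i \<in> Basis \<Longrightarrow> d' \<bullet> i - c' \<bullet> i = (d \<bullet> i - c \<bullet> i) / (if i \<in> A then 2 else 1)"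
      by auto
    have j: "j \<in> Basis" using insert by auto
    have lt: "c' \<bullet> i < d' \<bullet> i" if "i \<in> Basis" for i
      using IH(3)[OF that] c(2)[OF that] by (auto split: if_splits)
    let ?m = "(c' \<bullet> j + d' \<bullet> j) / 2"
    have am: "c' \<bullet> j \<le> ?m" "?m \<le> d' \<bullet> j" using lt[OF j] by auto
    note sp = cbox_split_mid[OF j am]
    have "\<not> G c' (face_proj j ?m d') \<or> \<not> G (face_proj j ?m c') d'"
      using split[OF subset_trans[OF IH(1) c(1)] lt j] IH(2) by blast
    then show ?case
    proof
      assume G: "\<not> G c' (face_proj j ?m d')"
      have "cbox c' (face_proj j ?m d') \<subseteq> cbox c d" using IH(1) sp(1) by blast
      moreover have "face_proj j ?m d' \<bullet> i - c' \<bullet> i = (d \<bullet> i - c \<bullet> i) / (if i \<in> insert j A then 2 else 1)"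
        if "i \<in> Basis" for i
        using IH(3)[OF that] insert(2) by (cases "i = j") (auto simp: face_proj_inner j that field_simps)
      ultimately show ?thesis using G by blast
    next
      assume G: "\<not> G (face_proj j ?m c') d'"
      have "cbox (face_proj j ?m c') d' \<subseteq> cbox c d" using IH(1) sp(2) by blast
      moreover have "d' \<bullet> i - face_proj j ?m c' \<bullet> i = (d \<bullet> i - c \<bullet> i) / (if i \<in> insert j A then 2 else 1)"
        if "i \<in> Basis" for i
        using IH(3)[OF that] insert(2) by (cases "i = j") (auto simp: face_proj_inner j that field_simps)
      ultimately show ?thesis using G by blast
    qed
  qed
  from this[of Basis] obtain c' d' where *: "cbox c' d' \<subseteq> cbox c d" "\<not> G c' d'"
    "\<And>i. i \<in> Basis \<Longrightarrow> d' \<bullet> i - c' \<bullet> i = (d \<bullet> i - c \<bullet> i) / 2" by auto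
  have "d' - c' = (d - c) /\<^sub>R 2"
    by (rule euclidean_eqI) (use * in \<open>auto simp: inner_diff_left\<close>)
  with * show ?thesis by blast
qed

lemma abs_diff_le_box:
  assumes "x \<in> cbox c d" "y \<in> cbox c d" "i \<in> Basis"
  shows "\<bar>(x - y) \<bullet> i\<bar> \<le> (d - c) \<bullet> i"
  using assms by (auto simp: mem_box inner_diff_left dest!: bspec[of _ _ i])

text \<open>A form of Cousin's lemma for boxes similar to a given one: a property that passes from the two
  halves of a box to the box, and that holds for all sufficiently small similar boxes around each point,
  holds for the box itself. Otherwise nested bad boxes would shrink to a point.\<close>

lemma cousin_bisection:
  fixes a b :: "'a::euclidean_space"
  assumes split: "\<And>c d j. cbox c d \<subseteq> cbox a b \<Longrightarrow> (\<And>i. i \<in> Basis \<Longrightarrow> c \<bullet> i < d \<bullet> i) \<Longrightarrow> j \<in> Basis \<Longrightarrow>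
      G c (face_proj j ((c \<bullet> j + d \<bullet> j) / 2) d) \<Longrightarrow> G (face_proj j ((c \<bullet> j + d \<bullet> j) / 2) c) d \<Longrightarrow> G c d"
    and leaf: "\<And>x. x \<in> cbox a b \<Longrightarrow> \<exists>\<delta>>0. \<forall>c d n. x \<in> cbox c d \<longrightarrow> cbox c d \<subseteq> cbox a b \<longrightarrow> cbox c d \<subseteq> ball x \<delta> \<longrightarrow>
        d - c = (b - a) /\<^sub>R 2 ^ n \<longrightarrow> G c d"
    and ab: "\<And>i. i \<in> Basis \<Longrightarrow> a \<bullet> i < b \<bullet> i"
  shows "G a b"
proof (rule ccontr)
  assume "\<not> G a b"
  define P where "P n z \<longleftrightarrow> cbox (fst z) (snd z) \<subseteq> cbox a b \<and> snd z - fst z = (b - a) /\<^sub>R 2 ^ n \<and> \<not> G (fst z) (snd z)"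
    for n z
  define Q where "Q z z' \<longleftrightarrow> cbox (fst z') (snd z') \<subseteq> cbox (fst z) (snd z)" for z z' :: "'a \<times> 'a"
  have len: "fst z \<bullet> i < snd z \<bullet> i" if "P n z" "i \<in> Basis" for n z i
  proof -
    have "(snd z - fst z) \<bullet> i = (b \<bullet> i - a \<bullet> i) / 2 ^ n"
      using that by (simp add: P_def divide_inverse_commute flip: inner_diff_left)
    moreover have "\<dots> > 0" using ab[OF that(2)] by simp
    ultimately show ?thesis by (simp add: inner_diff_left)
  qed
  have "\<exists>f. \<forall>n. P n (f n) \<and> Q (f n) (f (Suc n))"
  proof (rule dependent_nat_choice)
    show "\<exists>z. P 0 z" using \<open>\<not> G a b\<close> by (intro exI[of _ "(a, b)"]) (auto simp: P_def)
  next
    fix z n assume P: "P n z"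
    have "\<exists>c' d'. cbox c' d' \<subseteq> cbox (fst z) (snd z) \<and> d' - c' = (snd z - fst z) /\<^sub>R 2 \<and> \<not> G c' d'"
      by (rule bisection_box[of a b G, OF split]) (use P len[OF P] in \<open>simp_all add: P_def\<close>)
    then obtain c' d' where sub: "cbox c' d' \<subseteq> cbox (fst z) (snd z)" and eq: "d' - c' = (snd z - fst z) /\<^sub>R 2" and G: "\<not> G c' d'"
      by blast
    have "d' - c' = (b - a) /\<^sub>R 2 ^ Suc n" using P unfolding eq P_def by simp
    moreover have "cbox c' d' \<subseteq> cbox a b" using sub P unfolding P_def by (blast intro: order_trans)
    ultimately show "\<exists>z'. P (Suc n) z' \<and> Q z z'"
      using sub G by (intro exI[of _ "(c', d')"]) (simp add: P_def Q_def)
  qed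
  then obtain f where f: "\<And>n. P n (f n)" "\<And>n. Q (f n) (f (Suc n))" by blast
  define K where "K n = cbox (fst (f n)) (snd (f n))" for n
  have "decseq K" using f(2) unfolding K_def Q_def by (intro decseq_SucI) blast
  moreover have "K n \<noteq> {}" for n
    using len[OF f(1)[of n]] unfolding K_def by (simp add: box_ne_empty less_imp_le)
  moreover have "compact (K n)" for n by (simp add: K_def)
  ultimately have "\<Inter>(range K) \<noteq> {}"
    by (intro compact_nest) (auto simp: decseq_def)
  then obtain x where x: "\<And>n. x \<in> K n" by blast
  have xab: "x \<in> cbox a b" using x[of 0] f(1)[of 0] by (auto simp: K_def P_def)
  obtain \<delta> where d: "\<delta> > 0" "\<And>c d n. x \<in> cbox c d \<Longrightarrow> cbox c d \<subseteq> cbox a b \<Longrightarrow> cbox c d \<subseteq> ball x \<delta> \<Longrightarrow>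
        d - c = (b - a) /\<^sub>R 2 ^ n \<Longrightarrow> G c d" using leaf[OF xab] by blast
  have "(\<lambda>n. (\<Sum>i\<in>Basis. b \<bullet> i - a \<bullet> i) * (1 / 2) ^ n) \<longlonglongrightarrow> (\<Sum>i\<in>Basis. b \<bullet> i - a \<bullet> i) * 0"
    by (intro tendsto_intros LIMSEQ_power_zero) auto
  then have "\<forall>\<^sub>F n in sequentially. (\<Sum>i\<in>Basis. b \<bullet> i - a \<bullet> i) * (1 / 2) ^ n < \<delta>"
    by (rule order_tendstoD(2)) (use d(1) in simp)
  then obtain n where n: "(\<Sum>i\<in>Basis. b \<bullet> i - a \<bullet> i) * (1 / 2) ^ n < \<delta>"
    by (auto simp: eventually_sequentially)
  have diff: "snd (f n) - fst (f n) = (b - a) /\<^sub>R 2 ^ n" using f(1)[of n] by (simp add: P_def)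
  have "K n \<subseteq> ball x \<delta>"
  proof
    fix y assume y: "y \<in> K n"
    have "dist x y \<le> (\<Sum>i\<in>Basis. \<bar>(x - y) \<bullet> i\<bar>)"
      unfolding dist_norm by (rule norm_le_l1)
    also have "\<dots> \<le> (\<Sum>i\<in>Basis. (snd (f n) - fst (f n)) \<bullet> i)"
      using y x[of n] unfolding K_def by (intro sum_mono abs_diff_le_box)
    also have "\<dots> = (\<Sum>i\<in>Basis. b \<bullet> i - a \<bullet> i) * (1 / 2) ^ n"
      unfolding diff sum_distrib_right by (rule sum.cong) (simp_all add: inner_diff_left power_one_over field_simps)
    finally show "y \<in> ball x \<delta>" using n by simp
  qed
  then have "G (fst (f n)) (snd (f n))"
    using f(1)[of n] by (intro d(2)[OF x[of n, unfolded K_def] _ _ diff]) (simp_all add: K_def P_def)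
  then show False using f(1)[of n] by (simp add: P_def)
qed

text \<open>The property passed through the bisection is the existence of a tagged division, fine for the
  gauge, whose Riemann sum for the divergence is close to the flux.\<close>

theorem divergence_theorem_box:
  fixes v :: "'a::euclidean_space \<Rightarrow> 'a"
  assumes v: "\<And>x. x \<in> cbox a b \<Longrightarrow> (v has_derivative v' x) (at x within cbox a b)"
    and ab: "\<And>i. i \<in> Basis \<Longrightarrow> a \<bullet> i < b \<bullet> i"
    and f: "((\<lambda>x. \<Sum>i\<in>Basis. v' x i \<bullet> i) has_integral y) (cbox a b)"
  shows "y = box_flux v a b"
proof -
  let ?f = "\<lambda>x. \<Sum>i\<in>Basis. v' x i \<bullet> i"
  let ?m = "\<lambda>c d. measure lborel (cbox c d)"
  define R where "R = (\<Sum>i\<in>Basis. (\<Sum>j\<in>Basis. b \<bullet> j - a \<bullet> j) / (b \<bullet> i - a \<bullet> i))"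
  have R0: "0 \<le> R" unfolding R_def
    by (intro sum_nonneg divide_nonneg_nonneg) (simp_all add: less_imp_le[OF ab])
  have cont: "continuous_on (cbox a b) v"
    by (rule has_derivative_continuous_on[OF v])
  have key: "\<bar>y - box_flux v a b\<bar> \<le> 2 * e * ?m a b" if e: "0 < e" for e
  proof -
    obtain \<gamma> where *: "gauge \<gamma> \<and> (\<forall>p. p tagged_division_of cbox a b \<and> \<gamma> fine p \<longrightarrow>
        norm ((\<Sum>(x,K)\<in>p. measure lborel K *\<^sub>R ?f x) - y) \<le> e * ?m a b)"
      using iffD1[OF has_integral_factor_content f, THEN spec, THEN mp, OF e] ..
    note \<gamma> = conjunct1[OF *]
    have fine: "norm ((\<Sum>(x,K)\<in>p. measure lborel K *\<^sub>R ?f x) - y) \<le> e * ?m a b"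
      if "p tagged_division_of cbox a b" "\<gamma> fine p" for p
      using conjunct2[OF *] that by blast
    define G where "G c d \<longleftrightarrow> (\<exists>p. p tagged_division_of cbox c d \<and> \<gamma> fine p \<and>
       \<bar>box_flux v c d - (\<Sum>(x,K)\<in>p. measure lborel K * ?f x)\<bar> \<le> e * ?m c d)" for c d
    have "G a b"
    proof (rule cousin_bisection[of a b G, OF _ _ ab])
      fix c d :: 'a and j :: 'a
      assume cd: "cbox c d \<subseteq> cbox a b" "\<And>i. i \<in> Basis \<Longrightarrow> c \<bullet> i < d \<bullet> i" and j: "j \<in> Basis"
      let ?mid = "(c \<bullet> j + d \<bullet> j) / 2"
      assume G1: "G c (face_proj j ?mid d)" and G2: "G (face_proj j ?mid c) d"
      from G1[unfolded G_def] obtain p1 where p1: "p1 tagged_division_of cbox c (face_proj j ?mid d)" "\<gamma> fine p1"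
        and b1: "\<bar>box_flux v c (face_proj j ?mid d) - (\<Sum>(x,K)\<in>p1. measure lborel K * ?f x)\<bar> \<le> e * ?m c (face_proj j ?mid d)"
        by (elim exE conjE)
      from G2[unfolded G_def] obtain p2 where p2: "p2 tagged_division_of cbox (face_proj j ?mid c) d" "\<gamma> fine p2"
        and b2: "\<bar>box_flux v (face_proj j ?mid c) d - (\<Sum>(x,K)\<in>p2. measure lborel K * ?f x)\<bar> \<le> e * ?m (face_proj j ?mid c) d"
        by (elim exE conjE)
      have am: "c \<bullet> j \<le> ?mid" "?mid \<le> d \<bullet> j" using cd(2)[OF j] by auto
      have m: "?m c d = ?m c (face_proj j ?mid d) + ?m (face_proj j ?mid c) d"
        using content_split[OF j, of c d ?mid] unfolding cbox_split_mid[OF j am] .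
      have fl: "box_flux v c d = box_flux v c (face_proj j ?mid d) + box_flux v (face_proj j ?mid c) d"
        by (rule box_flux_bisect[OF continuous_on_subset[OF cont cd(1)] cd(2) j refl])
      note ts = tagged_sum_bisect[OF j am p1(1) p2(1)]
      show "G c d" unfolding G_def
      proof (intro exI[of _ "p1 \<union> p2"] conjI fine_Un p1(2) p2(2) ts(1))
        have "\<bar>(X + Y) - (X' + Y')\<bar> \<le> e * (A + B)" if "\<bar>X - X'\<bar> \<le> e * A" "\<bar>Y - Y'\<bar> \<le> e * B" for X X' Y Y' A B :: real
          using that unfolding distrib_left by linarith
        from this[OF b1 b2] show "\<bar>box_flux v c d - (\<Sum>(x,K)\<in>p1 \<union> p2. measure lborel K * ?f x)\<bar> \<le> e * ?m c d"
          unfolding ts(2) fl m .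
      qed
    next
      fix x assume x: "x \<in> cbox a b"
      \<comment> \<open>\<open>R\<close> is the sum of side ratios, common to all boxes similar to the given one\<close>
      define e' where "e' = e / (2 * R + 1)"
      have e': "0 < e'" using e R0 by (simp add: e'_def)
      obtain \<delta> where d: "\<delta> > 0" "\<And>y. y \<in> cbox a b \<Longrightarrow> norm (y - x) < \<delta> \<Longrightarrow> norm (v y - v x - v' x (y - x)) \<le> e' * norm (y - x)"
        using v[OF x] e' unfolding has_derivative_within_alt by blast
      obtain \<delta>' where d': "\<delta>' > 0" "ball x \<delta>' \<subseteq> \<gamma> x" 
        using gaugeD[OF \<gamma>, of x] by (meson open_contains_ball)
      show "\<exists>\<delta>>0. \<forall>c d n. x \<in> cbox c d \<longrightarrow> cbox c d \<subseteq> cbox a b \<longrightarrow> cbox c d \<subseteq> ball x \<delta> \<longrightarrow>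
        d - c = (b - a) /\<^sub>R 2 ^ n \<longrightarrow> G c d"
      proof (intro exI[of _ "min \<delta> \<delta>'"] conjI allI impI)
        show "0 < min \<delta> \<delta>'" using d d' by simp
        fix c d :: 'a and n :: nat
        assume xc: "x \<in> cbox c d" and sub: "cbox c d \<subseteq> cbox a b" and ball: "cbox c d \<subseteq> ball x (min \<delta> \<delta>')"
          and dc: "d - c = (b - a) /\<^sub>R 2 ^ n"
        have side: "d \<bullet> i - c \<bullet> i = (b \<bullet> i - a \<bullet> i) / 2 ^ n" for i
          using arg_cong[OF dc, of "\<lambda>z. z \<bullet> i"] by (simp add: inner_diff_left divide_inverse_commute)
        have cd: "c \<bullet> i < d \<bullet> i" if "i \<in> Basis" for i
        proof -
          have "0 < (b \<bullet> i - a \<bullet> i) / 2 ^ n" using ab[OF that] by simp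
          then show ?thesis using side[of i] by simp
        qed
        have Req: "(\<Sum>i\<in>Basis. (\<Sum>j\<in>Basis. d \<bullet> j - c \<bullet> j) / (d \<bullet> i - c \<bullet> i)) = R"
          unfolding R_def side sum_divide_distrib[symmetric] by simp
        have app: "norm (v y - v x - v' x (y - x)) \<le> e' * (\<Sum>i\<in>Basis. d \<bullet> i - c \<bullet> i)" if y: "y \<in> cbox c d" for y
        proof -
          have "y \<in> ball x (min \<delta> \<delta>')" "y \<in> cbox a b" using y sub ball by blast+
          then have 1: "norm (v y - v x - v' x (y - x)) \<le> e' * norm (y - x)"
            by (intro d(2)) (auto simp: dist_norm norm_minus_commute)
          have "norm (y - x) \<le> (\<Sum>i\<in>Basis. \<bar>(y - x) \<bullet> i\<bar>)" by (rule norm_le_l1)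
          also have "\<dots> \<le> (\<Sum>i\<in>Basis. d \<bullet> i - c \<bullet> i)"
            using y xc unfolding inner_diff_left[of d c, symmetric] by (intro sum_mono abs_diff_le_box)
          finally have "e' * norm (y - x) \<le> e' * (\<Sum>i\<in>Basis. d \<bullet> i - c \<bullet> i)"
            unfolding inner_diff_left using e' by (intro mult_left_mono) auto
          with 1 show ?thesis by (rule order_trans)
        qed
        have "\<bar>box_flux v c d - ?m c d * ?f x\<bar> \<le> 2 * e' * R * ?m c d"
          using box_flux_near_divergence[OF continuous_on_subset[OF cont sub] cd has_derivative_linear[OF v[OF x]]
              less_imp_le[OF e'] app] unfolding Req .
        also have "\<dots> \<le> e * ?m c d"
        proof (rule mult_right_mono)
          show "2 * e' * R \<le> e" using e R0 by (simp add: e'_def field_simps)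
        qed simp
        finally have "\<bar>box_flux v c d - (\<Sum>(x,K)\<in>{(x, cbox c d)}. measure lborel K * ?f x)\<bar> \<le> e * ?m c d"
          by simp
        moreover have "\<gamma> fine {(x, cbox c d)}" using order_trans[OF ball subset_ball[OF min.cobounded2]] d'(2)
          by (auto simp: fine_def)
        ultimately show "G c d" unfolding G_def using tagged_division_of_self[OF xc] by blast
      qed
    qed
    then obtain p where "p tagged_division_of cbox a b" "\<gamma> fine p"
       "\<bar>box_flux v a b - (\<Sum>(x,K)\<in>p. measure lborel K * ?f x)\<bar> \<le> e * ?m a b"
      unfolding G_def by blast
    with fine[of p] show ?thesis by simp
  qed
  have m0: "0 \<le> ?m a b" by simp
  have "\<bar>y - box_flux v a b\<bar> \<le> 0 + e" if "0 < e" for e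
  proof -
    have gen: "2 * (e / (2 * k + 1)) * k \<le> e" if "0 \<le> k" for k :: real
      using that \<open>0 < e\<close> by (simp add: field_simps)
    have "\<bar>y - box_flux v a b\<bar> \<le> 2 * (e / (2 * ?m a b + 1)) * ?m a b"
      using key[of "e / (2 * ?m a b + 1)"] that m0 by simp
    also note gen[OF m0]
    finally show ?thesis by simp
  qed
  then have "\<bar>y - box_flux v a b\<bar> \<le> 0" by (rule field_le_epsilon)
  then show ?thesis by simp
qed

section \<open>The law of a vector of independent random variables\<close>

lemma Basis_vec_real: "(Basis :: (real ^ 'n::finite) set) = range (\<lambda>k. axis k 1)"
  by (auto simp: Basis_vec_def)

lemma sum_Basis_vec:
  fixes f :: "real ^ 'n::finite \<Rightarrow> real"
  shows "(\<Sum>i\<in>Basis. f i) = (\<Sum>k\<in>UNIV. f (axis k 1))"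
proof -
  have "inj (\<lambda>k. axis k 1 :: real ^ 'n)" by (auto simp: inj_def axis_eq_axis)
  then show ?thesis by (simp add: Basis_vec_real sum.reindex)
qed

definition joint_density :: "('n::finite \<Rightarrow> real \<Rightarrow> real) \<Rightarrow> real ^ 'n \<Rightarrow> real" where
  "joint_density d x = (\<Prod>k\<in>UNIV. d k (x $ k))"

text \<open>Fubini's theorem for products of functions of one coordinate.\<close>

lemma nn_integral_lborel_vec_prod:
  fixes f :: "'n::finite \<Rightarrow> real \<Rightarrow> ennreal"
  assumes [measurable]: "\<And>k. f k \<in> borel_measurable borel"
  shows "(\<integral>\<^sup>+x. (\<Prod>k\<in>UNIV. f k (x $ k)) \<partial>(lborel :: (real ^ 'n) measure)) = (\<Prod>k\<in>UNIV. \<integral>\<^sup>+x. f k x \<partial>lborel)"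
proof -
  have inj: "inj (\<lambda>k. axis k 1 :: real ^ 'n)"
    by (auto simp: inj_def axis_eq_axis)
  define g :: "real ^ 'n \<Rightarrow> real \<Rightarrow> ennreal" where "g b = f (inv (\<lambda>k. axis k 1) b)" for b
  have g: "g (axis k 1) = f k" for k
    unfolding g_def using inv_f_f[OF inj, of k] by simp
  have gm [measurable]: "g b \<in> borel_measurable borel" for b by (simp add: g_def)
  have "(\<integral>\<^sup>+x. (\<Prod>b\<in>Basis. g b (x \<bullet> b)) \<partial>(lborel :: (real ^ 'n) measure)) = (\<Prod>b\<in>Basis. \<integral>\<^sup>+x. g b x \<partial>lborel)"
    by (rule nn_integral_lborel_prod) auto
  then show ?thesis
    unfolding Basis_vec_real by (simp add: prod.reindex[OF inj] g inner_axis)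
qed

lemma borel_measurable_rvec [measurable]:
  fixes X :: "'n::finite \<Rightarrow> 'a \<Rightarrow> real"
  assumes "\<And>k. X k \<in> borel_measurable M"
  shows "rvec X \<in> borel_measurable M"
proof (subst borel_measurable_euclidean_space, rule ballI)
  fix i :: "real ^ 'n" assume "i \<in> Basis"
  then obtain k where "i = axis k 1" by (auto simp: Basis_vec_def)
  then have "(\<lambda>x. rvec X x \<bullet> i) = X k" by (auto simp: inner_axis rvec_def)
  then show "(\<lambda>x. rvec X x \<bullet> i) \<in> borel_measurable M" using assms by simp
qed

text \<open>The law of the vector and the density agree on open boxes, which form a generator that is closed
  under intersection: there independence and Fubini's theorem give the same product.\<close>

lemma (in prob_space) distr_rvec:
  fixes X :: "'n::finite \<Rightarrow> 'a \<Rightarrow> real"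
  assumes indep: "indep_vars (\<lambda>_. borel) X UNIV"
    and X: "\<And>k. distributed M lborel (X k) (\<lambda>x. ennreal (d k x))"
    and d: "\<And>k x. 0 \<le> d k x"
  shows "distributed M lborel (rvec X) (\<lambda>x. ennreal (joint_density d x))"
proof -
  have Xm [measurable]: "X k \<in> borel_measurable M" for k
    using distributed_measurable[OF X[of k]] by simp
  have dm [measurable]: "d k \<in> borel_measurable borel" for k
    using distributed_real_measurable[OF _ X[of k]] d by simp
  have jm [measurable]: "joint_density d \<in> borel_measurable borel"
    unfolding joint_density_def[abs_def] by measurable
  have rm [measurable]: "rvec X \<in> borel_measurable M" by measurable
  let ?N = "density lborel (\<lambda>x. ennreal (joint_density d x)) :: (real ^ 'n) measure"
  have "distr M lborel (rvec X) = ?N"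
  proof (rule measure_eqI_generator_eq[where E="range (\<lambda>(a, b). box a b)" and \<Omega>=UNIV])
    let ?E = "range (\<lambda>(a, b). box a b) :: (real ^ 'n) set set"
    show "Int_stable ?E"
      by (auto simp: Int_stable_def box_Int_box)
    show "sets (distr M lborel (rvec X)) = sigma_sets UNIV ?E" "sets ?N = sigma_sets UNIV ?E"
      by (simp_all add: borel_eq_box)
    let ?A = "\<lambda>n::nat. box (- (real n *\<^sub>R One)) (real n *\<^sub>R One) :: (real ^ 'n) set"
    show "range ?A \<subseteq> ?E" "(\<Union>i. ?A i) = UNIV"
      unfolding UN_box_eq_UNIV by auto
    show "emeasure (distr M lborel (rvec X)) (?A i) \<noteq> \<infinity>" for i
      by (subst emeasure_distr) (auto simp: measurable_lborel2)
    fix S assume "S \<in> ?E"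
    then obtain l u where S: "S = box l u" by auto
    have box: "x \<in> box l u \<longleftrightarrow> (\<forall>k. x $ k \<in> {l $ k <..< u $ k})" for x
      by (auto simp: mem_box_cart)
    have "emeasure (distr M lborel (rvec X)) S = emeasure M (\<Inter>k\<in>UNIV. X k -` {l $ k <..< u $ k} \<inter> space M)"
      unfolding S by (subst emeasure_distr) (auto simp: box rvec_def measurable_lborel2 intro!: arg_cong[where f="emeasure M"])
    also have "\<dots> = ennreal (\<Prod>k\<in>UNIV. prob (X k -` {l $ k <..< u $ k} \<inter> space M))"
      unfolding emeasure_eq_measure by (subst indep_varsD[OF indep]) auto
    also have "\<dots> = (\<Prod>k\<in>UNIV. emeasure M (X k -` {l $ k <..< u $ k} \<inter> space M))"
      by (simp add: emeasure_eq_measure prod_ennreal)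
    also have "\<dots> = (\<Prod>k\<in>UNIV. \<integral>\<^sup>+x. ennreal (d k x) * indicator {l $ k <..< u $ k} x \<partial>lborel)"
      by (intro prod.cong refl distributed_emeasure[OF X]) simp
    also have "\<dots> = (\<integral>\<^sup>+x. (\<Prod>k\<in>UNIV. ennreal (d k (x $ k)) * indicator {l $ k <..< u $ k} (x $ k)) \<partial>lborel)"
      by (subst nn_integral_lborel_vec_prod) auto
    also have "\<dots> = (\<integral>\<^sup>+x. ennreal (joint_density d x) * indicator S x \<partial>lborel)"
    proof (intro nn_integral_cong)
      fix x :: "real ^ 'n"
      have "(\<Prod>k\<in>UNIV. indicator {l $ k <..< u $ k} (x $ k) :: ennreal) = indicator S x"
        unfolding S by (auto simp: indicator_def box)
      then show "(\<Prod>k\<in>UNIV. ennreal (d k (x $ k)) * indicator {l $ k <..< u $ k} (x $ k)) = ennreal (joint_density d x) * indicator S x"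
        by (simp add: prod.distrib joint_density_def prod_ennreal d)
    qed
    also have "\<dots> = emeasure ?N S"
      by (subst emeasure_density) (auto simp: S)
    finally show "emeasure (distr M lborel (rvec X)) S = emeasure ?N S" .
  qed auto
  then show ?thesis
    unfolding distributed_def by (auto simp: measurable_lborel2)
qed

section \<open>Tail integrals and integration by parts\<close>

text \<open>For \<open>f = g * d\<close> this is the numerator of \<open>stein_L d g\<close>. It is \<open>C\<^sup>1\<close> where \<open>f\<close> is continuous, with
  derivative \<open>- f\<close>, and it vanishes at both ends of the interval where \<open>f\<close> lives if \<open>f\<close> has integral zero.\<close>

definition tail_integral :: "(real \<Rightarrow> real) \<Rightarrow> real \<Rightarrow> real" where
  "tail_integral f x = (LBINT y:{x..}. f y)"

lemma tail_integral_has_derivative: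
  assumes f: "integrable lborel f" and I: "open I" and c: "continuous_on I f" and x: "x \<in> I"
  shows "(tail_integral f has_real_derivative - f x) (at x)"
proof -
  obtain e where e: "e > 0" "cball x e \<subseteq> I" using I x open_contains_cball by blast
  then have sub: "{x - e..x + e} \<subseteq> I" by (simp add: cball_eq_atLeastAtMost)
  have eq: "tail_integral f y = tail_integral f (x - e) - integral {x - e..y} f" if "y \<in> {x - e..x + e}" for y
  proof -
    have si: "set_integrable lborel A f" if "A \<in> sets borel" for A
      unfolding set_integrable_def using that by (intro integrable_mult_indicator f) simp
    have un: "{x - e..} = {x - e..<y} \<union> {y..}" using that by auto
    have "(LBINT t:{x - e..<y} \<union> {y..}. f t) = (LBINT t:{x - e..<y}. f t) + (LBINT t:{y..}. f t)"
      by (rule set_integral_Un[OF _ si si]) auto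
    then have "tail_integral f (x - e) = (LBINT t:{x - e..<y}. f t) + tail_integral f y"
      unfolding tail_integral_def un .
    also have "(LBINT t:{x - e..<y}. f t) = (LBINT t:{x - e..y}. f t)"
    proof (rule set_integral_cong_set)
      show "AE t in lborel. t \<in> {x - e..y} \<longleftrightarrow> t \<in> {x - e..<y}"
        using AE_lborel_singleton[of y] by eventually_elim auto
    qed (use borel_measurable_integrable[OF f] in \<open>simp_all add: set_borel_measurable_def\<close>)
    also have "\<dots> = integral {x - e..y} f"
      by (intro set_borel_integral_eq_integral si) simp
    finally show ?thesis by simp
  qed
  have "((\<lambda>y. integral {x - e..y} f) has_real_derivative f x) (at x within {x - e..x + e})"
    by (rule integral_has_real_derivative[OF continuous_on_subset[OF c sub]]) (use e in simp)
  then have "((\<lambda>y. tail_integral f (x - e) - integral {x - e..y} f) has_real_derivative 0 - f x) (at x within {x - e..x + e})"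
    by (rule DERIV_diff[OF DERIV_const])
  then have "(tail_integral f has_real_derivative 0 - f x) (at x within {x - e..x + e})"
  proof (rule has_field_derivative_transform_within[OF _ e(1)])
    show "tail_integral f (x - e) - integral {x - e..y} f = tail_integral f y" if "y \<in> {x - e..x + e}" for y
      by (rule eq[OF that, symmetric])
  qed (use e(1) in simp)
  moreover have "x \<in> interior {x - e..x + e}" using e by simp
  ultimately show ?thesis using at_within_interior[of x "{x - e..x + e}"] by simp
qed

lemma tail_integral_tendsto_upper:
  assumes f: "integrable lborel f" and z: "\<And>y. y \<notin> I \<Longrightarrow> f y = 0"
    and b: "\<And>y. y \<in> I \<Longrightarrow> \<forall>\<^sub>F n in sequentially. y < b n"
  shows "(\<lambda>n. tail_integral f (b n)) \<longlonglongrightarrow> 0"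
proof -
  have [measurable]: "f \<in> borel_measurable lborel" using f by simp
  have "(\<lambda>n. LINT y|lborel. indicator {b n..} y *\<^sub>R f y) \<longlonglongrightarrow> (LINT y|(lborel :: real measure). 0)"
  proof (rule integral_dominated_convergence[where w="\<lambda>y. norm (f y)"])
    show "AE y in lborel. (\<lambda>n. indicator {b n..} y *\<^sub>R f y) \<longlonglongrightarrow> 0"
    proof (rule AE_I2)
      fix y
      show "(\<lambda>n. indicator {b n..} y *\<^sub>R f y) \<longlonglongrightarrow> 0"
      proof (cases "y \<in> I")
        case True
        show ?thesis
          by (rule tendsto_eventually, rule eventually_mono[OF b[OF True]]) auto
      qed (simp add: z)
    qed
  qed (use f in \<open>auto split: split_indicator\<close>)
  then show ?thesis by (simp add: tail_integral_def set_lebesgue_integral_def)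
qed

lemma tail_integral_tendsto_lower:
  assumes f: "integrable lborel f" and z: "\<And>y. y \<notin> I \<Longrightarrow> f y = 0"
    and a: "\<And>y. y \<in> I \<Longrightarrow> \<forall>\<^sub>F n in sequentially. a n < y"
  shows "(\<lambda>n. tail_integral f (a n)) \<longlonglongrightarrow> (LINT y|lborel. f y)"
proof -
  have [measurable]: "f \<in> borel_measurable lborel" using f by simp
  have "(\<lambda>n. LINT y|lborel. indicator {a n..} y *\<^sub>R f y) \<longlonglongrightarrow> (LINT y|lborel. f y)"
  proof (rule integral_dominated_convergence[where w="\<lambda>y. norm (f y)"])
    show "AE y in lborel. (\<lambda>n. indicator {a n..} y *\<^sub>R f y) \<longlonglongrightarrow> f y"
    proof (rule AE_I2)
      fix y
      show "(\<lambda>n. indicator {a n..} y *\<^sub>R f y) \<longlonglongrightarrow> f y"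
      proof (cases "y \<in> I")
        case True
        show ?thesis
          by (rule tendsto_eventually, rule eventually_mono[OF a[OF True]]) auto
      qed (simp add: z)
    qed
  qed (use f in \<open>auto split: split_indicator\<close>)
  then show ?thesis by (simp add: tail_integral_def set_lebesgue_integral_def)
qed

lemma interval_exhaustion:
  fixes I :: "real set"
  assumes "open I" "connected I" "I \<noteq> {}"
  obtains a b :: "nat \<Rightarrow> real" where
    "\<forall>\<^sub>F n in sequentially. a n < b n \<and> {a n..b n} \<subseteq> I"
    "\<And>y. y \<in> I \<Longrightarrow> \<forall>\<^sub>F n in sequentially. a n < y \<and> y < b n"
proof -
  obtain C :: "nat \<Rightarrow> real set" where C: "\<And>n. compact (C n)" "\<And>n. C n \<subseteq> I"
     "\<And>K. compact K \<Longrightarrow> K \<subseteq> I \<Longrightarrow> \<exists>N. \<forall>n\<ge>N. K \<subseteq> C n"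
    by (rule open_Union_compact_subsets[OF assms(1)]) (rule that)
  define a b where "a n = Inf (C n)" and "b n = Sup (C n)" for n
  have near: "\<forall>\<^sub>F n in sequentially. a n < y \<and> y < b n \<and> C n \<noteq> {}" if y: "y \<in> I" for y
  proof -
    obtain e where e: "e > 0" "cball y e \<subseteq> I" using assms(1) y open_contains_cball by blast
    obtain N where N: "\<And>n. n \<ge> N \<Longrightarrow> cball y e \<subseteq> C n" using C(3)[OF compact_cball e(2)] by blast
    have "a n < y \<and> y < b n \<and> C n \<noteq> {}" if "n \<ge> N" for n
    proof -
      have "y - e \<in> C n" "y + e \<in> C n" using N[OF that] e(1) by (auto simp: subset_eq dist_real_def)
      moreover have "bdd_below (C n)" "bdd_above (C n)"
        using compact_imp_bounded[OF C(1)[of n]] by (simp_all add: bounded_imp_bdd_below bounded_imp_bdd_above)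
      ultimately have "a n \<le> y - e" "y + e \<le> b n" unfolding a_def b_def
        by (auto intro: cInf_lower cSup_upper)
      then show ?thesis using e(1) \<open>y - e \<in> C n\<close> by auto
    qed
    then show ?thesis by (auto simp: eventually_sequentially)
  qed
  obtain y where y: "y \<in> I" using assms by auto
  show thesis
  proof
    show "\<forall>\<^sub>F n in sequentially. a n < b n \<and> {a n..b n} \<subseteq> I"
      using near[OF y]
    proof eventually_elim
      case (elim n)
      then have "a n \<in> C n" "b n \<in> C n" unfolding a_def b_def
        using compact_imp_closed[OF C(1)[of n]] compact_imp_bounded[OF C(1)[of n]]
        by (simp_all add: closed_contains_Inf closed_contains_Sup bounded_imp_bdd_below bounded_imp_bdd_above)
      then have "a n \<in> I" "b n \<in> I" using C(2) by auto
      then have "{a n..b n} \<subseteq> I" using assms(2) connected_contains_Icc by blast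
      then show ?case using elim by simp
    qed
    show "\<forall>\<^sub>F n in sequentially. a n < z \<and> z < b n" if "z \<in> I" for z
      using near[OF that] by eventually_elim simp
  qed
qed

text \<open>The joint density with the factor of coordinate \<open>k\<close> removed; it does not depend on \<open>x $ k\<close>.\<close>

definition marginal_density :: "('n::finite \<Rightarrow> real \<Rightarrow> real) \<Rightarrow> 'n \<Rightarrow> real ^ 'n \<Rightarrow> real" where
  "marginal_density d k x = (\<Prod>j\<in>UNIV - {k}. d j (x $ j))"

lemma joint_density_split: "joint_density d x = d k (x $ k) * marginal_density d k x"
  unfolding joint_density_def marginal_density_def by (subst prod.remove[of _ k]) auto

lemma marginal_density_cong:
  "(\<And>j. j \<noteq> k \<Longrightarrow> x $ j = y $ j) \<Longrightarrow> marginal_density d k x = marginal_density d k y"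
  unfolding marginal_density_def by (intro prod.cong) auto

lemma marginal_density_nonneg: "(\<And>k x. 0 \<le> d k x) \<Longrightarrow> 0 \<le> marginal_density d k x"
  unfolding marginal_density_def by (intro prod_nonneg) auto

lemma marginal_density_has_derivative:
  assumes "\<And>j. d j differentiable (at (x $ j))"
  obtains P' where "(marginal_density d k has_derivative P') (at x)" "P' (axis k 1) = 0"
proof -
  have "\<forall>j. \<exists>D. (d j has_real_derivative D) (at (x $ j))"
    using assms by (simp add: real_differentiable_def)
  from choice[OF this] obtain D where D: "(d j has_real_derivative D j) (at (x $ j))" for j by blast
  have 1: "((\<lambda>x. d j (x $ j)) has_derivative (\<lambda>h. D j * h $ j)) (at x)" for j
  proof -
    have "((\<lambda>x. x $ j) has_derivative (\<lambda>h. h $ j)) (at x)"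
      by (rule bounded_linear_imp_has_derivative[OF bounded_linear_vec_nth])
    from has_derivative_compose[OF this D[of j, unfolded has_field_derivative_def]] show ?thesis .
  qed
  show thesis
  proof
    show "(marginal_density d k has_derivative
      (\<lambda>h. \<Sum>j\<in>UNIV - {k}. D j * h $ j * (\<Prod>i\<in>UNIV - {k} - {j}. d i (x $ i)))) (at x)"
      unfolding marginal_density_def[abs_def] by (rule has_derivative_prod) (rule 1)
  qed (simp add: axis_def)
qed

text \<open>Integrating out the other coordinates costs at most their total mass one and leaves the length
  of the box in direction \<open>k\<close>. This is what bounds the flux through the faces.\<close>

lemma marginal_density_integral_le:
  fixes a b :: "real ^ 'n::finite"
  assumes d: "\<And>k x. 0 \<le> d k x" and dm [measurable]: "\<And>k. d k \<in> borel_measurable borel"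
    and one: "\<And>k. (\<integral>\<^sup>+x. ennreal (d k x) \<partial>lborel) = 1"
    and ab: "a $ k \<le> b $ k"
    and int: "marginal_density d k integrable_on cbox a b"
  shows "integral (cbox a b) (marginal_density d k) \<le> b $ k - a $ k"
proof -
  let ?P = "marginal_density d k"
  have m [measurable]: "?P \<in> borel_measurable borel" unfolding marginal_density_def[abs_def] by measurable
  have "(\<integral>\<^sup>+x. ennreal (?P x) * indicator (cbox a b) x \<partial>lborel)
     \<le> (\<integral>\<^sup>+x. (\<Prod>j\<in>UNIV. if j = k then indicator {a $ k..b $ k} (x $ j) else ennreal (d j (x $ j))) \<partial>lborel)"
  proof (rule nn_integral_mono)
    fix x :: "real ^ 'n"
    have "(\<Prod>j\<in>UNIV. if j = k then indicator {a $ k..b $ k} (x $ j) else ennreal (d j (x $ j))) = indicator {a $ k..b $ k} (x $ k) * ennreal (?P x)"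
      unfolding marginal_density_def
      by (subst prod.remove[of _ k]) (auto simp: prod_ennreal d)
    moreover have "(indicator (cbox a b) x :: ennreal) \<le> indicator {a $ k..b $ k} (x $ k)"
      by (auto simp: indicator_def mem_box_cart)
    ultimately show "ennreal (?P x) * indicator (cbox a b) x \<le> (\<Prod>j\<in>UNIV. if j = k then indicator {a $ k..b $ k} (x $ j) else ennreal (d j (x $ j)))"
      by (simp add: mult.commute mult_left_mono)
  qed
  also have "\<dots> = (\<Prod>j\<in>UNIV. \<integral>\<^sup>+y. (if j = k then indicator {a $ k..b $ k} y else ennreal (d j y)) \<partial>lborel)"
    by (rule nn_integral_lborel_vec_prod) measurable
  also have "\<dots> = ennreal (b $ k - a $ k)"
    by (subst prod.remove[of _ k]) (use ab one in simp_all)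
  finally have le: "(\<integral>\<^sup>+x. ennreal (?P x) * indicator (cbox a b) x \<partial>lborel) \<le> ennreal (b $ k - a $ k)"
    by simp
  have eq: "(\<integral>\<^sup>+x. ennreal (indicator (cbox a b) x * ?P x) \<partial>lborel) = (\<integral>\<^sup>+x. ennreal (?P x) * indicator (cbox a b) x \<partial>lborel)"
    by (intro nn_integral_cong) (auto simp: indicator_def)
  have nn: "0 \<le> ?P x" for x by (rule marginal_density_nonneg[OF d])
  have si: "set_integrable lborel (cbox a b) ?P"
    unfolding set_integrable_def real_scaleR_def
    by (rule integrableI_nonneg) (use le eq nn in \<open>auto simp: less_top[symmetric] top_unique\<close>)
  have "ennreal (integral (cbox a b) ?P) = ennreal (LINT x:cbox a b|lborel. ?P x)"
    by (simp add: set_borel_integral_eq_integral(2)[OF si])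
  also have "\<dots> = (\<integral>\<^sup>+x. ennreal (indicator (cbox a b) x * ?P x) \<partial>lborel)"
    unfolding set_lebesgue_integral_def real_scaleR_def
    by (rule nn_integral_eq_integral[symmetric]) (use si nn in \<open>auto simp: set_integrable_def\<close>)
  also have "\<dots> \<le> ennreal (b $ k - a $ k)" using le eq by simp
  finally show ?thesis using ab by simp
qed

lemma stein_L_eq_tail_integral:
  "stein_L d g x = tail_integral (\<lambda>y. g y * d y) x / d x"
  by (simp add: stein_L_def tail_integral_def)

text \<open>On the range of the vector the \<open>k\<close>-th component is \<open>U\<close> times \<open>stein_L (d k) (g k)\<close> times the
  joint density. In this form the density \<open>d k\<close> cancels, so that differentiating in direction \<open>k\<close> involves no
  derivative of \<open>d k\<close>.\<close>

definition stein_field :: "('n::finite \<Rightarrow> real \<Rightarrow> real) \<Rightarrow> ('n \<Rightarrow> real \<Rightarrow> real) \<Rightarrow> (real ^ 'n \<Rightarrow> real) \<Rightarrow> real ^ 'n \<Rightarrow> real ^ 'n"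
  where "stein_field d g U x =
    (\<chi> k. U x * (tail_integral (\<lambda>y. g k y * d k y) (x $ k) * marginal_density d k x))"

text \<open>Differentiating the numerator \<open>tail_integral\<close> produces \<open>- g k * d k\<close>, and the remaining factors
  are constant in direction \<open>k\<close>.\<close>

lemma stein_field_has_divergence:
  fixes d g :: "'n::finite \<Rightarrow> real \<Rightarrow> real"
  assumes I: "\<And>k. open (I k)"
    and d_pos: "\<And>k x. x \<in> I k \<Longrightarrow> 0 < d k x"
    and d_diff: "\<And>k x. x \<in> I k \<Longrightarrow> d k differentiable (at x)"
    and g_cont: "\<And>k. continuous_on (I k) (g k)"
    and g_int: "\<And>k. integrable lborel (\<lambda>y. g k y * d k y)"
    and x: "x \<in> prod_range I"
    and U: "(U has_derivative U') (at x)"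
  shows "\<exists>L. (stein_field d g U has_derivative L) (at x) \<and>
    (\<Sum>i\<in>Basis. L i \<bullet> i) = joint_density d x *
      ((\<Sum>k\<in>UNIV. U' (axis k 1) * stein_L (d k) (g k) (x $ k)) - U x * (\<Sum>k\<in>UNIV. g k (x $ k)))"
proof -
  let ?G = "\<lambda>k. tail_integral (\<lambda>y. g k y * d k y)"
  have xI: "x $ k \<in> I k" for k using x by (simp add: prod_range_def)
  have "\<forall>k. \<exists>P'. (marginal_density d k has_derivative P') (at x) \<and> P' (axis k 1) = 0"
    using marginal_density_has_derivative[of d x] d_diff[OF xI] by metis
  from choice[OF this] obtain P' where P': "(marginal_density d k has_derivative P' k) (at x)" "P' k (axis k 1) = 0" for k
    by blast
  have "continuous_on (I k) (\<lambda>y. g k y * d k y)" for k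
    by (intro continuous_on_mult g_cont continuous_at_imp_continuous_on ballI differentiable_imp_continuous_within d_diff)
  then have "(?G k has_real_derivative - (g k (x $ k) * d k (x $ k))) (at (x $ k))" for k
    by (intro tail_integral_has_derivative[OF g_int I _ xI])
  note dG = has_derivative_compose[OF bounded_linear_imp_has_derivative[OF bounded_linear_vec_nth] this[unfolded has_field_derivative_def]]
  define L where "L h = (\<chi> k. U x * (?G k (x $ k) * P' k h + (- (g k (x $ k) * d k (x $ k))) * h $ k * marginal_density d k x)
     + U' h * (?G k (x $ k) * marginal_density d k x))" for h
  have "((\<lambda>x. stein_field d g U x $ k) has_derivative (\<lambda>h. L h $ k)) (at x)" for k
    unfolding stein_field_def L_def vec_lambda_beta
    by (rule has_derivative_mult[OF U has_derivative_mult[OF dG P'(1)]])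
  then have "(stein_field d g U has_derivative L) (at x)"
    unfolding has_derivative_componentwise_within[of "stein_field d g U"] Basis_vec_real
    by (auto simp: inner_axis)
  moreover have "(\<Sum>i\<in>Basis. L i \<bullet> i) = (\<Sum>k\<in>UNIV. L (axis k 1) $ k)"
    by (simp add: sum_Basis_vec inner_axis)
  moreover have "L (axis k 1) $ k = joint_density d x * (U' (axis k 1) * stein_L (d k) (g k) (x $ k)) - joint_density d x * U x * g k (x $ k)" for k
  proof -
    have eq: "?G k (x $ k) = stein_L (d k) (g k) (x $ k) * d k (x $ k)"
      using d_pos[OF xI[of k]] by (simp add: stein_L_eq_tail_integral)
    have "(axis k 1 :: real ^ 'n) $ k = 1" by (simp add: axis_def)
    then have "L (axis k 1) $ k = U x * (- (g k (x $ k) * d k (x $ k)) * marginal_density d k x)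
      + U' (axis k 1) * (?G k (x $ k) * marginal_density d k x)"
      by (simp add: L_def P'(2))
    then show ?thesis
      unfolding eq joint_density_split[of d x k] by (simp add: algebra_simps)
  qed
  ultimately show ?thesis
    by (intro exI[of _ L]) (simp add: sum_subtractf sum_distrib_left right_diff_distrib mult.assoc)
qed

lemma stein_field_box_flux_le:
  fixes d g :: "'n::finite \<Rightarrow> real \<Rightarrow> real"
  assumes d0: "\<And>k x. 0 \<le> d k x" and dm: "\<And>k. d k \<in> borel_measurable borel"
    and one: "\<And>k. (\<integral>\<^sup>+x. ennreal (d k x) \<partial>lborel) = 1"
    and cd: "\<And>k. continuous_on {a $ k..b $ k} (d k)"
    and cv: "continuous_on (cbox a b) (stein_field d g U)"
    and ab: "\<And>k. a $ k < b $ k"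
    and B: "\<And>x. x \<in> cbox a b \<Longrightarrow> \<bar>U x\<bar> \<le> B"
  shows "\<bar>box_flux (stein_field d g U) a b\<bar> \<le> (\<Sum>k\<in>UNIV. B * (\<bar>tail_integral (\<lambda>y. g k y * d k y) (a $ k)\<bar> + \<bar>tail_integral (\<lambda>y. g k y * d k y) (b $ k)\<bar>))"
proof -
  let ?G = "\<lambda>k. tail_integral (\<lambda>y. g k y * d k y)" and ?v = "stein_field d g U"
  have P_int: "marginal_density d k integrable_on cbox a b" for k
  proof (rule integrable_continuous, unfold marginal_density_def[abs_def], rule continuous_on_prod)
    fix j assume "j \<in> UNIV - {k}"
    show "continuous_on (cbox a b) (\<lambda>x. d j (x $ j))"
      by (rule continuous_on_compose2[OF cd]) (auto intro!: continuous_intros simp: mem_box_cart)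
  qed
  have B0: "0 \<le> B"
  proof -
    have "a \<in> cbox a b" using ab by (auto simp: mem_box_cart less_imp_le)
    from B[OF this] show ?thesis by simp
  qed
  have *: "\<bar>integral (cbox a b) (\<lambda>x. ?v (face_proj i (b \<bullet> i) x) \<bullet> i - ?v (face_proj i (a \<bullet> i) x) \<bullet> i) / (b \<bullet> i - a \<bullet> i)\<bar>
      \<le> B * (\<bar>?G k (a $ k)\<bar> + \<bar>?G k (b $ k)\<bar>)" if i: "i = axis k 1" for i k
  proof -
    have iB: "i \<in> Basis" by (simp add: i Basis_vec_real)
    have ip: "z \<bullet> i = z $ k" for z by (simp add: i inner_axis)
    have val: "?v (face_proj i c x) \<bullet> i = U (face_proj i c x) * (?G k c * marginal_density d k x)" for c x
    proof -
      have "face_proj i c x $ k = c" using face_proj_inner[OF iB iB, of c x] by (simp add: ip)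
      moreover have "face_proj i c x $ j = x $ j" if "j \<noteq> k" for j
        using that by (simp add: face_proj_def i axis_def)
      then have "marginal_density d k (face_proj i c x) = marginal_density d k x"
        by (rule marginal_density_cong)
      ultimately show ?thesis by (simp add: ip stein_field_def)
    qed
    have bd: "\<bar>?v (face_proj i c x) \<bullet> i\<bar> \<le> B * \<bar>?G k c\<bar> * marginal_density d k x"
      if x: "x \<in> cbox a b" and c: "a $ k \<le> c" "c \<le> b $ k" for x c
    proof -
      have "face_proj i c x \<in> cbox a b" by (rule face_proj_in_cbox[OF iB x]) (use c in \<open>simp_all add: ip\<close>)
      from B[OF this] have "\<bar>U (face_proj i c x)\<bar> * (\<bar>?G k c\<bar> * marginal_density d k x) \<le> B * (\<bar>?G k c\<bar> * marginal_density d k x)"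
        by (rule mult_right_mono) (simp add: marginal_density_nonneg[OF d0])
      then show ?thesis
        unfolding val abs_mult by (simp add: marginal_density_nonneg[OF d0] mult.assoc)
    qed
    have int: "(\<lambda>x. ?v (face_proj i (b \<bullet> i) x) \<bullet> i - ?v (face_proj i (a \<bullet> i) x) \<bullet> i) integrable_on cbox a b"
      by (intro integrable_diff integrable_continuous continuous_on_face[OF cv iB])
         (simp_all add: ip less_imp_le[OF ab])
    have "norm (integral (cbox a b) (\<lambda>x. ?v (face_proj i (b \<bullet> i) x) \<bullet> i - ?v (face_proj i (a \<bullet> i) x) \<bullet> i))
      \<le> integral (cbox a b) (\<lambda>x. B * (\<bar>?G k (a $ k)\<bar> + \<bar>?G k (b $ k)\<bar>) * marginal_density d k x)"
    proof (rule integral_norm_bound_integral[OF int])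
      show "(\<lambda>x. B * (\<bar>?G k (a $ k)\<bar> + \<bar>?G k (b $ k)\<bar>) * marginal_density d k x) integrable_on cbox a b"
        by (rule integrable_cmul[OF P_int, unfolded real_scaleR_def])
      fix x assume x: "x \<in> cbox a b"
      show "norm (?v (face_proj i (b \<bullet> i) x) \<bullet> i - ?v (face_proj i (a \<bullet> i) x) \<bullet> i) \<le> B * (\<bar>?G k (a $ k)\<bar> + \<bar>?G k (b $ k)\<bar>) * marginal_density d k x"
        using bd[OF x order_refl less_imp_le[OF ab]] bd[OF x less_imp_le[OF ab] order_refl]
        unfolding ip real_norm_def distrib_left distrib_right by linarith
    qed
    also have "\<dots> = B * (\<bar>?G k (a $ k)\<bar> + \<bar>?G k (b $ k)\<bar>) * integral (cbox a b) (marginal_density d k)"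
      by (rule integral_mult_right)
    also have "\<dots> \<le> B * (\<bar>?G k (a $ k)\<bar> + \<bar>?G k (b $ k)\<bar>) * (b $ k - a $ k)"
      by (intro mult_left_mono marginal_density_integral_le[OF d0 dm one] P_int less_imp_le[OF ab] mult_nonneg_nonneg B0) simp
    finally show ?thesis using ab[of k] by (simp add: ip pos_divide_le_eq)
  qed
  have "\<bar>box_flux ?v a b\<bar> \<le> (\<Sum>k\<in>UNIV. \<bar>integral (cbox a b) (\<lambda>x. ?v (face_proj (axis k 1) (b \<bullet> axis k 1) x) \<bullet> axis k 1 - ?v (face_proj (axis k 1) (a \<bullet> axis k 1) x) \<bullet> axis k 1) / (b \<bullet> axis k 1 - a \<bullet> axis k 1)\<bar>)"
    unfolding box_flux_def sum_Basis_vec by (rule sum_abs)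
  also have "\<dots> \<le> (\<Sum>k\<in>UNIV. B * (\<bar>?G k (a $ k)\<bar> + \<bar>?G k (b $ k)\<bar>))"
    by (intro sum_mono *[OF refl])
  finally show ?thesis .
qed

text \<open>Integration by parts: the operator \<open>U \<mapsto> \<Sum>k. \<partial>U/\<partial>x\<^sub>k * stein_L (d k) (g k)\<close> is dual, with respect
  to the joint law, to multiplication by \<open>\<Sum>k. g k\<close>. The divergence theorem is applied on boxes that exhaust the
  range of the vector. The flux through their faces tends to zero, since \<open>U\<close> is bounded and the tail integrals
  vanish at the ends of the intervals. Only the combination of all terms is assumed to be integrable.\<close>

theorem stein_integration_by_parts:
  fixes d g :: "'n::finite \<Rightarrow> real \<Rightarrow> real" and U :: "real ^ 'n \<Rightarrow> real"
  assumes I: "\<And>k. open (I k)" "\<And>k. connected (I k)"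
    and d0: "\<And>k x. 0 \<le> d k x" and dm: "\<And>k. d k \<in> borel_measurable borel"
    and one: "\<And>k. (\<integral>\<^sup>+x. ennreal (d k x) \<partial>lborel) = 1"
    and d_pos: "\<And>k x. x \<in> I k \<Longrightarrow> 0 < d k x"
    and d_zero: "\<And>k x. x \<notin> I k \<Longrightarrow> d k x = 0"
    and d_diff: "\<And>k x. x \<in> I k \<Longrightarrow> d k differentiable (at x)"
    and g_cont: "\<And>k. continuous_on (I k) (g k)"
    and g_int: "\<And>k. integrable lborel (\<lambda>y. g k y * d k y)"
    and g_mean: "\<And>k. (LINT y|lborel. g k y * d k y) = 0"
    and U: "\<And>x. x \<in> prod_range I \<Longrightarrow> (U has_derivative U' x) (at x)"
    and B: "\<And>x. x \<in> prod_range I \<Longrightarrow> \<bar>U x\<bar> \<le> B"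
    and int: "integrable lborel (\<lambda>x. joint_density d x *
      ((\<Sum>k\<in>UNIV. U' x (axis k 1) * stein_L (d k) (g k) (x $ k)) - U x * (\<Sum>k\<in>UNIV. g k (x $ k))))"
  shows "(LINT x|lborel. joint_density d x *
      ((\<Sum>k\<in>UNIV. U' x (axis k 1) * stein_L (d k) (g k) (x $ k)) - U x * (\<Sum>k\<in>UNIV. g k (x $ k)))) = 0"
    (is "integral\<^sup>L lborel ?f = 0")
proof -
  let ?G = "\<lambda>k. tail_integral (\<lambda>y. g k y * d k y)" and ?v = "stein_field d g U"
  have ne: "I k \<noteq> {}" for k
  proof
    assume "I k = {}"
    then have "d k x = 0" for x using d_zero by simp
    then show False using one[of k] by simp
  qed
  have "\<forall>k. \<exists>ab :: (nat \<Rightarrow> real) \<times> (nat \<Rightarrow> real). (\<forall>\<^sub>F n in sequentially. fst ab n < snd ab n \<and> {fst ab n..snd ab n} \<subseteq> I k) \<and>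
     (\<forall>y\<in>I k. \<forall>\<^sub>F n in sequentially. fst ab n < y \<and> y < snd ab n)"
  proof
    fix k
    obtain a b :: "nat \<Rightarrow> real" where "\<forall>\<^sub>F n in sequentially. a n < b n \<and> {a n..b n} \<subseteq> I k"
      "\<And>y. y \<in> I k \<Longrightarrow> \<forall>\<^sub>F n in sequentially. a n < y \<and> y < b n"
      by (rule interval_exhaustion[OF I ne]) (rule that)
    then show "\<exists>ab :: (nat \<Rightarrow> real) \<times> (nat \<Rightarrow> real). (\<forall>\<^sub>F n in sequentially. fst ab n < snd ab n \<and> {fst ab n..snd ab n} \<subseteq> I k) \<and>
     (\<forall>y\<in>I k. \<forall>\<^sub>F n in sequentially. fst ab n < y \<and> y < snd ab n)"
      by (intro exI[of _ "(a, b)"]) simp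
  qed
  from choice[OF this] obtain ab :: "'n \<Rightarrow> (nat \<Rightarrow> real) \<times> (nat \<Rightarrow> real)" where
    ab1: "\<And>k. \<forall>\<^sub>F n in sequentially. fst (ab k) n < snd (ab k) n \<and> {fst (ab k) n..snd (ab k) n} \<subseteq> I k" and
    ab2: "\<And>k y. y \<in> I k \<Longrightarrow> \<forall>\<^sub>F n in sequentially. fst (ab k) n < y \<and> y < snd (ab k) n"
    by blast
  define a b :: "nat \<Rightarrow> real ^ 'n" where "a n = (\<chi> k. fst (ab k) n)" and "b n = (\<chi> k. snd (ab k) n)" for n
  \<comment> \<open>the bound for the flux out of the \<open>n\<close>-th box\<close>
  define C where "C n = (\<Sum>k\<in>UNIV. B * (\<bar>?G k (a n $ k)\<bar> + \<bar>?G k (b n $ k)\<bar>))" for n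
  have fz: "g k y * d k y = 0" if "y \<notin> I k" for k y using d_zero[OF that] by simp
  have "(\<lambda>n. ?G k (a n $ k)) \<longlonglongrightarrow> 0" "(\<lambda>n. ?G k (b n $ k)) \<longlonglongrightarrow> 0" for k
  proof -
    have "\<forall>\<^sub>F n in sequentially. a n $ k < y" "\<forall>\<^sub>F n in sequentially. y < b n $ k" if "y \<in> I k" for y
      using ab2[OF that] by (auto simp: a_def b_def elim: eventually_mono)
    then show "(\<lambda>n. ?G k (a n $ k)) \<longlonglongrightarrow> 0" "(\<lambda>n. ?G k (b n $ k)) \<longlonglongrightarrow> 0"
      using tail_integral_tendsto_lower[OF g_int[of k] fz, where a="\<lambda>n. a n $ k"]
        tail_integral_tendsto_upper[OF g_int[of k] fz, where b="\<lambda>n. b n $ k"] by (simp_all add: g_mean)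
  qed
  then have "C \<longlonglongrightarrow> (\<Sum>k\<in>(UNIV :: 'n set). B * (\<bar>0\<bar> + \<bar>0\<bar>))"
    unfolding C_def[abs_def] by (intro tendsto_sum tendsto_mult tendsto_const tendsto_add tendsto_rabs)
  then have C0: "C \<longlonglongrightarrow> 0" by simp
  have "\<forall>\<^sub>F n in sequentially. \<forall>k. fst (ab k) n < snd (ab k) n \<and> {fst (ab k) n..snd (ab k) n} \<subseteq> I k"
    by (rule eventually_all_finite) (rule ab1)
  then have bound: "\<forall>\<^sub>F n in sequentially. norm (LINT x:cbox (a n) (b n)|lborel. ?f x) \<le> C n"
  proof eventually_elim
    case (elim n)
    then have lt: "a n $ k < b n $ k" and sub: "{a n $ k..b n $ k} \<subseteq> I k" for k
      by (simp_all add: a_def b_def)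
    have subI: "x \<in> prod_range I" if x: "x \<in> cbox (a n) (b n)" for x
    proof -
      have "x $ k \<in> {a n $ k..b n $ k}" for k using x by (simp add: mem_box_cart)
      then show ?thesis using sub unfolding prod_range_def by blast
    qed
    have "\<exists>L. (?v has_derivative L) (at x) \<and> (\<Sum>i\<in>Basis. L i \<bullet> i) = ?f x" if x: "x \<in> cbox (a n) (b n)" for x
      by (rule stein_field_has_divergence[OF I(1) d_pos d_diff g_cont g_int subI[OF x] U[OF subI[OF x]]])
    then have "\<forall>x\<in>cbox (a n) (b n). \<exists>L. (?v has_derivative L) (at x) \<and> (\<Sum>i\<in>Basis. L i \<bullet> i) = ?f x"
      by (rule ballI)
    from bchoice[OF this] obtain L where L: "(?v has_derivative L x) (at x)" "(\<Sum>i\<in>Basis. L x i \<bullet> i) = ?f x"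
      if "x \<in> cbox (a n) (b n)" for x by blast
    note L' = has_derivative_at_withinI[OF L(1)]
    have si: "set_integrable lborel (cbox (a n) (b n)) ?f"
      unfolding set_integrable_def by (intro integrable_mult_indicator int) simp
    have "(?f has_integral integral (cbox (a n) (b n)) ?f) (cbox (a n) (b n))"
      by (rule integrable_integral[OF set_borel_integral_eq_integral(1)[OF si]])
    then have hi: "((\<lambda>x. \<Sum>i\<in>Basis. L x i \<bullet> i) has_integral integral (cbox (a n) (b n)) ?f) (cbox (a n) (b n))"
      by (rule has_integral_eq[rotated]) (simp add: L(2))
    have ltB: "a n \<bullet> i < b n \<bullet> i" if "i \<in> Basis" for i
      using that lt by (auto simp: Basis_vec_real inner_axis)
    have eq: "integral (cbox (a n) (b n)) ?f = box_flux ?v (a n) (b n)"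
      by (rule divergence_theorem_box[OF L' ltB hi])
    have cd: "continuous_on {a n $ k..b n $ k} (d k)" for k
      using sub[of k] d_diff by (intro continuous_at_imp_continuous_on ballI differentiable_imp_continuous_within) blast
    have "\<bar>box_flux ?v (a n) (b n)\<bar> \<le> C n"
      unfolding C_def
      by (rule stein_field_box_flux_le[OF d0 dm one cd has_derivative_continuous_on[OF L'] lt B[OF subI]])
    then show ?case
      by (simp add: set_borel_integral_eq_integral(2)[OF si] eq)
  qed
  have fm: "?f \<in> borel_measurable lborel" using int by (rule borel_measurable_integrable)
  have f0: "?f x = 0" if "x \<notin> prod_range I" for x
  proof -
    have "\<exists>k. x $ k \<notin> I k" using that unfolding prod_range_def by blast
    then obtain k where "x $ k \<notin> I k" ..
    then have "d k (x $ k) = 0" by (rule d_zero)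
    then show ?thesis by (simp add: joint_density_split[of d x k])
  qed
  have "(\<lambda>n. LINT x:cbox (a n) (b n)|lborel. ?f x) \<longlonglongrightarrow> integral\<^sup>L lborel ?f"
    unfolding set_lebesgue_integral_def
  proof (rule integral_dominated_convergence[where w="\<lambda>x. norm (?f x)"])
    show "AE x in lborel. (\<lambda>n. indicator (cbox (a n) (b n)) x *\<^sub>R ?f x) \<longlonglongrightarrow> ?f x"
    proof (rule AE_I2)
      fix x
      show "(\<lambda>n. indicator (cbox (a n) (b n)) x *\<^sub>R ?f x) \<longlonglongrightarrow> ?f x"
      proof (cases "x \<in> prod_range I")
        case True
        then have "x $ k \<in> I k" for k by (simp add: prod_range_def)
        from ab2[OF this] have "\<forall>\<^sub>F n in sequentially. \<forall>k. fst (ab k) n < x $ k \<and> x $ k < snd (ab k) n"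
          by (rule eventually_all_finite)
        then have "\<forall>\<^sub>F n in sequentially. indicator (cbox (a n) (b n)) x *\<^sub>R ?f x = ?f x"
        proof eventually_elim
          case (elim n)
          then have "x \<in> cbox (a n) (b n)" by (simp add: mem_box_cart a_def b_def less_imp_le)
          then show ?case by simp
        qed
        then show ?thesis by (rule tendsto_eventually)
      next
        case False
        show ?thesis unfolding f0[OF False] by simp
      qed
    qed
    show "integrable lborel (\<lambda>x. norm (?f x))" by (rule integrable_norm[OF int])
    show "(\<lambda>x. indicator (cbox (a n) (b n)) x *\<^sub>R ?f x) \<in> borel_measurable lborel" for n
      by (rule borel_measurable_scaleR[OF _ fm]) simp
    show "AE x in lborel. norm (indicator (cbox (a n) (b n)) x *\<^sub>R ?f x) \<le> norm (?f x)" for n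
      by (rule AE_I2) (simp add: indicator_def)
  qed (rule fm)
  moreover have "(\<lambda>n. LINT x:cbox (a n) (b n)|lborel. ?f x) \<longlonglongrightarrow> 0"
    by (rule Lim_null_comparison[OF bound C0])
  ultimately show ?thesis by (rule LIMSEQ_unique)
qed

section \<open>From an integration by parts identity to the score\<close>

text \<open>A random variable \<open>\<Theta>\<close> against which \<open>\<phi> (Y)\<close> has the same mean as \<open>\<phi>' (Y)\<close>. If \<open>Y\<close> has a density \<open>p\<close>
  whose score is \<open>\<rho>\<close>, then \<open>- \<rho> (Y)\<close> is such a weight; conversely the conditional mean of any weight
  given \<open>Y\<close> will turn out to be \<open>- \<rho> (Y)\<close>.\<close>

definition ibp_weight :: "'a measure \<Rightarrow> ('a \<Rightarrow> real) \<Rightarrow> ('a \<Rightarrow> real) \<Rightarrow> bool" where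
  "ibp_weight M Y \<Theta> \<longleftrightarrow> Y \<in> borel_measurable M \<and> integrable M \<Theta> \<and>
    (\<forall>\<phi> \<phi>' B. (\<forall>x. (\<phi> has_real_derivative \<phi>' x) (at x)) \<longrightarrow> continuous_on UNIV \<phi>' \<longrightarrow>
      (\<forall>x. \<bar>\<phi> x\<bar> \<le> B) \<longrightarrow> (\<forall>x. \<bar>\<phi>' x\<bar> \<le> B) \<longrightarrow>
      (LINT \<omega>|M. \<phi>' (Y \<omega>)) = (LINT \<omega>|M. \<phi> (Y \<omega>) * \<Theta> \<omega>))"

text \<open>Smooth approximations of the absolute value, used to build test functions whose derivatives
  approximate the indicator function of an interval.\<close>

definition smooth_abs :: "real \<Rightarrow> real \<Rightarrow> real" where
  "smooth_abs c x = sqrt (x\<^sup>2 + c)"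

lemma smooth_abs_deriv:
  assumes "c > 0"
  shows "(smooth_abs c has_real_derivative x / smooth_abs c x) (at x)"
proof -
  have "x\<^sup>2 + c > 0" using assms by (simp add: add_nonneg_pos)
  then show ?thesis
    unfolding smooth_abs_def[abs_def]
    by (auto intro!: derivative_eq_intros simp: field_simps)
qed

lemma smooth_abs_ge: "c \<ge> 0 \<Longrightarrow> \<bar>x\<bar> \<le> smooth_abs c x"
  unfolding smooth_abs_def by (rule real_le_rsqrt) simp

lemma smooth_abs_lipschitz: "c \<ge> 0 \<Longrightarrow> \<bar>smooth_abs c x - smooth_abs c y\<bar> \<le> \<bar>x - y\<bar>"
  using norm_triangle_ineq3[of "(x, sqrt c)" "(y, sqrt c)"]
  by (simp add: norm_Pair smooth_abs_def)

lemma smooth_abs_quotient_le: "c > 0 \<Longrightarrow> \<bar>x / smooth_abs c x\<bar> \<le> 1"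
  using smooth_abs_ge[of c x] by (simp add: abs_le_iff field_simps) (cases "smooth_abs c x = 0"; auto simp: divide_le_eq le_divide_eq)

lemma smooth_abs_tendsto: "(\<lambda>n. smooth_abs (1 / real (Suc n)) x) \<longlonglongrightarrow> \<bar>x\<bar>"
proof -
  have "(\<lambda>n. sqrt (x\<^sup>2 + 1 / real (Suc n))) \<longlonglongrightarrow> sqrt (x\<^sup>2 + 0)"
    using LIMSEQ_inverse_real_of_nat by (intro tendsto_real_sqrt tendsto_add tendsto_const) (simp add: inverse_eq_divide)
  then show ?thesis by (simp add: smooth_abs_def)
qed

lemma smooth_abs_quotient_tendsto: "(\<lambda>n. x / smooth_abs (1 / real (Suc n)) x) \<longlonglongrightarrow> sgn x"
proof (cases "x = 0")
  case False
  then have "(\<lambda>n. x / smooth_abs (1 / real (Suc n)) x) \<longlonglongrightarrow> x / \<bar>x\<bar>"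
    by (intro tendsto_divide smooth_abs_tendsto tendsto_const) simp
  then show ?thesis by (simp add: sgn_real_def abs_real_def split: if_splits)
qed simp

text \<open>The identity for the test function \<open>(\<bar>y - a\<bar> - \<bar>y - b\<bar>) / 2\<close>, whose derivative is the indicator
  function of \<open>{a<..<b}\<close> with value \<open>1/2\<close> at the end points. It is bounded, although its two terms are not.\<close>

lemma (in prob_space) ibp_weight_sgn:
  assumes w: "ibp_weight M Y \<Theta>"
  shows "expectation (\<lambda>\<omega>. (sgn (Y \<omega> - a) - sgn (Y \<omega> - b)) / 2)
       = expectation (\<lambda>\<omega>. (\<bar>Y \<omega> - a\<bar> - \<bar>Y \<omega> - b\<bar>) / 2 * \<Theta> \<omega>)"
proof -
  have Y [measurable]: "Y \<in> borel_measurable M" and T: "integrable M \<Theta>"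
    and key: "\<And>\<phi> \<phi>' B. (\<And>x. (\<phi> has_real_derivative \<phi>' x) (at x)) \<Longrightarrow> continuous_on UNIV \<phi>' \<Longrightarrow>
      (\<And>x. \<bar>\<phi> x\<bar> \<le> B) \<Longrightarrow> (\<And>x. \<bar>\<phi>' x\<bar> \<le> B) \<Longrightarrow>
      (LINT \<omega>|M. \<phi>' (Y \<omega>)) = (LINT \<omega>|M. \<phi> (Y \<omega>) * \<Theta> \<omega>)"
    using w unfolding ibp_weight_def by blast+
  have [measurable]: "\<Theta> \<in> borel_measurable M" using T by simp
  define c where "c n = 1 / real (Suc n)" for n
  have c: "c n > 0" for n by (simp add: c_def)
  define \<phi> where "\<phi> n x = (smooth_abs (c n) (x - a) - smooth_abs (c n) (x - b)) / 2" for n x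
  define \<psi> where "\<psi> n x = ((x - a) / smooth_abs (c n) (x - a) - (x - b) / smooth_abs (c n) (x - b)) / 2" for n x
  have ne: "smooth_abs (c n) x \<noteq> 0" for n x
    using c[of n] by (simp add: smooth_abs_def add_nonneg_eq_0_iff)
  have sm: "continuous_on UNIV (smooth_abs (c n))" for n
    unfolding smooth_abs_def[abs_def] by (intro continuous_intros)
  have sm': "continuous_on UNIV (\<lambda>x. smooth_abs (c n) (x - z))" for n z
    by (rule continuous_on_compose2[OF sm]) (auto intro: continuous_intros)
  have c\<psi>: "continuous_on UNIV (\<psi> n)" for n
    unfolding \<psi>_def[abs_def] by (intro continuous_on_divide continuous_on_diff sm' continuous_on_const continuous_on_id) (simp_all add: ne)
  have c\<phi>: "continuous_on UNIV (\<phi> n)" for n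
    unfolding \<phi>_def[abs_def] by (intro continuous_on_divide continuous_on_diff sm' continuous_on_const) simp
  have [measurable]: "\<phi> n \<in> borel_measurable borel" "\<psi> n \<in> borel_measurable borel" for n
    by (rule borel_measurable_continuous_onI, rule c\<phi> c\<psi>)+
  have d: "(\<phi> n has_real_derivative \<psi> n x) (at x)" for n x
  proof -
    have "((\<lambda>x. smooth_abs (c n) (x - z)) has_real_derivative (x - z) / smooth_abs (c n) (x - z) * (1 - 0)) (at x)" for z
      by (rule DERIV_chain2[OF smooth_abs_deriv[OF c] DERIV_diff[OF DERIV_ident DERIV_const]])
    then have "((\<lambda>x. smooth_abs (c n) (x - z)) has_real_derivative (x - z) / smooth_abs (c n) (x - z)) (at x)" for z
      by simp
    then show ?thesis
      unfolding \<phi>_def[abs_def] \<psi>_def by (intro DERIV_cdivide DERIV_diff)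
  qed
  have b\<phi>: "\<bar>\<phi> n x\<bar> \<le> \<bar>b - a\<bar> / 2" for n x
    using smooth_abs_lipschitz[OF less_imp_le[OF c], of n "x - a" "x - b"] unfolding \<phi>_def by simp
  have b\<psi>: "\<bar>\<psi> n x\<bar> \<le> 1" for n x
  proof -
    have "\<bar>(u - v) / 2\<bar> \<le> 1" if "\<bar>u\<bar> \<le> 1" "\<bar>v\<bar> \<le> 1" for u v :: real
    proof -
      have "\<bar>u - v\<bar> \<le> 2" using that by arith
      then show ?thesis by simp
    qed
    from this[OF smooth_abs_quotient_le[OF c] smooth_abs_quotient_le[OF c]] show ?thesis
      unfolding \<psi>_def .
  qed
  have eq: "expectation (\<lambda>\<omega>. \<psi> n (Y \<omega>)) = expectation (\<lambda>\<omega>. \<phi> n (Y \<omega>) * \<Theta> \<omega>)" for n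
  proof (rule key[of "\<phi> n" "\<psi> n" "max 1 (\<bar>b - a\<bar> / 2)", OF d c\<psi>])
    show "\<bar>\<phi> n x\<bar> \<le> max 1 (\<bar>b - a\<bar> / 2)" for x using b\<phi>[of n x] by linarith
    show "\<bar>\<psi> n x\<bar> \<le> max 1 (\<bar>b - a\<bar> / 2)" for x using b\<psi>[of n x] by linarith
  qed
  have "(\<lambda>n. expectation (\<lambda>\<omega>. \<psi> n (Y \<omega>))) \<longlonglongrightarrow> expectation (\<lambda>\<omega>. (sgn (Y \<omega> - a) - sgn (Y \<omega> - b)) / 2)"
  proof (rule integral_dominated_convergence[where w="\<lambda>_. 1"])
    show "AE \<omega> in M. (\<lambda>n. \<psi> n (Y \<omega>)) \<longlonglongrightarrow> (sgn (Y \<omega> - a) - sgn (Y \<omega> - b)) / 2"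
      unfolding \<psi>_def c_def
      by (intro AE_I2 tendsto_divide tendsto_diff smooth_abs_quotient_tendsto tendsto_const) simp
    show "AE \<omega> in M. norm (\<psi> n (Y \<omega>)) \<le> 1" for n
      using b\<psi> by (intro AE_I2) simp
  qed simp_all
  moreover have "(\<lambda>n. expectation (\<lambda>\<omega>. \<phi> n (Y \<omega>) * \<Theta> \<omega>)) \<longlonglongrightarrow> expectation (\<lambda>\<omega>. (\<bar>Y \<omega> - a\<bar> - \<bar>Y \<omega> - b\<bar>) / 2 * \<Theta> \<omega>)"
  proof (rule integral_dominated_convergence[where w="\<lambda>\<omega>. \<bar>b - a\<bar> / 2 * \<bar>\<Theta> \<omega>\<bar>"])
    show "AE \<omega> in M. (\<lambda>n. \<phi> n (Y \<omega>) * \<Theta> \<omega>) \<longlonglongrightarrow> (\<bar>Y \<omega> - a\<bar> - \<bar>Y \<omega> - b\<bar>) / 2 * \<Theta> \<omega>"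
      unfolding \<phi>_def c_def
      by (intro AE_I2 tendsto_mult tendsto_divide tendsto_diff smooth_abs_tendsto tendsto_const) simp
    show "AE \<omega> in M. norm (\<phi> n (Y \<omega>) * \<Theta> \<omega>) \<le> \<bar>b - a\<bar> / 2 * \<bar>\<Theta> \<omega>\<bar>" for n
      unfolding real_norm_def abs_mult[of "\<phi> n _"] by (intro AE_I2 mult_right_mono b\<phi>) simp
    show "integrable M (\<lambda>\<omega>. \<bar>b - a\<bar> / 2 * \<bar>\<Theta> \<omega>\<bar>)" using T by simp
  qed simp_all
  ultimately show ?thesis unfolding eq by (rule LIMSEQ_unique)
qed

text \<open>Constant test functions.\<close>

lemma (in prob_space) ibp_weight_mean_0:
  assumes "ibp_weight M Y \<Theta>"
  shows "expectation \<Theta> = 0"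
proof -
  have "(LINT \<omega>|M. 0) = (LINT \<omega>|M. 1 * \<Theta> \<omega>)"
    using assms[unfolded ibp_weight_def, THEN conjunct2, THEN conjunct2, THEN spec[of _ "\<lambda>_. 1"], THEN spec[of _ "\<lambda>_. 0"], THEN spec[of _ 1]]
    by simp
  then show ?thesis by simp
qed

text \<open>The function \<open>y \<mapsto> E(\<Theta>; Y > y)\<close>, which is the density of \<open>Y\<close> when \<open>\<Theta>\<close> is a weight: formally it
  is the identity for \<open>\<phi> = indicator {y<..}\<close>, whose derivative is the point mass at \<open>y\<close>.\<close>

definition (in prob_space) upper_mean :: "('a \<Rightarrow> real) \<Rightarrow> ('a \<Rightarrow> real) \<Rightarrow> real \<Rightarrow> real" where
  "upper_mean Y \<Theta> y = expectation (\<lambda>\<omega>. indicator {y<..} (Y \<omega>) * \<Theta> \<omega>)"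

text \<open>On an interval of length \<open>2 * e\<close> around \<open>a\<close>, the test function above is bounded by \<open>e\<close>.\<close>

lemma (in prob_space) ibp_weight_no_atoms:
  assumes w: "ibp_weight M Y \<Theta>"
  shows "AE \<omega> in M. Y \<omega> \<noteq> a"
proof -
  have Y [measurable]: "Y \<in> borel_measurable M" and T: "integrable M \<Theta>"
    using w unfolding ibp_weight_def by blast+
  define C where "C = expectation (\<lambda>\<omega>. \<bar>\<Theta> \<omega>\<bar>)"
  have "prob {\<omega>\<in>space M. Y \<omega> = a} \<le> 0 + e * C" if e: "e > 0" for e
  proof -
    have "prob {\<omega>\<in>space M. Y \<omega> = a} = expectation (\<lambda>\<omega>. indicator {\<omega>\<in>space M. Y \<omega> = a} \<omega>)"
      by simp
    also have "\<dots> \<le> expectation (\<lambda>\<omega>. (sgn (Y \<omega> - (a - e)) - sgn (Y \<omega> - (a + e))) / 2)"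
    proof (rule integral_mono)
      show "integrable M (\<lambda>\<omega>. (sgn (Y \<omega> - (a - e)) - sgn (Y \<omega> - (a + e))) / 2)"
        by (rule integrable_const_bound[where B=1]) (auto simp: sgn_if)
      show "indicat_real {\<omega> \<in> space M. Y \<omega> = a} \<omega> \<le> (sgn (Y \<omega> - (a - e)) - sgn (Y \<omega> - (a + e))) / 2" for \<omega>
        using e by (auto simp: indicator_def sgn_if)
      show "integrable M (indicat_real {\<omega> \<in> space M. Y \<omega> = a})"
        by (rule integrable_real_indicator) (simp_all add: emeasure_eq_measure)
    qed
    also have "\<dots> = expectation (\<lambda>\<omega>. (\<bar>Y \<omega> - (a - e)\<bar> - \<bar>Y \<omega> - (a + e)\<bar>) / 2 * \<Theta> \<omega>)"
      by (rule ibp_weight_sgn[OF w])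
    also have "\<dots> \<le> expectation (\<lambda>\<omega>. e * \<bar>\<Theta> \<omega>\<bar>)"
    proof (rule integral_mono_AE')
      show "integrable M (\<lambda>\<omega>. e * \<bar>\<Theta> \<omega>\<bar>)" using T by simp
      have "(\<bar>Y \<omega> - (a - e)\<bar> - \<bar>Y \<omega> - (a + e)\<bar>) / 2 * \<Theta> \<omega> \<le> e * \<bar>\<Theta> \<omega>\<bar>" for \<omega>
      proof -
        have "\<bar>\<bar>Y \<omega> - (a - e)\<bar> - \<bar>Y \<omega> - (a + e)\<bar>\<bar> \<le> 2 * e" using e by arith
        then have "\<bar>(\<bar>Y \<omega> - (a - e)\<bar> - \<bar>Y \<omega> - (a + e)\<bar>) / 2\<bar> \<le> e" by simp
        then have "\<bar>(\<bar>Y \<omega> - (a - e)\<bar> - \<bar>Y \<omega> - (a + e)\<bar>) / 2 * \<Theta> \<omega>\<bar> \<le> e * \<bar>\<Theta> \<omega>\<bar>"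
          unfolding abs_mult by (rule mult_right_mono) simp
        then show ?thesis by linarith
      qed
      then show "AE \<omega> in M. (\<bar>Y \<omega> - (a - e)\<bar> - \<bar>Y \<omega> - (a + e)\<bar>) / 2 * \<Theta> \<omega> \<le> e * \<bar>\<Theta> \<omega>\<bar>" by simp
      show "AE \<omega> in M. 0 \<le> e * \<bar>\<Theta> \<omega>\<bar>" using e by simp
    qed
    finally show ?thesis by (simp add: C_def)
  qed
  then have le: "prob {\<omega>\<in>space M. Y \<omega> = a} \<le> e * C" if "e > 0" for e using that by simp
  have C0: "C \<ge> 0" unfolding C_def by simp
  have "prob {\<omega>\<in>space M. Y \<omega> = a} \<le> 0 + e" if "e > 0" for e
  proof -
    have "prob {\<omega>\<in>space M. Y \<omega> = a} \<le> e / (C + 1) * C" using le[of "e / (C + 1)"] that C0 by simp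
    also have "\<dots> \<le> e" using that C0 by (simp add: field_simps)
    finally show ?thesis by simp
  qed
  then have "prob {\<omega>\<in>space M. Y \<omega> = a} \<le> 0" by (rule field_le_epsilon)
  then have "prob {\<omega>\<in>space M. Y \<omega> = a} = 0" by (simp add: measure_le_0_iff)
  then show ?thesis
    by (intro AE_I[where N="{\<omega>\<in>space M. Y \<omega> = a}"]) (auto simp: emeasure_eq_measure)
qed


text \<open>Fubini's theorem: the length of \<open>{a..b} \<inter> {..<Y \<omega>}\<close> is the test function of the previous lemmas
  at \<open>Y \<omega>\<close> plus \<open>(b - a) / 2\<close>.\<close>

lemma (in prob_space) integral_upper_mean:
  assumes Y [measurable]: "Y \<in> borel_measurable M" and T: "integrable M \<Theta>" and ab: "a \<le> b"
  shows "set_integrable lborel {a..b} (upper_mean Y \<Theta>)"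
    and "(LBINT y:{a..b}. upper_mean Y \<Theta> y) = expectation (\<lambda>\<omega>. (\<bar>Y \<omega> - a\<bar> - \<bar>Y \<omega> - b\<bar>) / 2 * \<Theta> \<omega>) + (b - a) / 2 * expectation \<Theta>"
proof -
  interpret pair_sigma_finite "lborel :: real measure" M ..
  have [measurable]: "\<Theta> \<in> borel_measurable M" using T by simp
  define f where "f y \<omega> = indicator {a..b} y * ((if y < Y \<omega> then 1 else 0) * \<Theta> \<omega>)" for y \<omega>
  have dom: "integrable (lborel \<Otimes>\<^sub>M M) (\<lambda>(y, \<omega>). indicator {a..b} y * \<Theta> \<omega>)"
  proof (rule Fubini_integrable)
    show "integrable lborel (\<lambda>y. LINT \<omega>|M. norm (case (y, \<omega>) of (y, \<omega>) \<Rightarrow> indicator {a..b} y * \<Theta> \<omega>))"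
      by (simp add: abs_mult integrable_real_indicator emeasure_lborel_Icc_eq)
    show "AE y in lborel. integrable M (\<lambda>\<omega>. case (y, \<omega>) of (y, \<omega>) \<Rightarrow> indicator {a..b} y * \<Theta> \<omega>)"
      using T by simp
  qed measurable
  have int: "integrable (lborel \<Otimes>\<^sub>M M) (case_prod f)"
  proof (rule Bochner_Integration.integrable_bound[OF dom])
    show "case_prod f \<in> borel_measurable (lborel \<Otimes>\<^sub>M M)"
      unfolding f_def by measurable
  qed (auto simp: f_def indicator_def)
  have f1: "(LINT \<omega>|M. f y \<omega>) = indicator {a..b} y *\<^sub>R upper_mean Y \<Theta> y" for y
  proof -
    have "f y \<omega> = indicator {a..b} y * (indicator {y<..} (Y \<omega>) * \<Theta> \<omega>)" for \<omega>
      by (simp add: f_def indicator_def)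
    then show ?thesis by (simp add: upper_mean_def)
  qed
  have "integrable lborel (\<lambda>y. LINT \<omega>|M. f y \<omega>)"
    using integrable_fst[OF int] .
  then show "set_integrable lborel {a..b} (upper_mean Y \<Theta>)"
    unfolding f1 set_integrable_def .
  have "(LBINT y:{a..b}. upper_mean Y \<Theta> y) = (LINT y|lborel. LINT \<omega>|M. f y \<omega>)"
    unfolding f1 set_lebesgue_integral_def ..
  also have "\<dots> = (LINT \<omega>|M. LINT y|lborel. f y \<omega>)"
    by (rule Fubini_integral[OF int, symmetric])
  also have "\<dots> = (LINT \<omega>|M. (\<bar>Y \<omega> - a\<bar> - \<bar>Y \<omega> - b\<bar>) / 2 * \<Theta> \<omega> + (b - a) / 2 * \<Theta> \<omega>)"
  proof (rule Bochner_Integration.integral_cong[OF refl])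
    fix \<omega>
    have "(LINT y|lborel. f y \<omega>) = (LINT y|lborel. indicator ({a..b} \<inter> {..<Y \<omega>}) y * \<Theta> \<omega>)"
      by (rule Bochner_Integration.integral_cong) (auto simp: f_def indicator_def)
    also have "\<dots> = measure lborel ({a..b} \<inter> {..<Y \<omega>}) * \<Theta> \<omega>"
      by simp
    also have "measure lborel ({a..b} \<inter> {..<Y \<omega>}) = (\<bar>Y \<omega> - a\<bar> - \<bar>Y \<omega> - b\<bar>) / 2 + (b - a) / 2"
    proof -
      consider "Y \<omega> \<le> a" | "a < Y \<omega>" "Y \<omega> \<le> b" | "b < Y \<omega>" by linarith
      then show ?thesis
      proof cases
        case 1
        then have "{a..b} \<inter> {..<Y \<omega>} = {}" by auto
        then show ?thesis using 1 ab by (simp add: field_simps)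
      next
        case 2
        then have "{a..b} \<inter> {..<Y \<omega>} = {a..<Y \<omega>}" by auto
        then show ?thesis using 2 ab by (simp add: field_simps)
      next
        case 3
        then have "{a..b} \<inter> {..<Y \<omega>} = {a..b}" by auto
        then show ?thesis using 3 ab by (simp add: field_simps)
      qed
    qed
    finally show "(LINT y|lborel. f y \<omega>) = (\<bar>Y \<omega> - a\<bar> - \<bar>Y \<omega> - b\<bar>) / 2 * \<Theta> \<omega> + (b - a) / 2 * \<Theta> \<omega>"
      by (simp add: distrib_right)
  qed
  also have "\<dots> = expectation (\<lambda>\<omega>. (\<bar>Y \<omega> - a\<bar> - \<bar>Y \<omega> - b\<bar>) / 2 * \<Theta> \<omega>) + (b - a) / 2 * expectation \<Theta>"
  proof -
    have "integrable M (\<lambda>\<omega>. (\<bar>Y \<omega> - a\<bar> - \<bar>Y \<omega> - b\<bar>) / 2 * \<Theta> \<omega>)"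
    proof (rule Bochner_Integration.integrable_bound)
      show "integrable M (\<lambda>\<omega>. (b - a) / 2 * \<Theta> \<omega>)" using T by simp
      show "AE \<omega> in M. norm ((\<bar>Y \<omega> - a\<bar> - \<bar>Y \<omega> - b\<bar>) / 2 * \<Theta> \<omega>) \<le> norm ((b - a) / 2 * \<Theta> \<omega>)"
        unfolding norm_mult using ab by (intro AE_I2 mult_right_mono) auto
    qed measurable
    then show ?thesis using T by simp
  qed
  finally show "(LBINT y:{a..b}. upper_mean Y \<Theta> y) = expectation (\<lambda>\<omega>. (\<bar>Y \<omega> - a\<bar> - \<bar>Y \<omega> - b\<bar>) / 2 * \<Theta> \<omega>) + (b - a) / 2 * expectation \<Theta>" .
qed

lemma (in prob_space) upper_mean_diff:
  assumes Y [measurable]: "Y \<in> borel_measurable M" and T: "integrable M \<Theta>" and ab: "a \<le> b"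
  shows "upper_mean Y \<Theta> a - upper_mean Y \<Theta> b = expectation (\<lambda>\<omega>. indicator {a<..b} (Y \<omega>) * \<Theta> \<omega>)"
proof -
  have [measurable]: "\<Theta> \<in> borel_measurable M" using T by simp
  have int: "integrable M (\<lambda>\<omega>. indicator A (Y \<omega>) * \<Theta> \<omega>)" if [measurable]: "A \<in> sets borel" for A
    by (rule Bochner_Integration.integrable_bound[OF T]) (auto simp: indicator_def)
  have "upper_mean Y \<Theta> a - upper_mean Y \<Theta> b = expectation (\<lambda>\<omega>. indicator {a<..} (Y \<omega>) * \<Theta> \<omega> - indicator {b<..} (Y \<omega>) * \<Theta> \<omega>)"
    unfolding upper_mean_def by (subst Bochner_Integration.integral_diff) (simp_all add: int)
  also have "\<dots> = expectation (\<lambda>\<omega>. indicator {a<..b} (Y \<omega>) * \<Theta> \<omega>)"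
    by (rule Bochner_Integration.integral_cong) (use ab in \<open>auto simp: indicator_def\<close>)
  finally show ?thesis .
qed

lemma (in prob_space) ibp_weight_interval_prob:
  assumes w: "ibp_weight M Y \<Theta>" and ab: "a \<le> b"
  shows "prob (Y -` {a<..b} \<inter> space M) = (LBINT y:{a..b}. upper_mean Y \<Theta> y)"
proof -
  have Y [measurable]: "Y \<in> borel_measurable M" and T: "integrable M \<Theta>"
    using w unfolding ibp_weight_def by blast+
  have "prob (Y -` {a<..b} \<inter> space M) = expectation (\<lambda>\<omega>. indicator (Y -` {a<..b} \<inter> space M) \<omega>)"
    by simp
  also have "\<dots> = expectation (\<lambda>\<omega>. (sgn (Y \<omega> - a) - sgn (Y \<omega> - b)) / 2)"
  proof (rule integral_cong_AE)
    show "AE \<omega> in M. indicat_real (Y -` {a<..b} \<inter> space M) \<omega> = (sgn (Y \<omega> - a) - sgn (Y \<omega> - b)) / 2"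
      using ibp_weight_no_atoms[OF w, of a] ibp_weight_no_atoms[OF w, of b] AE_space
      by eventually_elim (use ab in \<open>auto simp: indicator_def sgn_if\<close>)
  qed measurable
  also have "\<dots> = (LBINT y:{a..b}. upper_mean Y \<Theta> y)"
    unfolding ibp_weight_sgn[OF w] integral_upper_mean(2)[OF Y T ab] ibp_weight_mean_0[OF w] by simp
  finally show ?thesis .
qed

lemma (in prob_space) continuous_upper_mean:
  assumes Y [measurable]: "Y \<in> borel_measurable M" and T: "integrable M \<Theta>"
    and na: "\<And>a. AE \<omega> in M. Y \<omega> \<noteq> a"
  shows "continuous_on UNIV (upper_mean Y \<Theta>)"
proof (rule continuous_at_imp_continuous_on, rule ballI)
  fix y :: real
  have [measurable]: "\<Theta> \<in> borel_measurable M" using T by simp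
  show "isCont (upper_mean Y \<Theta>) y"
  proof (rule continuous_at_sequentially[THEN iffD2], intro allI impI)
    fix x :: "nat \<Rightarrow> real" assume x: "x \<longlonglongrightarrow> y"
    have "(\<lambda>n. expectation (\<lambda>\<omega>. indicator {x n<..} (Y \<omega>) * \<Theta> \<omega>)) \<longlonglongrightarrow> expectation (\<lambda>\<omega>. indicator {y<..} (Y \<omega>) * \<Theta> \<omega>)"
    proof (rule integral_dominated_convergence[where w="\<lambda>\<omega>. \<bar>\<Theta> \<omega>\<bar>"])
      show "AE \<omega> in M. (\<lambda>n. indicator {x n<..} (Y \<omega>) * \<Theta> \<omega>) \<longlonglongrightarrow> indicator {y<..} (Y \<omega>) * \<Theta> \<omega>"
        using na[of y]
      proof eventually_elim
        case (elim \<omega>)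
        have "\<forall>\<^sub>F n in sequentially. indicat_real {x n<..} (Y \<omega>) = indicator {y<..} (Y \<omega>)"
        proof (cases "y < Y \<omega>")
          case True
          from order_tendstoD(2)[OF x True] show ?thesis by eventually_elim (use True in simp)
        next
          case False
          then have "Y \<omega> < y" using elim by simp
          from order_tendstoD(1)[OF x this] show ?thesis by eventually_elim (use False in simp)
        qed
        then have "(\<lambda>n. indicat_real {x n<..} (Y \<omega>)) \<longlonglongrightarrow> indicator {y<..} (Y \<omega>)" by (rule tendsto_eventually)
        then show ?case by (intro tendsto_mult tendsto_const)
      qed
      show "AE \<omega> in M. norm (indicator {x n<..} (Y \<omega>) * \<Theta> \<omega>) \<le> \<bar>\<Theta> \<omega>\<bar>" for n
        by (rule AE_I2) (simp add: indicator_def)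
      show "integrable M (\<lambda>\<omega>. \<bar>\<Theta> \<omega>\<bar>)" using T by simp
    qed measurable
    then show "(upper_mean Y \<Theta> \<circ> x) \<longlonglongrightarrow> upper_mean Y \<Theta> y"
      by (simp add: upper_mean_def o_def)
  qed
qed

text \<open>By continuity a negative value would make an interval probability negative.\<close>

lemma (in prob_space) upper_mean_nonneg:
  assumes w: "ibp_weight M Y \<Theta>"
  shows "0 \<le> upper_mean Y \<Theta> y"
proof (rule ccontr)
  assume "\<not> 0 \<le> upper_mean Y \<Theta> y"
  then have neg: "upper_mean Y \<Theta> y < 0" by simp
  have Y: "Y \<in> borel_measurable M" and T: "integrable M \<Theta>"
    using w unfolding ibp_weight_def by blast+
  let ?p = "upper_mean Y \<Theta>"
  have cont: "continuous_on UNIV ?p" by (rule continuous_upper_mean[OF Y T ibp_weight_no_atoms[OF w]])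
  have "isCont ?p y" using cont by (simp add: continuous_on_eq_continuous_at)
  moreover have "- ?p y / 2 > 0" using neg by simp
  ultimately obtain d where d: "d > 0" "\<And>z. \<bar>z - y\<bar> < d \<Longrightarrow> \<bar>?p z - ?p y\<bar> < - ?p y / 2"
    unfolding continuous_at_eps_delta dist_real_def by blast
  have small: "?p z \<le> ?p y / 2" if "z \<in> {y..y + d / 2}" for z
    using d(2)[of z] that d(1) by (simp add: abs_less_iff)
  have "integral {y..y + d / 2} ?p \<le> integral {y..y + d / 2} (\<lambda>_. ?p y / 2)"
    by (rule integral_le[OF integrable_continuous_real[OF continuous_on_subset[OF cont]] integrable_const_ivl small]) auto
  also have "\<dots> = d / 2 * (?p y / 2)" using d(1) by simp
  also have "\<dots> < 0" using d(1) neg by (simp add: mult_pos_neg)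
  finally have "integral {y..y + d / 2} ?p < 0" .
  moreover have "integral {y..y + d / 2} ?p = (LBINT z:{y..y + d / 2}. ?p z)"
    using set_borel_integral_eq_integral(2)[OF integral_upper_mean(1)[OF Y T, of y "y + d / 2"]] d(1) by simp
  moreover have "\<dots> = prob (Y -` {y<..y + d / 2} \<inter> space M)"
    by (rule ibp_weight_interval_prob[OF w, symmetric]) (use d(1) in simp)
  ultimately show False using measure_nonneg[of M "Y -` {y<..y + d / 2} \<inter> space M"] by linarith
qed

text \<open>The law of \<open>Y\<close> and the density agree on half-open intervals.\<close>

lemma (in prob_space) ibp_weight_distributed:
  assumes w: "ibp_weight M Y \<Theta>"
  shows "distributed M lborel Y (\<lambda>y. ennreal (upper_mean Y \<Theta> y))"
proof -
  have Y [measurable]: "Y \<in> borel_measurable M" and T: "integrable M \<Theta>"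
    using w unfolding ibp_weight_def by blast+
  let ?p = "upper_mean Y \<Theta>"
  have cont: "continuous_on UNIV ?p" by (rule continuous_upper_mean[OF Y T ibp_weight_no_atoms[OF w]])
  have pm [measurable]: "?p \<in> borel_measurable borel" by (rule borel_measurable_continuous_onI[OF cont])
  have nn: "0 \<le> ?p y" for y by (rule upper_mean_nonneg[OF w])
  have "distr M lborel Y = density lborel (\<lambda>y. ennreal (?p y))"
  proof (rule measure_eqI_generator_eq[where E="range (\<lambda>(a, b). {a<..b})" and \<Omega>=UNIV])
    let ?E = "range (\<lambda>(a, b). {a<..b}) :: real set set"
    show "Int_stable ?E" by (auto simp: Int_stable_def)
    show "sets (distr M lborel Y) = sigma_sets UNIV ?E" "sets (density lborel (\<lambda>y. ennreal (?p y))) = sigma_sets UNIV ?E"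
      by (simp_all add: borel_sigma_sets_Ioc)
    show "range (\<lambda>i::nat. {- real i<..real i}) \<subseteq> ?E" by auto
    show "(\<Union>i::nat. {- real i<..real i}) = UNIV"
    proof -
      have "\<exists>i::nat. x \<in> {- real i<..real i}" for x :: real
      proof -
        obtain i :: nat where "\<bar>x\<bar> < real i" using reals_Archimedean2 by blast
        then show ?thesis by (intro exI[of _ i]) auto
      qed
      then show ?thesis by auto
    qed
    show "emeasure (distr M lborel Y) {- real i<..real i} \<noteq> \<infinity>" for i
      by (subst emeasure_distr) (simp_all add: emeasure_eq_measure)
    fix S assume "S \<in> ?E"
    then obtain a b where S: "S = {a<..b}" by auto
    show "emeasure (distr M lborel Y) S = emeasure (density lborel (\<lambda>y. ennreal (?p y))) S"
    proof (cases "a \<le> b")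
      case True
      have si: "set_integrable lborel {a..b} ?p" by (rule integral_upper_mean(1)[OF Y T True])
      have "emeasure (density lborel (\<lambda>y. ennreal (?p y))) S = (\<integral>\<^sup>+y. ennreal (?p y) * indicator {a<..b} y \<partial>lborel)"
        unfolding S by (rule emeasure_density) simp_all
      also have "\<dots> = (\<integral>\<^sup>+y. ennreal (indicator {a..b} y *\<^sub>R ?p y) \<partial>lborel)"
      proof (rule nn_integral_cong_AE)
        show "AE y in lborel. ennreal (?p y) * indicator {a<..b} y = ennreal (indicator {a..b} y *\<^sub>R ?p y)"
          using AE_lborel_singleton[of a] by eventually_elim (auto simp: indicator_def)
      qed
      also have "\<dots> = ennreal (LBINT y:{a..b}. ?p y)"
        unfolding set_lebesgue_integral_def
        by (rule nn_integral_eq_integral) (use si nn in \<open>simp_all add: set_integrable_def\<close>)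
      also have "\<dots> = emeasure (distr M lborel Y) S"
        unfolding S ibp_weight_interval_prob[OF w True, symmetric]
        by (subst emeasure_distr) (simp_all add: emeasure_eq_measure)
      finally show ?thesis ..
    qed (simp add: S)
  qed auto
  then show ?thesis unfolding distributed_def by simp
qed

text \<open>The conditional mean as a function of \<open>Y\<close>: the Radon-Nikodym derivative of \<open>A \<mapsto> E(\<Theta>; Y \<in> A)\<close>
  with respect to the law of \<open>Y\<close>.\<close>

lemma (in prob_space) conditional_mean_function_nonneg:
  assumes Y [measurable]: "Y \<in> borel_measurable M" and T: "integrable M \<Theta>" and nn: "\<And>\<omega>. 0 \<le> \<Theta> \<omega>"
  shows "\<exists>\<theta> :: real \<Rightarrow> real. \<theta> \<in> borel_measurable borel \<and> integrable M (\<lambda>\<omega>. \<theta> (Y \<omega>)) \<and>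
    (\<forall>A\<in>sets borel. expectation (\<lambda>\<omega>. indicator A (Y \<omega>) * \<Theta> \<omega>) = expectation (\<lambda>\<omega>. indicator A (Y \<omega>) * \<theta> (Y \<omega>)))"
proof -
  have [measurable]: "\<Theta> \<in> borel_measurable M" using T by simp
  define D where "D = distr M borel Y"
  define N where "N = distr (density M (\<lambda>\<omega>. ennreal (\<Theta> \<omega>))) borel Y"
  interpret D: prob_space D unfolding D_def by (rule prob_space_distr[OF Y])
  have sD: "sets D = sets borel" and sN: "sets N = sets D" by (simp_all add: D_def N_def)
  have mD: "measurable D (borel :: real measure) = borel_measurable borel" by (rule measurable_cong_sets) (simp_all add: sD)
  have eN: "emeasure N A = (\<integral>\<^sup>+\<omega>. ennreal (\<Theta> \<omega>) * indicator A (Y \<omega>) \<partial>M)" if [measurable]: "A \<in> sets borel" for A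
  proof -
    have "emeasure N A = emeasure (density M (\<lambda>\<omega>. ennreal (\<Theta> \<omega>))) (Y -` A \<inter> space M)"
      unfolding N_def by (subst emeasure_distr) simp_all
    also have "\<dots> = (\<integral>\<^sup>+\<omega>. ennreal (\<Theta> \<omega>) * indicator (Y -` A \<inter> space M) \<omega> \<partial>M)"
      by (rule emeasure_density) measurable
    also have "\<dots> = (\<integral>\<^sup>+\<omega>. ennreal (\<Theta> \<omega>) * indicator A (Y \<omega>) \<partial>M)"
      by (rule nn_integral_cong) (simp add: indicator_def)
    finally show ?thesis .
  qed
  have fin: "(\<integral>\<^sup>+\<omega>. ennreal (\<Theta> \<omega>) \<partial>M) < \<infinity>"
    using nn_integral_eq_integral[OF T] nn by simp
  have "finite_measure N"
  proof (rule finite_measureI)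
    have "space N = UNIV" by (simp add: N_def)
    then show "emeasure N (space N) \<noteq> \<infinity>" using eN[of UNIV] fin by simp
  qed
  moreover have ac: "absolutely_continuous D N"
    unfolding absolutely_continuous_def
  proof
    fix A assume A: "A \<in> null_sets D"
    then have [measurable]: "A \<in> sets borel" using sD by auto
    have "emeasure M (Y -` A \<inter> space M) = 0"
      using A unfolding D_def null_sets_def by (simp add: emeasure_distr)
    then have "AE \<omega> in M. \<omega> \<notin> Y -` A \<inter> space M"
      by (intro AE_not_in) (simp add: null_sets_def)
    then have "AE \<omega> in M. ennreal (\<Theta> \<omega>) * indicator A (Y \<omega>) = 0"
      using AE_space by eventually_elim (simp add: indicator_def)
    then have "(\<integral>\<^sup>+\<omega>. ennreal (\<Theta> \<omega>) * indicator A (Y \<omega>) \<partial>M) = (\<integral>\<^sup>+\<omega>. 0 \<partial>M)"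
      by (rule nn_integral_cong_AE)
    then have "emeasure N A = 0" using eN[of A] by simp
    then show "A \<in> null_sets N" using sN sD by (simp add: null_sets_def)
  qed
  ultimately obtain \<theta> where th: "\<theta> \<in> borel_measurable D" "AE x in D. RN_deriv D N x = ennreal (\<theta> x)" "\<And>x. 0 \<le> \<theta> x"
    by (rule D.real_RN_deriv[OF _ _ sN]) (rule that)
  have tm [measurable]: "\<theta> \<in> borel_measurable borel" using th(1) mD by simp
  have "density D (\<lambda>x. ennreal (\<theta> x)) = density D (RN_deriv D N)"
    by (rule density_cong) (use th in \<open>auto elim: eventually_mono\<close>)
  then have dN: "density D (\<lambda>x. ennreal (\<theta> x)) = N" using D.density_RN_deriv[OF ac sN] by simp
  have eq: "(\<integral>\<^sup>+\<omega>. ennreal (\<Theta> \<omega>) * indicator A (Y \<omega>) \<partial>M) = (\<integral>\<^sup>+\<omega>. ennreal (\<theta> (Y \<omega>)) * indicator A (Y \<omega>) \<partial>M)"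
    if [measurable]: "A \<in> sets borel" for A
  proof -
    have "emeasure N A = (\<integral>\<^sup>+x. ennreal (\<theta> x) * indicator A x \<partial>D)"
      unfolding dN[symmetric]
      by (rule emeasure_density) (use th(1) in \<open>simp_all add: sD measurable_compose[OF _ measurable_ennreal]\<close>)
    also have "\<dots> = (\<integral>\<^sup>+\<omega>. ennreal (\<theta> (Y \<omega>)) * indicator A (Y \<omega>) \<partial>M)"
      unfolding D_def by (rule nn_integral_distr) simp_all
    finally show ?thesis using eN[of A] by simp
  qed
  have int: "integrable M (\<lambda>\<omega>. \<theta> (Y \<omega>))"
  proof (rule integrableI_nonneg)
    show "(\<integral>\<^sup>+\<omega>. ennreal (\<theta> (Y \<omega>)) \<partial>M) < \<infinity>" using eq[of UNIV] fin by simp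
  qed (use th(3) in simp_all)
  have "expectation (\<lambda>\<omega>. indicator A (Y \<omega>) * \<Theta> \<omega>) = expectation (\<lambda>\<omega>. indicator A (Y \<omega>) * \<theta> (Y \<omega>))"
    if [measurable]: "A \<in> sets borel" for A
  proof -
    have *: "expectation (\<lambda>\<omega>. indicator A (Y \<omega>) * f \<omega>) = enn2real (\<integral>\<^sup>+\<omega>. ennreal (f \<omega>) * indicator A (Y \<omega>) \<partial>M)"
      if [measurable]: "f \<in> borel_measurable M" and f: "\<And>\<omega>. 0 \<le> f \<omega>" for f :: "'a \<Rightarrow> real"
    proof -
      have "expectation (\<lambda>\<omega>. indicator A (Y \<omega>) * f \<omega>) = enn2real (\<integral>\<^sup>+\<omega>. ennreal (indicator A (Y \<omega>) * f \<omega>) \<partial>M)"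
        by (rule integral_eq_nn_integral) (use f in simp_all)
      also have "(\<integral>\<^sup>+\<omega>. ennreal (indicator A (Y \<omega>) * f \<omega>) \<partial>M) = (\<integral>\<^sup>+\<omega>. ennreal (f \<omega>) * indicator A (Y \<omega>) \<partial>M)"
        by (rule nn_integral_cong) (simp add: indicator_def)
      finally show ?thesis .
    qed
    show ?thesis using *[of \<Theta>] *[of "\<lambda>\<omega>. \<theta> (Y \<omega>)"] nn th(3) eq[of A] by simp
  qed
  with int tm show ?thesis by blast
qed

lemma (in prob_space) conditional_mean_function:
  assumes Y [measurable]: "Y \<in> borel_measurable M" and T: "integrable M \<Theta>"
  obtains \<theta> :: "real \<Rightarrow> real" where "\<theta> \<in> borel_measurable borel" "integrable M (\<lambda>\<omega>. \<theta> (Y \<omega>))"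
    "\<And>A. A \<in> sets borel \<Longrightarrow> expectation (\<lambda>\<omega>. indicator A (Y \<omega>) * \<Theta> \<omega>) = expectation (\<lambda>\<omega>. indicator A (Y \<omega>) * \<theta> (Y \<omega>))"
proof -
  have [measurable]: "\<Theta> \<in> borel_measurable M" using T by simp
  have P: "integrable M (\<lambda>\<omega>. max 0 (\<Theta> \<omega>))" and N: "integrable M (\<lambda>\<omega>. max 0 (- \<Theta> \<omega>))"
    using T by simp_all
  obtain p n :: "real \<Rightarrow> real" where p: "p \<in> borel_measurable borel" "integrable M (\<lambda>\<omega>. p (Y \<omega>))"
      "\<forall>A\<in>sets borel. expectation (\<lambda>\<omega>. indicator A (Y \<omega>) * max 0 (\<Theta> \<omega>)) = expectation (\<lambda>\<omega>. indicator A (Y \<omega>) * p (Y \<omega>))"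
    and n: "n \<in> borel_measurable borel" "integrable M (\<lambda>\<omega>. n (Y \<omega>))"
      "\<forall>A\<in>sets borel. expectation (\<lambda>\<omega>. indicator A (Y \<omega>) * max 0 (- \<Theta> \<omega>)) = expectation (\<lambda>\<omega>. indicator A (Y \<omega>) * n (Y \<omega>))"
    using conditional_mean_function_nonneg[OF Y P] conditional_mean_function_nonneg[OF Y N] by auto
  have ind: "integrable M (\<lambda>\<omega>. indicator A (Y \<omega>) * f \<omega>)" if [measurable]: "A \<in> sets borel" and f: "integrable M f" for A and f :: "'a \<Rightarrow> real"
    by (rule Bochner_Integration.integrable_bound[OF f]) (use f in \<open>auto simp: indicator_def\<close>)
  show thesis
  proof
    show "(\<lambda>y. p y - n y) \<in> borel_measurable borel" using p n by measurable
    show "integrable M (\<lambda>\<omega>. p (Y \<omega>) - n (Y \<omega>))" using p n by simp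
    fix A :: "real set" assume A: "A \<in> sets borel"
    have "expectation (\<lambda>\<omega>. indicator A (Y \<omega>) * \<Theta> \<omega>) = expectation (\<lambda>\<omega>. indicator A (Y \<omega>) * max 0 (\<Theta> \<omega>) - indicator A (Y \<omega>) * max 0 (- \<Theta> \<omega>))"
      by (rule Bochner_Integration.integral_cong) (simp_all add: max_def algebra_simps)
    also have "\<dots> = expectation (\<lambda>\<omega>. indicator A (Y \<omega>) * p (Y \<omega>)) - expectation (\<lambda>\<omega>. indicator A (Y \<omega>) * n (Y \<omega>))"
      using p(3) n(3) A by (subst Bochner_Integration.integral_diff[OF ind[OF A P] ind[OF A N]]) simp
    also have "\<dots> = expectation (\<lambda>\<omega>. indicator A (Y \<omega>) * (p (Y \<omega>) - n (Y \<omega>)))"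
      by (subst Bochner_Integration.integral_diff[OF ind[OF A p(2)] ind[OF A n(2)], symmetric]) (simp add: right_diff_distrib)
    finally show "expectation (\<lambda>\<omega>. indicator A (Y \<omega>) * \<Theta> \<omega>) = expectation (\<lambda>\<omega>. indicator A (Y \<omega>) * (p (Y \<omega>) - n (Y \<omega>)))" .
  qed
qed

lemma AE_right_derivative_of_integral:
  fixes f P :: "real \<Rightarrow> real"
  assumes f: "integrable lborel f" and P: "\<And>a b. a \<le> b \<Longrightarrow> P b - P a = (LBINT y:{a..b}. f y)"
  shows "AE x in lebesgue. \<forall>e>0. \<exists>d>0. \<forall>h. 0 < h \<and> h < d \<longrightarrow> \<bar>(P (x + h) - P x) / h - f x\<bar> < e"
proof -
  have si: "set_integrable lborel {a..b} f" for a b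
    unfolding set_integrable_def by (intro integrable_mult_indicator f) simp
  have "f integrable_on cbox a b" for a b
    using set_borel_integral_eq_integral(1)[OF si] by simp
  then obtain N where N: "negligible N" "\<And>x e. \<lbrakk>x \<notin> N; 0 < e\<rbrakk> \<Longrightarrow>
      \<exists>d>0. \<forall>h. 0 < h \<and> h < d \<longrightarrow> norm (integral (cbox x (x + h *\<^sub>R One)) f /\<^sub>R h ^ DIM(real) - f x) < e"
    by (rule integrable_ccontinuous_explicit) (rule that)
  have "\<forall>e>0. \<exists>d>0. \<forall>h. 0 < h \<and> h < d \<longrightarrow> \<bar>(P (x + h) - P x) / h - f x\<bar> < e" if x: "x \<notin> N" for x
  proof (intro allI impI)
    fix e :: real assume "0 < e"
    from N(2)[OF x this] obtain d where d: "d > 0" "\<And>h. 0 < h \<Longrightarrow> h < d \<Longrightarrow> norm (integral (cbox x (x + h *\<^sub>R One)) f /\<^sub>R h ^ DIM(real) - f x) < e"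
      by blast
    have "\<bar>(P (x + h) - P x) / h - f x\<bar> < e" if h: "0 < h" "h < d" for h
    proof -
      have "P (x + h) - P x = integral {x..x + h} f"
        using P[of x "x + h"] h set_borel_integral_eq_integral(2)[OF si] by simp
      then show ?thesis using d(2)[OF h] by (simp add: divide_inverse mult.commute)
    qed
    then show "\<exists>d>0. \<forall>h. 0 < h \<and> h < d \<longrightarrow> \<bar>(P (x + h) - P x) / h - f x\<bar> < e" using d(1) by blast
  qed
  then have "{x \<in> space lebesgue. \<not> (\<forall>e>0. \<exists>d>0. \<forall>h. 0 < h \<and> h < d \<longrightarrow> \<bar>(P (x + h) - P x) / h - f x\<bar> < e)} \<subseteq> N"
    by blast
  moreover have "N \<in> null_sets lebesgue" using N(1) by (simp add: negligible_iff_null_sets)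
  ultimately show ?thesis
    by (intro AE_I'[of N])
qed

text \<open>Lebesgue's differentiation theorem on the line. The right derivative comes from averages over
  \<open>{x..x + h}\<close>, the left derivative from the same statement after reflection at the origin.\<close>

lemma AE_has_derivative_of_integral:
  fixes f P :: "real \<Rightarrow> real"
  assumes f: "integrable lborel f" and P: "\<And>a b. a \<le> b \<Longrightarrow> P b - P a = (LBINT y:{a..b}. f y)"
  shows "AE x in lebesgue. (P has_real_derivative f x) (at x)"
proof -
  let ?R = "\<lambda>P f x. \<forall>e>0. \<exists>d>0. \<forall>h. 0 < h \<and> h < d \<longrightarrow> \<bar>(P (x + h) - P x) / h - f x\<bar> < (e::real)"
  have f': "integrable lborel (\<lambda>x. f (- x))"
    using lborel_integrable_real_affine[OF f, of "-1" 0] by simp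
  have P': "(- P (- b)) - (- P (- a)) = (LBINT y:{a..b}. f (- y))" if "a \<le> b" for a b
  proof -
    have "(LBINT y:{a..b}. f (- y)) = (LBINT y:{- b..- a}. f y)"
      unfolding set_lebesgue_integral_def
      using lborel_integral_real_affine[of "-1" "\<lambda>y. indicator {- b..- a} y *\<^sub>R f y" 0]
      by (simp add: indicator_def if_distrib conj_commute neg_le_iff_le minus_le_iff le_minus_iff cong: if_cong)
    then show ?thesis using P[of "- b" "- a"] that by simp
  qed
  have "AE x in lebesgue. ?R (\<lambda>x. - P (- x)) (\<lambda>x. f (- x)) x"
    by (rule AE_right_derivative_of_integral[OF f']) (rule P')
  then obtain N where N: "N \<in> null_sets lebesgue" "{x \<in> space lebesgue. \<not> ?R (\<lambda>x. - P (- x)) (\<lambda>x. f (- x)) x} \<subseteq> N"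
    unfolding eventually_ae_filter by blast
  have negN: "negligible (uminus ` N)"
    using N(1) by (intro negligible_differentiable_image_negligible) (auto simp: negligible_iff_null_sets intro!: derivative_intros)
  have L: "AE x in lebesgue. ?R (\<lambda>x. - P (- x)) (\<lambda>x. f (- x)) (- x)"
  proof (rule AE_I'[of "uminus ` N"])
    show "uminus ` N \<in> null_sets lebesgue" using negN by (simp add: negligible_iff_null_sets)
    show "{x \<in> space lebesgue. \<not> ?R (\<lambda>x. - P (- x)) (\<lambda>x. f (- x)) (- x)} \<subseteq> uminus ` N"
    proof
      fix x assume "x \<in> {x \<in> space lebesgue. \<not> ?R (\<lambda>x. - P (- x)) (\<lambda>x. f (- x)) (- x)}"
      then have "- x \<in> N" by (intro subsetD[OF N(2)]) simp
      then show "x \<in> uminus ` N" by (rule rev_image_eqI) simp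
    qed
  qed
  have R: "AE x in lebesgue. ?R P f x"
    by (rule AE_right_derivative_of_integral[OF f]) (rule P)
  show ?thesis
    using R L
  proof eventually_elim
    case (elim x)
    show ?case unfolding DERIV_def LIM_def
    proof (intro allI impI)
      fix e :: real assume e: "0 < e"
      obtain d1 where d1: "d1 > 0" "\<And>h. 0 < h \<Longrightarrow> h < d1 \<Longrightarrow> \<bar>(P (x + h) - P x) / h - f x\<bar> < e"
        using elim(1) e by blast
      obtain d2 where d2: "d2 > 0" "\<And>h. 0 < h \<Longrightarrow> h < d2 \<Longrightarrow> \<bar>(- P (- (- x + h)) - (- P (- (- x)))) / h - f (- (- x))\<bar> < e"
        using elim(2) e by blast
      have "\<bar>(P (x + h) - P x) / h - f x\<bar> < e" if h: "h \<noteq> 0" "\<bar>h\<bar> < min d1 d2" for h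
      proof (cases "0 < h")
        case True
        then show ?thesis using d1(2)[of h] h by simp
      next
        case False
        then have h': "0 < - h" "- h < d2" using h by auto
        have "(- P (- (- x + - h)) - (- P (- (- x)))) / (- h) = (P (x + h) - P x) / h"
          using h(1) by (simp add: field_simps)
        then show ?thesis using d2(2)[OF h'] by simp
      qed
      then show "\<exists>s>0. \<forall>h. h \<noteq> 0 \<and> dist h 0 < s \<longrightarrow> dist ((P (x + h) - P x) / h) (f x) < e"
        using d1(1) d2(1) by (intro exI[of _ "min d1 d2"]) (simp add: dist_real_def)
    qed
  qed
qed

text \<open>Outside the truncation of \<open>\<bar>f\<bar>\<close> at height \<open>n\<close> the integral is small on all sets, and below it
  a set contributes at most \<open>n\<close> times its measure.\<close>

lemma absolutely_continuous_integral:
  fixes f :: "real \<Rightarrow> real"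
  assumes f: "integrable lborel f" and e: "0 < e"
  shows "\<exists>\<delta>>0. \<forall>A\<in>sets borel. emeasure lborel A < ennreal \<delta> \<longrightarrow> (LBINT y:A. \<bar>f y\<bar>) < e"
proof -
  have [measurable]: "f \<in> borel_measurable borel" using borel_measurable_integrable[OF f] by simp
  let ?r = "\<lambda>n y. \<bar>f y\<bar> - min \<bar>f y\<bar> (real n)"
  have ri: "integrable lborel (?r n)" for n
    by (rule Bochner_Integration.integrable_bound[OF f]) auto
  have "(\<lambda>n. LINT y|lborel. ?r n y) \<longlonglongrightarrow> (LINT y|(lborel :: real measure). (0::real))"
  proof (rule integral_dominated_convergence[where w="\<lambda>y. \<bar>f y\<bar>"])
    show "AE y in lborel. (\<lambda>n. ?r n y) \<longlonglongrightarrow> 0"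
    proof (rule AE_I2)
      fix y
      obtain N :: nat where N: "\<bar>f y\<bar> \<le> real N" using real_arch_simple by blast
      have "?r n y = 0" if "n \<ge> N" for n
        using N that by (simp add: min_def)
      then show "(\<lambda>n. ?r n y) \<longlonglongrightarrow> 0"
        by (intro tendsto_eventually) (auto simp: eventually_sequentially)
    qed
  qed (use f in auto)
  then have lim: "(\<lambda>n. LINT y|lborel. ?r n y) \<longlonglongrightarrow> 0" by simp
  have "\<forall>\<^sub>F n in sequentially. (LINT y|lborel. ?r n y) < e / 2"
    by (rule order_tendstoD(2)[OF lim]) (simp add: e)
  then obtain n where n: "(LINT y|lborel. ?r n y) < e / 2"
    unfolding eventually_sequentially by blast
  define \<delta> where "\<delta> = e / (2 * (real n + 1))"
  have d: "\<delta> > 0" using e by (simp add: \<delta>_def)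
  have "(LBINT y:A. \<bar>f y\<bar>) < e" if A [measurable]: "A \<in> sets borel" and le: "emeasure lborel A < ennreal \<delta>" for A
  proof -
    have fin: "emeasure lborel A < \<infinity>" using le by (rule less_trans) simp
    have ind: "integrable lborel (indicat_real A)" using fin by (simp add: integrable_real_indicator)
    have "(LBINT y:A. \<bar>f y\<bar>) \<le> (LINT y|lborel. ?r n y + (real n + 1) * indicator A y)"
      unfolding set_lebesgue_integral_def real_scaleR_def
    proof (rule integral_mono_AE')
      show "integrable lborel (\<lambda>y. ?r n y + (real n + 1) * indicator A y)"
        using ri ind by (intro Bochner_Integration.integrable_add integrable_mult_right)
      have "indicator A y * \<bar>f y\<bar> \<le> ?r n y + (real n + 1) * indicator A y" for y
        by (cases "y \<in> A") (simp_all add: min_def)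
      then show "AE y in lborel. indicator A y * \<bar>f y\<bar> \<le> ?r n y + (real n + 1) * indicator A y" by simp
      have "0 \<le> ?r n y + (real n + 1) * indicator A y" for y
        by (cases "y \<in> A") (simp_all add: min_def)
      then show "AE y in lborel. 0 \<le> ?r n y + (real n + 1) * indicator A y" by simp
    qed
    also have "\<dots> = (LINT y|lborel. ?r n y) + (real n + 1) * measure lborel A"
      using ri ind by (subst Bochner_Integration.integral_add) (simp_all add: integrable_mult_right)
    also have "\<dots> < e"
    proof -
      have "emeasure lborel A = ennreal (measure lborel A)"
        by (rule emeasure_eq_ennreal_measure) (use fin in simp)
      then have "measure lborel A < \<delta>" using le by (simp add: ennreal_less_iff)
      then have "(real n + 1) * measure lborel A \<le> (real n + 1) * \<delta>"
        by (intro mult_left_mono) simp_all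
      also have "(real n + 1) * \<delta> = e / 2" by (simp add: \<delta>_def field_simps)
      finally show ?thesis using n by simp
    qed
    finally show ?thesis .
  qed
  then show ?thesis by (intro exI[of _ \<delta>] conjI d ballI impI)
qed

lemma absolutely_continuous_fun_of_integral:
  fixes f P :: "real \<Rightarrow> real"
  assumes f: "integrable lborel f" and P: "\<And>a b. a \<le> b \<Longrightarrow> P b - P a = (LBINT y:{a..b}. f y)"
  shows "absolutely_continuous_fun P"
  unfolding absolutely_continuous_fun_def
proof (intro allI impI)
  fix e :: real assume "0 < e"
  from absolutely_continuous_integral[OF f this] obtain \<delta> where d: "\<delta> > 0"
    "\<And>A. A \<in> sets borel \<Longrightarrow> emeasure lborel A < ennreal \<delta> \<Longrightarrow> (LBINT y:A. \<bar>f y\<bar>) < e" by blast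
  have si: "set_integrable lborel A (\<lambda>y. \<bar>f y\<bar>)" "set_integrable lborel A f" if "A \<in> sets borel" for A
    unfolding set_integrable_def using that f by (intro integrable_mult_indicator; simp)+
  show "\<exists>\<delta>>0. \<forall>(m::nat) a b. (\<forall>i<m. a i \<le> b i) \<and> disjoint_family_on (\<lambda>i. {a i<..<b i}) {..<m} \<and>
      (\<Sum>i<m. b i - a i) < \<delta> \<longrightarrow> (\<Sum>i<m. \<bar>P (b i) - P (a i)\<bar>) < e"
  proof (intro exI[of _ \<delta>] conjI allI impI d(1))
    fix m :: nat and a b :: "nat \<Rightarrow> real"
    assume "(\<forall>i<m. a i \<le> b i) \<and> disjoint_family_on (\<lambda>i. {a i<..<b i}) {..<m} \<and> (\<Sum>i<m. b i - a i) < \<delta>"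
    then have ab: "\<And>i. i < m \<Longrightarrow> a i \<le> b i" and dj: "disjoint_family_on (\<lambda>i. {a i<..<b i}) {..<m}"
      and sm: "(\<Sum>i<m. b i - a i) < \<delta>" by auto
    let ?A = "\<Union>i\<in>{..<m}. {a i<..<b i}"
    have "\<bar>P (b i) - P (a i)\<bar> \<le> (LBINT y:{a i<..<b i}. \<bar>f y\<bar>)" if "i < m" for i
    proof -
      have "P (b i) - P (a i) = (LBINT y:{a i<..<b i}. f y)"
        unfolding P[OF ab[OF that]]
      proof (rule set_integral_cong_set)
        show "AE y in lborel. (y \<in> {a i<..<b i}) = (y \<in> {a i..b i})"
          using AE_lborel_singleton[of "a i"] AE_lborel_singleton[of "b i"] by eventually_elim auto
      qed (use f in \<open>simp_all add: set_borel_measurable_def\<close>)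
      then show ?thesis
        using set_integral_norm_bound[OF si(2), of "{a i<..<b i}"] by simp
    qed
    then have "(\<Sum>i<m. \<bar>P (b i) - P (a i)\<bar>) \<le> (\<Sum>i<m. LBINT y:{a i<..<b i}. \<bar>f y\<bar>)"
      by (intro sum_mono) simp
    also have "\<dots> = (LBINT y:?A. \<bar>f y\<bar>)"
    proof (rule set_integral_finite_UN_AE[symmetric])
      show "AE y in lborel. y \<in> {a i<..<b i} \<and> y \<in> {a j<..<b j} \<longrightarrow> i = j" if "i \<in> {..<m}" "j \<in> {..<m}" for i j
      proof (rule AE_I2, rule impI, rule ccontr)
        fix y assume y: "y \<in> {a i<..<b i} \<and> y \<in> {a j<..<b j}" and "i \<noteq> j"
        then have "{a i<..<b i} \<inter> {a j<..<b j} = {}" using dj that unfolding disjoint_family_on_def by blast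
        then show False using y by blast
      qed
    qed (simp_all add: si)
    also have "\<dots> < e"
    proof (rule d(2))
      have "emeasure lborel ?A \<le> (\<Sum>i<m. emeasure lborel {a i<..<b i})"
        by (rule emeasure_subadditive_finite) auto
      also have "\<dots> = (\<Sum>i<m. ennreal (b i - a i))"
        by (intro sum.cong refl) (simp add: ab)
      also have "\<dots> = ennreal (\<Sum>i<m. b i - a i)"
        by (rule sum_ennreal) (simp add: ab)
      also have "\<dots> < ennreal \<delta>" using sm d(1) by (simp add: ennreal_lessI)
      finally show "emeasure lborel ?A < ennreal \<delta>" .
    qed simp
    finally show "(\<Sum>i<m. \<bar>P (b i) - P (a i)\<bar>) < e" .
  qed
qed

text \<open>The density \<open>p\<close> satisfies \<open>p b - p a = - E(\<Theta>; a < Y \<le> b)\<close>, which is minus the integral of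
  \<open>\<theta> * p\<close> over \<open>{a..b}\<close>, where \<open>\<theta> (Y)\<close> is the conditional mean of \<open>\<Theta>\<close> given \<open>Y\<close>. Hence \<open>p\<close> is
  absolutely continuous with score \<open>- \<theta>\<close>, so that score plus identity at \<open>Y\<close> is the conditional mean of \<open>Y - \<Theta>\<close>,
  and conditioning does not increase the second moment.\<close>

theorem (in prob_space) ibp_weight_fisher_distance_le:
  assumes w: "ibp_weight M Y \<Theta>" and Yi: "integrable M Y"
    and sq: "integrable M (\<lambda>\<omega>. (Y \<omega> - \<Theta> \<omega>)\<^sup>2)"
  shows "\<exists>p. has_ac_density M Y p \<and> fisher_distance M Y p \<le> (\<integral>\<^sup>+\<omega>. ennreal ((Y \<omega> - \<Theta> \<omega>)\<^sup>2) \<partial>M)"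
proof -
  have Y [measurable]: "Y \<in> borel_measurable M" and T: "integrable M \<Theta>"
    using w unfolding ibp_weight_def by blast+
  have Tm [measurable]: "\<Theta> \<in> borel_measurable M" using T by simp
  let ?p = "upper_mean Y \<Theta>"
  have dist: "distributed M lborel Y (\<lambda>y. ennreal (?p y))" by (rule ibp_weight_distributed[OF w])
  have cont: "continuous_on UNIV ?p" by (rule continuous_upper_mean[OF Y T ibp_weight_no_atoms[OF w]])
  have pm [measurable]: "?p \<in> borel_measurable borel" by (rule borel_measurable_continuous_onI[OF cont])
  have nn: "0 \<le> ?p y" for y by (rule upper_mean_nonneg[OF w])
  obtain \<theta> :: "real \<Rightarrow> real" where th [measurable]: "\<theta> \<in> borel_measurable borel" and thi: "integrable M (\<lambda>\<omega>. \<theta> (Y \<omega>))"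
    and thA: "\<And>A. A \<in> sets borel \<Longrightarrow> expectation (\<lambda>\<omega>. indicator A (Y \<omega>) * \<Theta> \<omega>) = expectation (\<lambda>\<omega>. indicator A (Y \<omega>) * \<theta> (Y \<omega>))"
    by (rule conditional_mean_function[OF Y T]) (rule that)
  define u where "u y = - (?p y * \<theta> y)" for y
  have ui: "integrable lborel u"
    unfolding u_def using distributed_integrable[OF dist, of \<theta>] thi nn by simp
  have pu: "?p b - ?p a = (LBINT y:{a..b}. u y)" if "a \<le> b" for a b
  proof -
    have "?p a - ?p b = expectation (\<lambda>\<omega>. indicator {a<..b} (Y \<omega>) * \<theta> (Y \<omega>))"
      unfolding upper_mean_diff[OF Y T that] by (rule thA) simp
    also have "\<dots> = (LINT y|lborel. ?p y * (indicator {a<..b} y * \<theta> y))"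
      by (rule distributed_integral[OF dist, symmetric]) (use nn in simp_all)
    also have "\<dots> = (LINT y|lborel. - (indicator {a..b} y *\<^sub>R u y))"
    proof (rule integral_cong_AE)
      show "AE y in lborel. ?p y * (indicator {a<..b} y * \<theta> y) = - (indicator {a..b} y *\<^sub>R u y)"
        using AE_lborel_singleton[of a] by eventually_elim (auto simp: indicator_def u_def)
    qed (simp_all add: u_def)
    also have "\<dots> = - (LBINT y:{a..b}. u y)" by (simp add: set_lebesgue_integral_def)
    finally show ?thesis by simp
  qed
  have ac: "absolutely_continuous_fun ?p"
    by (rule absolutely_continuous_fun_of_integral[OF ui]) (rule pu)
  have "AE y in lebesgue. (?p has_real_derivative u y) (at y)"
    by (rule AE_has_derivative_of_integral[OF ui]) (rule pu)
  then have der: "AE y in lborel. (?p has_real_derivative u y) (at y)"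
    by (simp add: AE_completion_iff)
  have "AE y in density lborel (\<lambda>y. ennreal (?p y)). score ?p y = - \<theta> y"
    unfolding AE_density[OF measurable_compose[OF pm[folded measurable_lborel2] measurable_ennreal]]
    using der
  proof eventually_elim
    case (elim y)
    then have "deriv ?p y = u y" by (rule DERIV_imp_deriv)
    then show ?case by (simp add: score_def u_def)
  qed
  then have "AE y in distr M lborel Y. score ?p y = - \<theta> y"
    unfolding distributed_distr_eq_density[OF dist] .
  then have sc: "AE \<omega> in M. score ?p (Y \<omega>) = - \<theta> (Y \<omega>)"
    by (intro AE_distrD[of Y M lborel]) simp_all
  define F where "F = vimage_algebra (space M) Y borel"
  have subF: "subalgebra M F"
    unfolding subalgebra_def F_def using Y by (auto simp: sets_vimage_algebra2 measurable_sets)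
  interpret finite_measure_subalgebra M F
    by unfold_locales (rule subF)
  have YF: "Y \<in> borel_measurable F" unfolding F_def by (rule measurable_vimage_algebra1) simp
  have ce: "AE \<omega> in M. real_cond_exp M F (\<lambda>\<omega>. Y \<omega> - \<Theta> \<omega>) \<omega> = Y \<omega> - \<theta> (Y \<omega>)"
  proof (rule real_cond_exp_charact)
    show "integrable M (\<lambda>\<omega>. Y \<omega> - \<Theta> \<omega>)" "integrable M (\<lambda>\<omega>. Y \<omega> - \<theta> (Y \<omega>))"
      using Yi T thi by simp_all
    show "(\<lambda>\<omega>. Y \<omega> - \<theta> (Y \<omega>)) \<in> borel_measurable F"
      by (rule measurable_compose[OF YF, of "\<lambda>y. y - \<theta> y"]) measurable
    fix A assume "A \<in> sets F"
    then obtain B where B [measurable]: "B \<in> sets borel" and A: "A = Y -` B \<inter> space M"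
      unfolding F_def by (auto simp: sets_vimage_algebra2)
    have ind: "integrable M (\<lambda>\<omega>. indicator B (Y \<omega>) * h \<omega>)" if h: "integrable M h" for h :: "'a \<Rightarrow> real"
      by (rule Bochner_Integration.integrable_bound[OF h]) (use h in \<open>auto simp: indicator_def\<close>)
    have eqA: "(LINT \<omega>:A|M. Y \<omega> - h \<omega>) = expectation (\<lambda>\<omega>. indicator B (Y \<omega>) * Y \<omega>) - expectation (\<lambda>\<omega>. indicator B (Y \<omega>) * h \<omega>)"
      if h: "integrable M h" for h :: "'a \<Rightarrow> real"
    proof -
      have "(LINT \<omega>:A|M. Y \<omega> - h \<omega>) = expectation (\<lambda>\<omega>. indicator B (Y \<omega>) * Y \<omega> - indicator B (Y \<omega>) * h \<omega>)"
        unfolding set_lebesgue_integral_def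
        by (rule Bochner_Integration.integral_cong) (simp_all add: A indicator_def)
      then show ?thesis by (simp add: Bochner_Integration.integral_diff[OF ind[OF Yi] ind[OF h]])
    qed
    show "(LINT \<omega>:A|M. Y \<omega> - \<Theta> \<omega>) = (LINT \<omega>:A|M. Y \<omega> - \<theta> (Y \<omega>))"
      unfolding eqA[OF T] eqA[OF thi] using thA[OF B] by simp
  qed
  have cvx: "convex_on UNIV (\<lambda>x::real. x\<^sup>2)"
    by (rule convex_power2)
  have jensen: "AE \<omega> in M. (real_cond_exp M F (\<lambda>\<omega>. Y \<omega> - \<Theta> \<omega>) \<omega>)\<^sup>2 \<le> real_cond_exp M F (\<lambda>\<omega>. (Y \<omega> - \<Theta> \<omega>)\<^sup>2) \<omega>"
    by (rule real_cond_exp_jensens_inequality(2)[where I=UNIV]) (use Yi T sq cvx in simp_all)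
  have le: "AE \<omega> in M. (score ?p (Y \<omega>) + Y \<omega>)\<^sup>2 \<le> real_cond_exp M F (\<lambda>\<omega>. (Y \<omega> - \<Theta> \<omega>)\<^sup>2) \<omega>"
    using jensen ce sc
  proof eventually_elim
    case (elim \<omega>)
    have "score ?p (Y \<omega>) + Y \<omega> = real_cond_exp M F (\<lambda>\<omega>. Y \<omega> - \<Theta> \<omega>) \<omega>" using elim(2,3) by simp
    then show ?case using elim(1) by simp
  qed
  have "fisher_distance M Y ?p \<le> (\<integral>\<^sup>+\<omega>. ennreal (real_cond_exp M F (\<lambda>\<omega>. (Y \<omega> - \<Theta> \<omega>)\<^sup>2) \<omega>) \<partial>M)"
    unfolding fisher_distance_def
    by (rule nn_integral_mono_AE, use le in eventually_elim) (rule ennreal_leI)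
  also have "\<dots> = ennreal (expectation (real_cond_exp M F (\<lambda>\<omega>. (Y \<omega> - \<Theta> \<omega>)\<^sup>2)))"
  proof (rule nn_integral_eq_integral)
    show "integrable M (real_cond_exp M F (\<lambda>\<omega>. (Y \<omega> - \<Theta> \<omega>)\<^sup>2))" by (rule real_cond_exp_int(1)[OF sq])
    show "AE \<omega> in M. 0 \<le> real_cond_exp M F (\<lambda>\<omega>. (Y \<omega> - \<Theta> \<omega>)\<^sup>2) \<omega>"
      using le by eventually_elim (rule order_trans[OF zero_le_power2])
  qed
  also have "\<dots> = (\<integral>\<^sup>+\<omega>. ennreal ((Y \<omega> - \<Theta> \<omega>)\<^sup>2) \<partial>M)"
    unfolding real_cond_exp_int(2)[OF sq] by (rule nn_integral_eq_integral[OF sq, symmetric]) simp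
  finally have "fisher_distance M Y ?p \<le> (\<integral>\<^sup>+\<omega>. ennreal ((Y \<omega> - \<Theta> \<omega>)\<^sup>2) \<partial>M)" .
  moreover have "has_ac_density M Y ?p"
    unfolding has_ac_density_def using nn ac dist by blast
  ultimately show ?thesis by blast
qed

section \<open>The integration by parts identity for a function of the vector\<close>

lemma partial_eq_derivative:
  fixes f :: "real ^ 'n::finite \<Rightarrow> real"
  assumes "(f has_derivative f') (at x)"
  shows "partial k f x = f' (axis k 1)"
proof -
  have eq: "(\<chi> j. if j = k then t else x $ j) = x + (t - x $ k) *\<^sub>R axis k 1" for t
    by (simp add: vec_eq_iff axis_def)
  have "((\<lambda>t. x + (t - x $ k) *\<^sub>R axis k 1) has_derivative (\<lambda>h. h *\<^sub>R axis k 1)) (at (x $ k))"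
    by (auto intro!: derivative_eq_intros)
  moreover have "(f has_derivative f') (at (x + (x $ k - x $ k) *\<^sub>R axis k 1))" using assms by simp
  ultimately have "((\<lambda>t. f (x + (t - x $ k) *\<^sub>R axis k 1)) has_derivative (\<lambda>h. f' (h *\<^sub>R axis k 1))) (at (x $ k))"
    by (rule has_derivative_compose)
  moreover have "f' (h *\<^sub>R axis k 1) = f' (axis k 1) * h" for h
    using linear_scale[OF has_derivative_linear[OF assms], of h "axis k 1"] by simp
  ultimately have "((\<lambda>t. f (x + (t - x $ k) *\<^sub>R axis k 1)) has_real_derivative f' (axis k 1)) (at (x $ k))"
    by (simp add: has_field_derivative_def)
  then show ?thesis unfolding partial_def eq by (rule DERIV_imp_deriv)
qed

text \<open>A limit of difference quotients along \<open>1 / n\<close>. The indicator function is needed because the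
  partial derivative is unspecified outside the open set.\<close>

lemma borel_measurable_partial:
  fixes f :: "real ^ 'n::finite \<Rightarrow> real"
  assumes R: "open R" and f: "\<And>x. x \<in> R \<Longrightarrow> f differentiable (at x)"
  shows "(\<lambda>x. indicator R x * partial k f x) \<in> borel_measurable borel"
proof -
  have "continuous_on R f"
    by (intro continuous_at_imp_continuous_on ballI differentiable_imp_continuous_within f)
  then have [measurable]: "(\<lambda>x. indicator R x *\<^sub>R f x) \<in> borel_measurable borel"
    by (rule borel_measurable_continuous_on_indicator[rotated]) (use R in simp)
  define f0 where "f0 x = indicator R x *\<^sub>R f x" for x
  have [measurable]: "f0 \<in> borel_measurable borel" unfolding f0_def by measurable
  have [measurable]: "R \<in> sets borel" using R by simp
  define q where "q n x = indicator R x * ((f0 (x + (1 / real (Suc n)) *\<^sub>R axis k 1) - f0 x) / (1 / real (Suc n)))" for n x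
  show ?thesis
  proof (rule borel_measurable_LIMSEQ_real)
    show "q n \<in> borel_measurable borel" for n unfolding q_def by measurable
    fix x :: "real ^ 'n"
    show "(\<lambda>n. q n x) \<longlonglongrightarrow> indicator R x * partial k f x"
    proof (cases "x \<in> R")
      case True
      obtain f' where f': "(f has_derivative f') (at x)" using f[OF True] by (auto simp: differentiable_def)
      have "((\<lambda>t::real. x + t *\<^sub>R axis k 1) has_derivative (\<lambda>h. h *\<^sub>R axis k 1)) (at 0)"
        by (auto intro!: derivative_eq_intros)
      moreover have "(f has_derivative f') (at (x + 0 *\<^sub>R axis k 1))" using f' by simp
      ultimately have "((\<lambda>t::real. f (x + t *\<^sub>R axis k 1)) has_derivative (\<lambda>h. f' (h *\<^sub>R axis k 1))) (at 0)"
        by (rule has_derivative_compose)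
      moreover have "f' (h *\<^sub>R axis k 1) = f' (axis k 1) * h" for h
        using linear_scale[OF has_derivative_linear[OF f'], of h "axis k 1"] by simp
      ultimately have "((\<lambda>t. f (x + t *\<^sub>R axis k 1)) has_real_derivative partial k f x) (at 0)"
        by (simp add: has_field_derivative_def partial_eq_derivative[OF f'])
      then have lim: "((\<lambda>h. (f (x + h *\<^sub>R axis k 1) - f x) / h) \<longlongrightarrow> partial k f x) (at 0)"
        unfolding DERIV_def by simp
      have h0: "(\<lambda>n. 1 / real (Suc n)) \<longlonglongrightarrow> 0"
        using LIMSEQ_inverse_real_of_nat by (simp add: inverse_eq_divide)
      have "filterlim (\<lambda>n. 1 / real (Suc n)) (at 0) sequentially"
        unfolding filterlim_at using h0 by simp
      from filterlim_compose[OF lim this]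
      have l1: "(\<lambda>n. (f (x + (1 / real (Suc n)) *\<^sub>R axis k 1) - f x) / (1 / real (Suc n))) \<longlonglongrightarrow> partial k f x" .
      have "(\<lambda>n. x + (1 / real (Suc n)) *\<^sub>R axis k 1) \<longlonglongrightarrow> x + 0 *\<^sub>R axis k 1"
        by (intro tendsto_add tendsto_scaleR tendsto_const h0)
      then have "\<forall>\<^sub>F n in sequentially. x + (1 / real (Suc n)) *\<^sub>R axis k 1 \<in> R"
        using topological_tendstoD[OF _ R, of _ x sequentially] True by simp
      then have ev: "\<forall>\<^sub>F n in sequentially. (f (x + (1 / real (Suc n)) *\<^sub>R axis k 1) - f x) / (1 / real (Suc n)) = q n x"
        by eventually_elim (simp add: q_def f0_def True)
      have "(\<lambda>n. q n x) \<longlonglongrightarrow> partial k f x"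
        by (rule Lim_transform_eventually[OF l1 ev])
      then show ?thesis using True by simp
    qed (simp add: q_def)
  qed
qed

text \<open>\<open>1 / y\<close> made smooth at the origin. As \<open>e\<close> tends to zero, it and its derivative tend to
  \<open>1 / y\<close> and \<open>- 1 / y\<^sup>2\<close> for \<open>y \<noteq> 0\<close> and are dominated by these limits in absolute value; for fixed \<open>e\<close>
  they are bounded.\<close>

definition regular_inverse :: "real \<Rightarrow> real \<Rightarrow> real" where
  "regular_inverse e y = y / (y\<^sup>2 + e)"

definition regular_inverse_deriv :: "real \<Rightarrow> real \<Rightarrow> real" where
  "regular_inverse_deriv e y = (e - y\<^sup>2) / (y\<^sup>2 + e)\<^sup>2"

lemma regular_inverse_has_derivative:
  assumes e: "e > 0"
  shows "(regular_inverse e has_real_derivative regular_inverse_deriv e y) (at y)"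
proof -
  have "y\<^sup>2 + e > 0" using e by (simp add: add_nonneg_pos)
  then have ne: "y\<^sup>2 + e \<noteq> 0" by simp
  have "((\<lambda>y. y\<^sup>2 + e) has_real_derivative 2 * y) (at y)"
    by (auto intro!: derivative_eq_intros)
  from DERIV_divide[OF DERIV_ident this ne] show ?thesis
    unfolding regular_inverse_def[abs_def] regular_inverse_deriv_def
    by (simp add: power2_eq_square algebra_simps)
qed

lemma regular_inverse_mult_bounds:
  assumes e: "e > 0"
  shows "0 \<le> regular_inverse e y * y" "regular_inverse e y * y \<le> 1"
proof -
  have p: "y\<^sup>2 + e > 0" using e by (simp add: add_nonneg_pos)
  have eq: "regular_inverse e y * y = y\<^sup>2 / (y\<^sup>2 + e)" by (simp add: regular_inverse_def power2_eq_square)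
  show "0 \<le> regular_inverse e y * y" "regular_inverse e y * y \<le> 1"
    unfolding eq using p e by (simp_all add: divide_le_eq)
qed

lemma abs_regular_inverse_le:
  assumes e: "e > 0"
  shows "\<bar>regular_inverse e y\<bar> \<le> 1 + 1 / e" "y \<noteq> 0 \<Longrightarrow> \<bar>regular_inverse e y\<bar> \<le> \<bar>inverse y\<bar>"
proof -
  have p: "y\<^sup>2 + e > 0" using e by (simp add: add_nonneg_pos)
  have "\<bar>y\<bar> \<le> 1 + y\<^sup>2"
  proof -
    have "0 \<le> (1 - \<bar>y\<bar>)\<^sup>2" by simp
    also have "(1 - \<bar>y\<bar>)\<^sup>2 = 1 - 2 * \<bar>y\<bar> + y\<^sup>2" by (simp add: power2_diff)
    finally have "2 * \<bar>y\<bar> \<le> 1 + y\<^sup>2" by simp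
    then show ?thesis by simp
  qed
  also have "1 + y\<^sup>2 \<le> (1 + 1 / e) * (y\<^sup>2 + e)"
    using e by (simp add: field_simps)
  finally show "\<bar>regular_inverse e y\<bar> \<le> 1 + 1 / e"
    unfolding regular_inverse_def using p by (simp add: abs_divide pos_divide_le_eq)
  assume y: "y \<noteq> 0"
  have "\<bar>regular_inverse e y\<bar> * \<bar>y\<bar> \<le> 1"
    using regular_inverse_mult_bounds[OF e, of y] by (simp flip: abs_mult)
  then show "\<bar>regular_inverse e y\<bar> \<le> \<bar>inverse y\<bar>" using y by (simp add: field_simps)
qed

lemma abs_regular_inverse_deriv_le:
  assumes e: "e > 0"
  shows "\<bar>regular_inverse_deriv e y\<bar> \<le> 1 / e" "y \<noteq> 0 \<Longrightarrow> \<bar>regular_inverse_deriv e y\<bar> \<le> (inverse y)\<^sup>2"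
proof -
  have p: "y\<^sup>2 + e > 0" using e by (simp add: add_nonneg_pos)
  have "\<bar>e - y\<^sup>2\<bar> \<le> y\<^sup>2 + e" using e by (simp add: abs_le_iff)
  then have "\<bar>regular_inverse_deriv e y\<bar> \<le> (y\<^sup>2 + e) / (y\<^sup>2 + e)\<^sup>2"
    unfolding regular_inverse_deriv_def abs_divide by (simp add: divide_right_mono)
  also have "\<dots> = 1 / (y\<^sup>2 + e)" using p by (simp add: power2_eq_square)
  finally have le: "\<bar>regular_inverse_deriv e y\<bar> \<le> 1 / (y\<^sup>2 + e)" .
  also have "\<dots> \<le> 1 / e" using e by (intro divide_left_mono) (simp_all add: add_nonneg_pos)
  finally show "\<bar>regular_inverse_deriv e y\<bar> \<le> 1 / e" .
  assume "y \<noteq> 0"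
  then have "1 / (y\<^sup>2 + e) \<le> 1 / y\<^sup>2" using e by (intro divide_left_mono) (simp_all add: add_nonneg_pos)
  with le show "\<bar>regular_inverse_deriv e y\<bar> \<le> (inverse y)\<^sup>2"
    by (simp add: inverse_eq_divide power_divide)
qed

lemma regular_inverse_tendsto:
  assumes y: "y \<noteq> 0"
  shows "(\<lambda>n. regular_inverse (1 / real (Suc n)) y) \<longlonglongrightarrow> inverse y"
    and "(\<lambda>n. regular_inverse_deriv (1 / real (Suc n)) y) \<longlonglongrightarrow> - (inverse y)\<^sup>2"
proof -
  have h0: "(\<lambda>n. 1 / real (Suc n)) \<longlonglongrightarrow> 0"
    using LIMSEQ_inverse_real_of_nat by (simp add: inverse_eq_divide)
  have "(\<lambda>n. regular_inverse (1 / real (Suc n)) y) \<longlonglongrightarrow> y / (y\<^sup>2 + 0)"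
    unfolding regular_inverse_def by (intro tendsto_divide tendsto_add tendsto_const h0) (use y in simp)
  moreover have "y / (y\<^sup>2 + 0) = inverse y" using y by (simp add: power2_eq_square field_simps)
  ultimately show "(\<lambda>n. regular_inverse (1 / real (Suc n)) y) \<longlonglongrightarrow> inverse y" by simp
  have "(\<lambda>n. regular_inverse_deriv (1 / real (Suc n)) y) \<longlonglongrightarrow> (0 - y\<^sup>2) / (y\<^sup>2 + 0)\<^sup>2"
    unfolding regular_inverse_deriv_def
    by (intro tendsto_divide tendsto_add tendsto_diff tendsto_power tendsto_const h0) (use y in simp)
  moreover have "(0 - y\<^sup>2) / (y\<^sup>2 + 0)\<^sup>2 = - (inverse y)\<^sup>2" using y by (simp add: power2_eq_square field_simps)
  ultimately show "(\<lambda>n. regular_inverse_deriv (1 / real (Suc n)) y) \<longlonglongrightarrow> - (inverse y)\<^sup>2" by simp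
qed

text \<open>The random vector, the function \<open>F\<close> and the functions \<open>g k\<close> with their structural assumptions;
  moment conditions are stated where they are used.\<close>

locale stein_setting = prob_space M for M :: "'a measure" +
  fixes X :: "'n::finite \<Rightarrow> 'a \<Rightarrow> real" and I :: "'n \<Rightarrow> real set"
    and d g :: "'n \<Rightarrow> real \<Rightarrow> real" and F :: "real ^ 'n \<Rightarrow> real"
  assumes indep: "indep_vars (\<lambda>_. borel) X UNIV"
    and I_interval: "\<And>k. open (I k)" "\<And>k. connected (I k)"
    and X_density: "\<And>k. distributed M lborel (X k) (\<lambda>x. ennreal (d k x))"
    and d_pos: "\<And>k x. x \<in> I k \<Longrightarrow> 0 < d k x"
    and d_zero: "\<And>k x. x \<notin> I k \<Longrightarrow> d k x = 0"
    and d_diff: "\<And>k x. x \<in> I k \<Longrightarrow> d k differentiable (at x)"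
    and F_C2: "Ck_on 2 (prod_range I) F"
    and g_cont: "\<And>k. continuous_on (I k) (g k)"
    and g_integrable: "\<And>k. integrable M (\<lambda>\<omega>. g k (X k \<omega>))"
    and g_mean: "\<And>k. expectation (\<lambda>\<omega>. g k (X k \<omega>)) = 0"
begin

abbreviation "R \<equiv> prod_range I"
abbreviation "W \<equiv> joint_density d"
abbreviation "V \<equiv> rvec X"

text \<open>The three functions \<open>\<Sum>k. g k\<close>, \<open>nabla d g F\<close> and the derivative of the latter along the vector
  field \<open>stein_L (d k) (g k)\<close>, extended by zero outside the range of the vector. Unlike the original
  functions, which are arbitrary there, they are Borel measurable; composed with the random
  vector they agree with the original functions almost surely.\<close>

definition S0 :: "real ^ 'n \<Rightarrow> real" where
  "S0 x = indicator R x * (\<Sum>k\<in>UNIV. g k (x $ k))"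

definition N0 :: "real ^ 'n \<Rightarrow> real" where
  "N0 x = indicator R x * nabla d g F x"

definition T0 :: "real ^ 'n \<Rightarrow> real" where
  "T0 x = indicator R x * (\<Sum>k\<in>UNIV. partial k (nabla d g F) x * stein_L (d k) (g k) (x $ k))"

lemma open_R: "open R"
  unfolding prod_range_def by (rule open_vector_box) (simp add: I_interval)

lemma R_nth: "x \<in> R \<Longrightarrow> x $ k \<in> I k"
  by (simp add: prod_range_def)

lemma R_borel [measurable]: "R \<in> sets borel"
  using open_R by simp

lemma d_nonneg: "0 \<le> d k x"
  using d_pos[of x k] d_zero[of x k] by (cases "x \<in> I k") (simp_all add: less_imp_le)

lemma d_borel [measurable]: "d k \<in> borel_measurable borel"
  using distributed_real_measurable[OF _ X_density[of k]] d_nonneg by simp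

lemma X_borel [measurable]: "X k \<in> borel_measurable M"
  using distributed_measurable[OF X_density[of k]] by simp

lemma V_borel [measurable]: "V \<in> borel_measurable M"
  by (rule borel_measurable_rvec) (rule X_borel)

lemma d_integral: "(\<integral>\<^sup>+x. ennreal (d k x) \<partial>lborel) = 1"
proof -
  have "(\<integral>\<^sup>+x. ennreal (d k x) * 1 \<partial>lborel) = (\<integral>\<^sup>+\<omega>. 1 \<partial>M)"
    by (rule distributed_nn_integral[OF X_density]) simp
  then show ?thesis by (simp add: emeasure_space_1)
qed

lemma law_V: "distributed M lborel V (\<lambda>x. ennreal (W x))"
  by (rule distr_rvec[OF indep X_density d_nonneg])

lemma W_nonneg: "0 \<le> W x"
  unfolding joint_density_def by (intro prod_nonneg ballI d_nonneg)

lemma W_borel [measurable]: "W \<in> borel_measurable borel"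
  unfolding joint_density_def[abs_def] by measurable

lemma W_zero: "x \<notin> R \<Longrightarrow> W x = 0"
proof -
  assume "x \<notin> R"
  then have "\<exists>k. x $ k \<notin> I k" unfolding prod_range_def by blast
  then obtain k where "x $ k \<notin> I k" ..
  then have "d k (x $ k) = 0" by (rule d_zero)
  then show "W x = 0" by (simp add: joint_density_split[of d x k])
qed

lemma AE_X: "AE \<omega> in M. X k \<omega> \<in> I k"
proof -
  have [measurable]: "I k \<in> sets borel" using I_interval by simp
  have "AE x in lborel. 0 < ennreal (d k x) \<longrightarrow> x \<in> I k"
    using d_zero by (intro AE_I2) force
  then show ?thesis
    by (subst distributed_AE2[OF X_density, of "\<lambda>x. x \<in> I k"]) simp_all
qed

lemma AE_R: "AE \<omega> in M. V \<omega> \<in> R"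
proof -
  have "AE \<omega> in M. \<forall>k\<in>UNIV. X k \<omega> \<in> I k"
    by (rule AE_finite_allI) (simp_all add: AE_X)
  then show ?thesis by (simp add: prod_range_def rvec_def)
qed

text \<open>The function \<open>g k\<close> is made measurable by cutting it off outside \<open>I k\<close>, where the density vanishes.\<close>

lemma g_lborel: "integrable lborel (\<lambda>y. g k y * d k y)" "(LINT y|lborel. g k y * d k y) = 0"
proof -
  define g1 where "g1 y = indicator (I k) y *\<^sub>R g k y" for y
  have [measurable]: "g1 \<in> borel_measurable borel"
    unfolding g1_def[abs_def]
    by (rule borel_measurable_continuous_on_indicator[OF _ g_cont]) (simp add: I_interval)
  have gm: "(\<lambda>\<omega>. g k (X k \<omega>)) \<in> borel_measurable M" using g_integrable by simp
  have ae: "AE \<omega> in M. g k (X k \<omega>) = g1 (X k \<omega>)"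
    using AE_X[of k] by eventually_elim (simp add: g1_def)
  have i1: "integrable M (\<lambda>\<omega>. g1 (X k \<omega>))"
    by (rule integrable_cong_AE_imp[OF g_integrable]) (use ae in \<open>auto elim: eventually_mono\<close>)
  have eq: "(\<lambda>y. d k y * g1 y) = (\<lambda>y. g k y * d k y)"
  proof
    fix y show "d k y * g1 y = g k y * d k y"
      by (cases "y \<in> I k") (simp_all add: g1_def d_zero)
  qed
  show "integrable lborel (\<lambda>y. g k y * d k y)"
    unfolding eq[symmetric] using distributed_integrable[OF X_density, of g1 k] i1 d_nonneg by simp
  have "(LINT y|lborel. d k y * g1 y) = expectation (\<lambda>\<omega>. g1 (X k \<omega>))"
    by (rule distributed_integral[OF X_density]) (simp_all add: d_nonneg)
  also have "\<dots> = expectation (\<lambda>\<omega>. g k (X k \<omega>))"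
    by (rule integral_cong_AE) (use gm ae in \<open>auto elim: eventually_mono\<close>)
  finally show "(LINT y|lborel. g k y * d k y) = 0" unfolding eq g_mean .
qed

lemma stein_L_differentiable:
  assumes x: "x \<in> I k"
  shows "stein_L (d k) (g k) differentiable (at x)"
proof -
  have "continuous_on (I k) (\<lambda>y. g k y * d k y)"
    by (intro continuous_on_mult g_cont continuous_at_imp_continuous_on ballI differentiable_imp_continuous_within d_diff)
  from tail_integral_has_derivative[OF g_lborel(1) I_interval(1) this x]
  have "tail_integral (\<lambda>y. g k y * d k y) differentiable (at x)"
    by (auto simp: real_differentiable_def)
  then have "(\<lambda>x. tail_integral (\<lambda>y. g k y * d k y) x / d k x) differentiable (at x)"
    by (rule differentiable_divide[OF _ d_diff[OF x]]) (use d_pos[OF x] in simp)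
  then show ?thesis by (simp add: stein_L_eq_tail_integral[abs_def])
qed

lemma stein_L_component_differentiable:
  assumes x: "x \<in> R"
  shows "(\<lambda>x. stein_L (d k) (g k) (x $ k)) differentiable (at x)"
proof -
  have "(\<lambda>x. x $ k) differentiable (at x)"
    using bounded_linear_imp_has_derivative[OF bounded_linear_vec_nth] by (auto simp: differentiable_def)
  from differentiable_compose[OF _ this, of "stein_L (d k) (g k)"] stein_L_differentiable[OF R_nth[OF x]]
  show ?thesis by simp
qed

lemma F_differentiable: "x \<in> R \<Longrightarrow> F differentiable (at x)"
  and partial_F_differentiable: "x \<in> R \<Longrightarrow> partial k F differentiable (at x)"
proof -
  have "Ck_on (Suc (Suc 0)) R F" using F_C2 by (simp add: numeral_2_eq_2)
  then show "x \<in> R \<Longrightarrow> F differentiable (at x)" "x \<in> R \<Longrightarrow> partial k F differentiable (at x)"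
    by simp_all
qed

lemma nabla_differentiable: "x \<in> R \<Longrightarrow> nabla d g F differentiable (at x)"
  unfolding nabla_def[abs_def]
  by (intro differentiable_sum ballI differentiable_mult partial_F_differentiable stein_L_component_differentiable finite)

lemma F0_borel [measurable]: "(\<lambda>x. indicator R x * F x) \<in> borel_measurable borel"
  using borel_measurable_continuous_on_indicator[of R F, OF R_borel]
  by (simp add: continuous_at_imp_continuous_on differentiable_imp_continuous_within F_differentiable)

lemma N0_borel [measurable]: "N0 \<in> borel_measurable borel"
  unfolding N0_def[abs_def] using borel_measurable_continuous_on_indicator[of R "nabla d g F", OF R_borel]
  by (simp add: continuous_at_imp_continuous_on differentiable_imp_continuous_within nabla_differentiable)

lemma T0_borel [measurable]: "T0 \<in> borel_measurable borel"
proof -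
  have 1: "(\<lambda>x. indicator R x * partial k (nabla d g F) x) \<in> borel_measurable borel" for k
    by (rule borel_measurable_partial[OF open_R nabla_differentiable])
  have 2: "(\<lambda>x. indicator R x * stein_L (d k) (g k) (x $ k)) \<in> borel_measurable borel" for k
    using borel_measurable_continuous_on_indicator[of R "\<lambda>x. stein_L (d k) (g k) (x $ k)", OF R_borel]
    by (simp add: continuous_at_imp_continuous_on differentiable_imp_continuous_within stein_L_component_differentiable)
  have "T0 = (\<lambda>x. \<Sum>k\<in>UNIV. (indicator R x * partial k (nabla d g F) x) * (indicator R x * stein_L (d k) (g k) (x $ k)))"
    by (auto simp: T0_def fun_eq_iff indicator_def)
  then show ?thesis using 1 2 by simp
qed

lemma S0_borel [measurable]: "S0 \<in> borel_measurable borel"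
proof -
  have 1: "(\<lambda>x. indicator R x * g k (x $ k)) \<in> borel_measurable borel" for k
  proof -
    have "continuous_on R (\<lambda>x. g k (x $ k))"
      by (rule continuous_on_compose2[OF g_cont]) (auto intro!: continuous_intros simp: R_nth)
    from borel_measurable_continuous_on_indicator[OF R_borel this] show ?thesis by simp
  qed
  have "S0 = (\<lambda>x. \<Sum>k\<in>UNIV. indicator R x * g k (x $ k))"
    unfolding S0_def[abs_def] sum_distrib_left ..
  then show ?thesis by (simp only: borel_measurable_sum 1)
qed

lemma S0_V: "AE \<omega> in M. S0 (V \<omega>) = (\<Sum>k\<in>UNIV. g k (X k \<omega>))"
  using AE_R by eventually_elim (simp add: S0_def rvec_def)

lemma N0_V: "AE \<omega> in M. N0 (V \<omega>) = nabla d g F (V \<omega>)"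
  using AE_R by eventually_elim (simp add: N0_def)

lemma T0_V: "AE \<omega> in M. T0 (V \<omega>) = (\<Sum>k\<in>UNIV. partial k (nabla d g F) (V \<omega>) * stein_L (d k) (g k) (X k \<omega>))"
  using AE_R by eventually_elim (simp add: T0_def rvec_def)

lemma S0_integrable: "integrable M (\<lambda>\<omega>. S0 (V \<omega>))"
proof (rule integrable_cong_AE_imp)
  show "integrable M (\<lambda>\<omega>. \<Sum>k\<in>UNIV. g k (X k \<omega>))" using g_integrable by simp
  show "AE \<omega> in M. (\<Sum>k\<in>UNIV. g k (X k \<omega>)) = S0 (V \<omega>)" using S0_V by eventually_elim simp
qed measurable

text \<open>Integration by parts for \<open>U = \<phi> (F) * regular_inverse e (nabla d g F)\<close>. The derivative of \<open>F\<close>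
  along the vector field \<open>stein_L (d k) (g k)\<close> is \<open>nabla d g F\<close> and that of \<open>nabla d g F\<close> is \<open>T0\<close>, so
  the chain rule turns the left-hand side of the integration by parts into \<open>\<phi>' (F)\<close> times a factor that tends to one.\<close>

lemma regularised_identity:
  assumes \<phi>: "\<And>x. (\<phi> has_real_derivative \<phi>' x) (at x)" and c: "continuous_on UNIV \<phi>'"
    and b: "\<And>x. \<bar>\<phi> x\<bar> \<le> B" "\<And>x. \<bar>\<phi>' x\<bar> \<le> B"
    and Y: "(\<lambda>\<omega>. F (V \<omega>)) \<in> borel_measurable M"
    and T: "integrable M (\<lambda>\<omega>. T0 (V \<omega>))" and e: "e > 0"
  shows "expectation (\<lambda>\<omega>. \<phi>' (F (V \<omega>)) * (regular_inverse e (N0 (V \<omega>)) * N0 (V \<omega>)))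
    = expectation (\<lambda>\<omega>. \<phi> (F (V \<omega>)) * (regular_inverse e (N0 (V \<omega>)) * S0 (V \<omega>) - regular_inverse_deriv e (N0 (V \<omega>)) * T0 (V \<omega>)))"
proof -
  let ?\<chi> = "regular_inverse e" and ?\<chi>' = "regular_inverse_deriv e" and ?N = "nabla d g F"
  have [measurable]: "\<phi>' \<in> borel_measurable borel" by (rule borel_measurable_continuous_onI[OF c])
  have "continuous_on UNIV \<phi>" by (rule DERIV_continuous_on) (use \<phi> in \<open>auto intro: DERIV_subset\<close>)
  then have [measurable]: "\<phi> \<in> borel_measurable borel" by (rule borel_measurable_continuous_onI)
  have [measurable]: "?\<chi> \<in> borel_measurable borel" "?\<chi>' \<in> borel_measurable borel"
    unfolding regular_inverse_def[abs_def] regular_inverse_deriv_def[abs_def] by measurable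
  have B0: "0 \<le> B" using b(1)[of 0] by linarith
  define F0 where "F0 x = indicator R x * F x" for x
  have [measurable]: "F0 \<in> borel_measurable borel" unfolding F0_def by measurable
  define U where "U x = \<phi> (F x) * ?\<chi> (?N x)" for x
  have "\<forall>x. \<exists>U'. x \<in> R \<longrightarrow> (U has_derivative U') (at x) \<and>
     (\<Sum>k\<in>UNIV. U' (axis k 1) * stein_L (d k) (g k) (x $ k)) = \<phi>' (F0 x) * (?\<chi> (N0 x) * N0 x) + \<phi> (F0 x) * (?\<chi>' (N0 x) * T0 x)"
  proof
    fix x :: "real ^ 'n"
    show "\<exists>U'. x \<in> R \<longrightarrow> (U has_derivative U') (at x) \<and>
     (\<Sum>k\<in>UNIV. U' (axis k 1) * stein_L (d k) (g k) (x $ k)) = \<phi>' (F0 x) * (?\<chi> (N0 x) * N0 x) + \<phi> (F0 x) * (?\<chi>' (N0 x) * T0 x)"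
    proof (cases "x \<in> R")
      case True
      obtain F' where F': "(F has_derivative F') (at x)" using F_differentiable[OF True] by (auto simp: differentiable_def)
      obtain N' where N': "(?N has_derivative N') (at x)" using nabla_differentiable[OF True] by (auto simp: differentiable_def)
      let ?U' = "\<lambda>h. \<phi> (F x) * (?\<chi>' (?N x) * N' h) + (\<phi>' (F x) * F' h) * ?\<chi> (?N x)"
      have "(U has_derivative ?U') (at x)"
        unfolding U_def[abs_def]
        by (rule has_derivative_mult[OF has_derivative_compose[OF F' \<phi>[unfolded has_field_derivative_def]]
              has_derivative_compose[OF N' regular_inverse_has_derivative[OF e, unfolded has_field_derivative_def]]])
      moreover have "(\<Sum>k\<in>UNIV. ?U' (axis k 1) * stein_L (d k) (g k) (x $ k))
        = \<phi>' (F0 x) * (?\<chi> (N0 x) * N0 x) + \<phi> (F0 x) * (?\<chi>' (N0 x) * T0 x)"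
      proof -
        have "(\<Sum>k\<in>UNIV. ?U' (axis k 1) * stein_L (d k) (g k) (x $ k))
          = \<phi> (F x) * ?\<chi>' (?N x) * (\<Sum>k\<in>UNIV. N' (axis k 1) * stein_L (d k) (g k) (x $ k))
          + \<phi>' (F x) * ?\<chi> (?N x) * (\<Sum>k\<in>UNIV. F' (axis k 1) * stein_L (d k) (g k) (x $ k))"
          unfolding sum_distrib_left sum.distrib[symmetric] by (rule sum.cong) (simp_all add: algebra_simps)
        moreover have "(\<Sum>k\<in>UNIV. F' (axis k 1) * stein_L (d k) (g k) (x $ k)) = ?N x"
          by (simp add: nabla_def partial_eq_derivative[OF F'])
        moreover have "(\<Sum>k\<in>UNIV. N' (axis k 1) * stein_L (d k) (g k) (x $ k)) = T0 x"
          using True by (simp add: T0_def partial_eq_derivative[OF N'])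
        ultimately show ?thesis using True by (simp add: F0_def N0_def)
      qed
      ultimately show ?thesis by blast
    qed simp
  qed
  from choice[OF this] obtain U' where U': "\<And>x. x \<in> R \<Longrightarrow> (U has_derivative U' x) (at x)"
    "\<And>x. x \<in> R \<Longrightarrow> (\<Sum>k\<in>UNIV. U' x (axis k 1) * stein_L (d k) (g k) (x $ k)) = \<phi>' (F0 x) * (?\<chi> (N0 x) * N0 x) + \<phi> (F0 x) * (?\<chi>' (N0 x) * T0 x)"
    by blast
  \<comment> \<open>\<open>A\<close> is the part of the derivative of \<open>U\<close> that contains \<open>\<phi>'\<close>; everything else is moved to the other side as \<open>C\<close>\<close>
  define A where "A x = \<phi>' (F0 x) * (?\<chi> (N0 x) * N0 x)" for x
  define C where "C x = \<phi> (F0 x) * (?\<chi> (N0 x) * S0 x - ?\<chi>' (N0 x) * T0 x)" for x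
  have [measurable]: "A \<in> borel_measurable borel" "C \<in> borel_measurable borel" unfolding A_def C_def by measurable
  have eqf: "W x * ((\<Sum>k\<in>UNIV. U' x (axis k 1) * stein_L (d k) (g k) (x $ k)) - U x * (\<Sum>k\<in>UNIV. g k (x $ k)))
     = W x * (A x - C x)" for x
  proof (cases "x \<in> R")
    case True
    have "F0 x = F x" "N0 x = ?N x" "S0 x = (\<Sum>k\<in>UNIV. g k (x $ k))" using True by (simp_all add: F0_def N0_def S0_def)
    then show ?thesis unfolding U'(2)[OF True] A_def C_def U_def by (simp add: algebra_simps)
  qed (simp add: W_zero)
  have iA: "integrable M (\<lambda>\<omega>. A (V \<omega>))"
  proof (rule integrable_const_bound[where B=B])
    have "\<bar>A x\<bar> \<le> B" for x
    proof -
      have "\<bar>A x\<bar> = \<bar>\<phi>' (F0 x)\<bar> * (?\<chi> (N0 x) * N0 x)" 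
        unfolding A_def abs_mult[of "\<phi>' (F0 x)"] using regular_inverse_mult_bounds(1)[OF e] by simp
      also have "\<dots> \<le> B * 1"
        by (rule mult_mono[OF b(2) regular_inverse_mult_bounds(2)[OF e] B0 regular_inverse_mult_bounds(1)[OF e]])
      finally show ?thesis by simp
    qed
    then show "AE \<omega> in M. norm (A (V \<omega>)) \<le> B" by simp
  qed measurable
  have iC: "integrable M (\<lambda>\<omega>. C (V \<omega>))"
  proof (rule Bochner_Integration.integrable_bound)
    show "integrable M (\<lambda>\<omega>. B * ((1 + 1 / e) * \<bar>S0 (V \<omega>)\<bar> + 1 / e * \<bar>T0 (V \<omega>)\<bar>))"
      using S0_integrable T by (intro integrable_mult_right Bochner_Integration.integrable_add integrable_abs)
    have "\<bar>C x\<bar> \<le> B * ((1 + 1 / e) * \<bar>S0 x\<bar> + 1 / e * \<bar>T0 x\<bar>)" for x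
    proof -
      have "\<bar>?\<chi> (N0 x) * S0 x - ?\<chi>' (N0 x) * T0 x\<bar> \<le> \<bar>?\<chi> (N0 x) * S0 x\<bar> + \<bar>?\<chi>' (N0 x) * T0 x\<bar>"
        by (rule abs_triangle_ineq4)
      also have "\<dots> \<le> (1 + 1 / e) * \<bar>S0 x\<bar> + 1 / e * \<bar>T0 x\<bar>"
        unfolding abs_mult by (intro add_mono mult_right_mono abs_regular_inverse_le(1)[OF e] abs_regular_inverse_deriv_le(1)[OF e]) simp_all
      finally show ?thesis unfolding C_def abs_mult[of "\<phi> (F0 x)"] using b(1)[of "F0 x"] B0
        by (intro mult_mono) simp_all
    qed
    then show "AE \<omega> in M. norm (C (V \<omega>)) \<le> norm (B * ((1 + 1 / e) * \<bar>S0 (V \<omega>)\<bar> + 1 / e * \<bar>T0 (V \<omega>)\<bar>))"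
      by (intro AE_I2) (metis abs_ge_self order_trans real_norm_def)
  qed measurable
  have int: "integrable lborel (\<lambda>x. W x * (A x - C x))"
    using distributed_integrable[OF law_V, of "\<lambda>x. A x - C x"] iA iC W_nonneg by simp
  have Ub: "\<bar>U x\<bar> \<le> B * (1 + 1 / e)" for x
    unfolding U_def abs_mult by (rule mult_mono[OF b(1) abs_regular_inverse_le(1)[OF e] B0]) simp
  have "(LINT x|lborel. W x * ((\<Sum>k\<in>UNIV. U' x (axis k 1) * stein_L (d k) (g k) (x $ k)) - U x * (\<Sum>k\<in>UNIV. g k (x $ k)))) = 0"
    by (rule stein_integration_by_parts[where B="B * (1 + 1 / e)" and U'=U', OF I_interval d_nonneg d_borel d_integral d_pos d_zero d_diff g_cont g_lborel U'(1) Ub])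
       (assumption | simp only: eqf int)+
  then have "(LINT x|lborel. W x * (A x - C x)) = 0" unfolding eqf .
  moreover have "(LINT x|lborel. W x * (A x - C x)) = expectation (\<lambda>\<omega>. A (V \<omega>) - C (V \<omega>))"
    by (rule distributed_integral[OF law_V]) (simp_all add: W_nonneg)
  ultimately have "expectation (\<lambda>\<omega>. A (V \<omega>)) = expectation (\<lambda>\<omega>. C (V \<omega>))"
    using iA iC by simp
  moreover have "expectation (\<lambda>\<omega>. A (V \<omega>)) = expectation (\<lambda>\<omega>. \<phi>' (F (V \<omega>)) * (?\<chi> (N0 (V \<omega>)) * N0 (V \<omega>)))"
  proof (rule integral_cong_AE)
    show "AE \<omega> in M. A (V \<omega>) = \<phi>' (F (V \<omega>)) * (?\<chi> (N0 (V \<omega>)) * N0 (V \<omega>))"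
      using AE_R by eventually_elim (simp add: A_def F0_def)
  qed (use Y in measurable)
  moreover have "expectation (\<lambda>\<omega>. C (V \<omega>)) = expectation (\<lambda>\<omega>. \<phi> (F (V \<omega>)) * (?\<chi> (N0 (V \<omega>)) * S0 (V \<omega>) - ?\<chi>' (N0 (V \<omega>)) * T0 (V \<omega>)))"
  proof (rule integral_cong_AE)
    show "AE \<omega> in M. C (V \<omega>) = \<phi> (F (V \<omega>)) * (?\<chi> (N0 (V \<omega>)) * S0 (V \<omega>) - ?\<chi>' (N0 (V \<omega>)) * T0 (V \<omega>))"
      using AE_R by eventually_elim (simp add: C_def F0_def)
  qed (use Y in measurable)
  ultimately show ?thesis by simp
qed

end

lemma (in prob_space) integrable_of_square:
  fixes f :: "'a \<Rightarrow> real"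
  assumes [measurable]: "f \<in> borel_measurable M" and fin: "(\<integral>\<^sup>+\<omega>. ennreal ((f \<omega>)\<^sup>2) \<partial>M) < \<infinity>"
  shows "integrable M (\<lambda>\<omega>. (f \<omega>)\<^sup>2)" "integrable M f"
proof -
  show sq: "integrable M (\<lambda>\<omega>. (f \<omega>)\<^sup>2)"
    by (rule integrableI_nonneg) (use fin in simp_all)
  show "integrable M f" by (rule square_integrable_imp_integrable[OF _ sq]) measurable
qed

context stein_setting
begin

definition weight :: "'a \<Rightarrow> real" where
  "weight \<omega> = S0 (V \<omega>) * inverse (N0 (V \<omega>)) + T0 (V \<omega>) * (inverse (N0 (V \<omega>)))\<^sup>2"

text \<open>Letting the regularisation parameter tend to zero; the bounds for \<open>regular_inverse\<close> make the
  integrands dominated by the two terms of \<open>weight\<close>.\<close>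

lemma ibp_weight_F:
  assumes Y [measurable]: "(\<lambda>\<omega>. F (V \<omega>)) \<in> borel_measurable M"
    and nz: "AE \<omega> in M. N0 (V \<omega>) \<noteq> 0"
    and T: "integrable M (\<lambda>\<omega>. T0 (V \<omega>))"
    and SN: "integrable M (\<lambda>\<omega>. S0 (V \<omega>) * inverse (N0 (V \<omega>)))"
    and TN: "integrable M (\<lambda>\<omega>. T0 (V \<omega>) * (inverse (N0 (V \<omega>)))\<^sup>2)"
  shows "ibp_weight M (\<lambda>\<omega>. F (V \<omega>)) weight"
  unfolding ibp_weight_def
proof (intro conjI allI impI)
  show "integrable M weight" unfolding weight_def[abs_def] using SN TN by simp
  fix \<phi> \<phi>' :: "real \<Rightarrow> real" and B :: real
  assume \<phi>: "\<forall>x. (\<phi> has_real_derivative \<phi>' x) (at x)" and c: "continuous_on UNIV \<phi>'"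
    and b: "\<forall>x. \<bar>\<phi> x\<bar> \<le> B" "\<forall>x. \<bar>\<phi>' x\<bar> \<le> B"
  have [measurable]: "\<phi>' \<in> borel_measurable borel" by (rule borel_measurable_continuous_onI[OF c])
  have "continuous_on UNIV \<phi>" by (rule DERIV_continuous_on) (use \<phi> in \<open>auto intro: DERIV_subset\<close>)
  then have [measurable]: "\<phi> \<in> borel_measurable borel" by (rule borel_measurable_continuous_onI)
  have [measurable]: "regular_inverse e \<in> borel_measurable borel" "regular_inverse_deriv e \<in> borel_measurable borel" for e
    unfolding regular_inverse_def[abs_def] regular_inverse_deriv_def[abs_def] by measurable
  have B0: "0 \<le> B" using b(1)[THEN spec, of 0] by linarith
  define e where "e n = 1 / real (Suc n)" for n
  have e: "e n > 0" for n by (simp add: e_def)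
  let ?Y = "\<lambda>\<omega>. F (V \<omega>)" and ?N = "\<lambda>\<omega>. N0 (V \<omega>)" and ?S = "\<lambda>\<omega>. S0 (V \<omega>)" and ?T = "\<lambda>\<omega>. T0 (V \<omega>)"
  have eq: "expectation (\<lambda>\<omega>. \<phi>' (?Y \<omega>) * (regular_inverse (e n) (?N \<omega>) * ?N \<omega>))
    = expectation (\<lambda>\<omega>. \<phi> (?Y \<omega>) * (regular_inverse (e n) (?N \<omega>) * ?S \<omega> - regular_inverse_deriv (e n) (?N \<omega>) * ?T \<omega>))" for n
    by (rule regularised_identity[OF \<phi>[THEN spec] c b(1)[THEN spec] b(2)[THEN spec] Y T e])
  have "(\<lambda>n. expectation (\<lambda>\<omega>. \<phi>' (?Y \<omega>) * (regular_inverse (e n) (?N \<omega>) * ?N \<omega>))) \<longlonglongrightarrow> expectation (\<lambda>\<omega>. \<phi>' (?Y \<omega>))"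
  proof (rule integral_dominated_convergence[where w="\<lambda>_. B"])
    show "AE \<omega> in M. (\<lambda>n. \<phi>' (?Y \<omega>) * (regular_inverse (e n) (?N \<omega>) * ?N \<omega>)) \<longlonglongrightarrow> \<phi>' (?Y \<omega>)"
      using nz
    proof eventually_elim
      case (elim \<omega>)
      have "(\<lambda>n. \<phi>' (?Y \<omega>) * (regular_inverse (e n) (?N \<omega>) * ?N \<omega>)) \<longlonglongrightarrow> \<phi>' (?Y \<omega>) * (inverse (?N \<omega>) * ?N \<omega>)"
        unfolding e_def by (intro tendsto_mult tendsto_const regular_inverse_tendsto(1)[OF elim])
      then show ?case using elim by simp
    qed
    have "\<bar>\<phi>' y * (regular_inverse (e n) x * x)\<bar> \<le> B" for n x y
    proof -
      have "\<bar>\<phi>' y * (regular_inverse (e n) x * x)\<bar> = \<bar>\<phi>' y\<bar> * (regular_inverse (e n) x * x)"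
        unfolding abs_mult[of "\<phi>' y"] using regular_inverse_mult_bounds(1)[OF e] by simp
      also have "\<dots> \<le> B * 1"
        by (rule mult_mono[OF b(2)[THEN spec] regular_inverse_mult_bounds(2)[OF e] B0 regular_inverse_mult_bounds(1)[OF e]])
      finally show ?thesis by simp
    qed
    then show "AE \<omega> in M. norm (\<phi>' (?Y \<omega>) * (regular_inverse (e n) (?N \<omega>) * ?N \<omega>)) \<le> B" for n
      by simp
  qed simp_all
  moreover have "(\<lambda>n. expectation (\<lambda>\<omega>. \<phi> (?Y \<omega>) * (regular_inverse (e n) (?N \<omega>) * ?S \<omega> - regular_inverse_deriv (e n) (?N \<omega>) * ?T \<omega>)))
    \<longlonglongrightarrow> expectation (\<lambda>\<omega>. \<phi> (?Y \<omega>) * weight \<omega>)"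
  proof (rule integral_dominated_convergence[where w="\<lambda>\<omega>. B * (\<bar>?S \<omega> * inverse (?N \<omega>)\<bar> + \<bar>?T \<omega> * (inverse (?N \<omega>))\<^sup>2\<bar>)"])
    show "integrable M (\<lambda>\<omega>. B * (\<bar>?S \<omega> * inverse (?N \<omega>)\<bar> + \<bar>?T \<omega> * (inverse (?N \<omega>))\<^sup>2\<bar>))"
      using SN TN by (intro integrable_mult_right Bochner_Integration.integrable_add integrable_abs)
    show "AE \<omega> in M. (\<lambda>n. \<phi> (?Y \<omega>) * (regular_inverse (e n) (?N \<omega>) * ?S \<omega> - regular_inverse_deriv (e n) (?N \<omega>) * ?T \<omega>)) \<longlonglongrightarrow> \<phi> (?Y \<omega>) * weight \<omega>"
      using nz
    proof eventually_elim
      case (elim \<omega>)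
      have "(\<lambda>n. \<phi> (?Y \<omega>) * (regular_inverse (e n) (?N \<omega>) * ?S \<omega> - regular_inverse_deriv (e n) (?N \<omega>) * ?T \<omega>))
        \<longlonglongrightarrow> \<phi> (?Y \<omega>) * (inverse (?N \<omega>) * ?S \<omega> - (- (inverse (?N \<omega>))\<^sup>2) * ?T \<omega>)"
        unfolding e_def by (intro tendsto_mult tendsto_diff tendsto_const regular_inverse_tendsto[OF elim])
      then show ?case by (simp add: weight_def mult.commute)
    qed
    show "AE \<omega> in M. norm (\<phi> (?Y \<omega>) * (regular_inverse (e n) (?N \<omega>) * ?S \<omega> - regular_inverse_deriv (e n) (?N \<omega>) * ?T \<omega>))
      \<le> B * (\<bar>?S \<omega> * inverse (?N \<omega>)\<bar> + \<bar>?T \<omega> * (inverse (?N \<omega>))\<^sup>2\<bar>)" for n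
      using nz
    proof eventually_elim
      case (elim \<omega>)
      let ?x = "?N \<omega>"
      have "\<bar>regular_inverse (e n) ?x * ?S \<omega> - regular_inverse_deriv (e n) ?x * ?T \<omega>\<bar>
        \<le> \<bar>regular_inverse (e n) ?x * ?S \<omega>\<bar> + \<bar>regular_inverse_deriv (e n) ?x * ?T \<omega>\<bar>"
        by (rule abs_triangle_ineq4)
      also have "\<dots> \<le> \<bar>inverse ?x\<bar> * \<bar>?S \<omega>\<bar> + (inverse ?x)\<^sup>2 * \<bar>?T \<omega>\<bar>"
        unfolding abs_mult
        by (intro add_mono mult_right_mono abs_regular_inverse_le(2)[OF e elim] abs_regular_inverse_deriv_le(2)[OF e elim]) simp_all
      also have "\<dots> = \<bar>?S \<omega> * inverse ?x\<bar> + \<bar>?T \<omega> * (inverse ?x)\<^sup>2\<bar>"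
        by (simp add: abs_mult mult.commute)
      finally show ?case
        unfolding real_norm_def abs_mult[of "\<phi> (?Y \<omega>)"] by (intro mult_mono b(1)[THEN spec] B0) simp_all
    qed
    show "(\<lambda>\<omega>. \<phi> (?Y \<omega>) * weight \<omega>) \<in> borel_measurable M" unfolding weight_def by measurable
  qed measurable
  ultimately show "(LINT \<omega>|M. \<phi>' (?Y \<omega>)) = (LINT \<omega>|M. \<phi> (?Y \<omega>) * weight \<omega>)"
    unfolding eq by (rule LIMSEQ_unique)
qed (rule Y)

text \<open>\<open>F - weight\<close> is split as \<open>(F - S) - S * (1 - N) / N - T / N\<^sup>2\<close>, and Hoelder's inequality bounds the
  second moments of the three terms.\<close>

theorem fisher_distance_le:
  assumes Y [measurable]: "(\<lambda>\<omega>. F (V \<omega>)) \<in> borel_measurable M"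
    and nz: "AE \<omega> in M. nabla d g F (V \<omega>) \<noteq> 0"
    and exponents: "p > 1" "q > 1" "r > 1" "s > 1" "t > 1"
      "1 / p + 1 / q + 1 / r = 1" "1 / s + 1 / t = 1"
    and fin:
      "Lp_norm M 2 (\<lambda>\<omega>. F (V \<omega>) - (\<Sum>k\<in>UNIV. g k (X k \<omega>))) < \<infinity>"
      "Lp_norm M (2 * p) (\<lambda>\<omega>. \<Sum>k\<in>UNIV. g k (X k \<omega>)) < \<infinity>"
      "Lp_norm M (2 * q) (\<lambda>\<omega>. inverse (nabla d g F (V \<omega>))) < \<infinity>"
      "Lp_norm M (2 * r) (\<lambda>\<omega>. 1 - nabla d g F (V \<omega>)) < \<infinity>"
      "Lp_norm M (4 * s) (\<lambda>\<omega>. inverse (nabla d g F (V \<omega>))) < \<infinity>"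
      "Lp_norm M (2 * t) (\<lambda>\<omega>. \<Sum>k\<in>UNIV. partial k (nabla d g F) (V \<omega>) * stein_L (d k) (g k) (X k \<omega>)) < \<infinity>"
  shows "\<exists>d\<^sub>F. has_ac_density M (\<lambda>\<omega>. F (V \<omega>)) d\<^sub>F \<and>
    fisher_distance M (\<lambda>\<omega>. F (V \<omega>)) d\<^sub>F
      \<le> 3 * (Lp_norm M 2 (\<lambda>\<omega>. F (V \<omega>) - (\<Sum>k\<in>UNIV. g k (X k \<omega>)))) ^ 2
      + 3 * (Lp_norm M (2 * p) (\<lambda>\<omega>. \<Sum>k\<in>UNIV. g k (X k \<omega>))) ^ 2
          * (Lp_norm M (2 * q) (\<lambda>\<omega>. inverse (nabla d g F (V \<omega>)))) ^ 2
          * (Lp_norm M (2 * r) (\<lambda>\<omega>. 1 - nabla d g F (V \<omega>))) ^ 2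
      + 3 * (Lp_norm M (4 * s) (\<lambda>\<omega>. inverse (nabla d g F (V \<omega>)))) ^ 4
          * (Lp_norm M (2 * t) (\<lambda>\<omega>. \<Sum>k\<in>UNIV.
              partial k (nabla d g F) (V \<omega>) * stein_L (d k) (g k) (X k \<omega>))) ^ 2"
proof -
  let ?Y = "\<lambda>\<omega>. F (V \<omega>)" and ?N = "\<lambda>\<omega>. N0 (V \<omega>)" and ?S = "\<lambda>\<omega>. S0 (V \<omega>)" and ?T = "\<lambda>\<omega>. T0 (V \<omega>)"
  have L1: "Lp_norm M a (\<lambda>\<omega>. ?Y \<omega> - (\<Sum>k\<in>UNIV. g k (X k \<omega>))) = Lp_norm M a (\<lambda>\<omega>. ?Y \<omega> - ?S \<omega>)" for a
    by (rule Lp_norm_cong_AE) (use S0_V in \<open>eventually_elim, simp\<close>)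
  have L2: "Lp_norm M a (\<lambda>\<omega>. \<Sum>k\<in>UNIV. g k (X k \<omega>)) = Lp_norm M a ?S" for a
    by (rule Lp_norm_cong_AE) (use S0_V in \<open>eventually_elim, simp\<close>)
  have L3: "Lp_norm M a (\<lambda>\<omega>. inverse (nabla d g F (V \<omega>))) = Lp_norm M a (\<lambda>\<omega>. inverse (?N \<omega>))" for a
    by (rule Lp_norm_cong_AE) (use N0_V in \<open>eventually_elim, simp\<close>)
  have L4: "Lp_norm M a (\<lambda>\<omega>. 1 - nabla d g F (V \<omega>)) = Lp_norm M a (\<lambda>\<omega>. 1 - ?N \<omega>)" for a
    by (rule Lp_norm_cong_AE) (use N0_V in \<open>eventually_elim, simp\<close>)
  have L5: "Lp_norm M a (\<lambda>\<omega>. \<Sum>k\<in>UNIV. partial k (nabla d g F) (V \<omega>) * stein_L (d k) (g k) (X k \<omega>)) = Lp_norm M a ?T" for a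
    by (rule Lp_norm_cong_AE) (use T0_V in \<open>eventually_elim, simp\<close>)
  note fin' = fin[unfolded L1 L2 L3 L4 L5]
  have nz': "AE \<omega> in M. ?N \<omega> \<noteq> 0" using nz N0_V by eventually_elim simp
  define A where "A \<omega> = ?Y \<omega> - ?S \<omega>" for \<omega>
  define B where "B \<omega> = ?S \<omega> * inverse (?N \<omega>) * (1 - ?N \<omega>)" for \<omega>
  define C where "C \<omega> = ?T \<omega> * (inverse (?N \<omega>))\<^sup>2" for \<omega>
  have [measurable]: "A \<in> borel_measurable M" "B \<in> borel_measurable M" "C \<in> borel_measurable M"
    unfolding A_def B_def C_def by measurable
  let ?a = "Lp_norm M 2 (\<lambda>\<omega>. ?Y \<omega> - ?S \<omega>) ^ 2"
  let ?b = "Lp_norm M (2 * p) ?S ^ 2 * Lp_norm M (2 * q) (\<lambda>\<omega>. inverse (?N \<omega>)) ^ 2 * Lp_norm M (2 * r) (\<lambda>\<omega>. 1 - ?N \<omega>) ^ 2"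
  let ?c = "Lp_norm M (4 * s) (\<lambda>\<omega>. inverse (?N \<omega>)) ^ 4 * Lp_norm M (2 * t) ?T ^ 2"
  have A2: "(\<integral>\<^sup>+\<omega>. ennreal ((A \<omega>)\<^sup>2) \<partial>M) \<le> ?a"
    using Hoelder_Lp_norm[of "{()}" "\<lambda>_. 1" "\<lambda>_ \<omega>. ?Y \<omega> - ?S \<omega>" M "\<lambda>_. 2"] fin'(1)
    by (simp add: A_def)
  have eqB: "\<bar>?S \<omega>\<bar> ^ 2 * \<bar>inverse (?N \<omega>)\<bar> ^ 2 * \<bar>1 - ?N \<omega>\<bar> ^ 2 = (B \<omega>)\<^sup>2" for \<omega>
    by (simp only: power2_abs B_def power_mult_distrib)
  have "(\<integral>\<^sup>+\<omega>. ennreal (\<bar>?S \<omega>\<bar> ^ 2 * \<bar>inverse (?N \<omega>)\<bar> ^ 2 * \<bar>1 - ?N \<omega>\<bar> ^ 2) \<partial>M) \<le> ?b"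
    using Hoelder_Lp_norm_3[of p q r ?S M "\<lambda>\<omega>. inverse (?N \<omega>)" "\<lambda>\<omega>. 1 - ?N \<omega>" 2] fin'(2-4) exponents by simp
  then have B2: "(\<integral>\<^sup>+\<omega>. ennreal ((B \<omega>)\<^sup>2) \<partial>M) \<le> ?b" unfolding eqB .
  have eqC: "\<bar>inverse (?N \<omega>)\<bar> ^ 4 * \<bar>?T \<omega>\<bar> ^ 2 = (C \<omega>)\<^sup>2" for \<omega>
  proof -
    have "\<bar>z\<bar> ^ 4 = (z\<^sup>2)\<^sup>2" for z :: real by (simp flip: power_mult)
    then show ?thesis by (simp only: C_def power_mult_distrib power2_abs mult.commute)
  qed
  have "(\<integral>\<^sup>+\<omega>. ennreal (\<bar>inverse (?N \<omega>)\<bar> ^ 4 * \<bar>?T \<omega>\<bar> ^ 2) \<partial>M) \<le> ?c"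
    using Hoelder_Lp_norm_2[of s t "\<lambda>\<omega>. inverse (?N \<omega>)" M ?T 4 2] fin'(5-6) exponents by simp
  then have C2: "(\<integral>\<^sup>+\<omega>. ennreal ((C \<omega>)\<^sup>2) \<partial>M) \<le> ?c" unfolding eqC .
  have "?a < \<infinity>" using fin'(1) by (simp add: power_less_top_ennreal)
  with A2 have Af: "(\<integral>\<^sup>+\<omega>. ennreal ((A \<omega>)\<^sup>2) \<partial>M) < \<infinity>" by (rule le_less_trans)
  have "?b < \<infinity>" using fin'(2-4) by (simp add: power_less_top_ennreal ennreal_mult_less_top)
  with B2 have Bf: "(\<integral>\<^sup>+\<omega>. ennreal ((B \<omega>)\<^sup>2) \<partial>M) < \<infinity>" by (rule le_less_trans)
  have "?c < \<infinity>" using fin'(5-6) by (simp add: power_less_top_ennreal ennreal_mult_less_top)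
  with C2 have Cf: "(\<integral>\<^sup>+\<omega>. ennreal ((C \<omega>)\<^sup>2) \<partial>M) < \<infinity>" by (rule le_less_trans)
  have iA: "integrable M (\<lambda>\<omega>. (A \<omega>)\<^sup>2)" "integrable M A" by (rule integrable_of_square[OF _ Af], measurable)+
  have iB: "integrable M (\<lambda>\<omega>. (B \<omega>)\<^sup>2)" "integrable M B" by (rule integrable_of_square[OF _ Bf], measurable)+
  have iC: "integrable M (\<lambda>\<omega>. (C \<omega>)\<^sup>2)" "integrable M C" by (rule integrable_of_square[OF _ Cf], measurable)+
  have iY: "integrable M ?Y"
    using Bochner_Integration.integrable_add[OF iA(2) S0_integrable] by (simp add: A_def)
  have iT: "integrable M ?T"
  proof -
    obtain m where "(\<integral>\<^sup>+\<omega>. ennreal ((\<bar>?T \<omega>\<bar> ^ 2) powr (1 / (1 / t))) \<partial>M) = ennreal m"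
      by (rule Lp_norm_power[OF fin'(6), of "1 / t" 2]) (use exponents in \<open>auto intro: that\<close>)
    then have mf: "(\<integral>\<^sup>+\<omega>. ennreal (((?T \<omega>)\<^sup>2) powr t) \<partial>M) < \<infinity>" by simp
    have "(\<integral>\<^sup>+\<omega>. ennreal ((?T \<omega>)\<^sup>2) \<partial>M) \<le> (\<integral>\<^sup>+\<omega>. 1 + ennreal (((?T \<omega>)\<^sup>2) powr t) \<partial>M)"
    proof (rule nn_integral_mono)
      fix \<omega>
      have "z \<le> 1 + z powr t" if "0 \<le> z" for z :: real
      proof (cases "z \<le> 1")
        case False
        then have "z powr 1 \<le> z powr t" using exponents by (intro powr_mono) simp_all
        then show ?thesis using False by simp
      qed (simp add: add_increasing2)
      then have "ennreal ((?T \<omega>)\<^sup>2) \<le> ennreal (1 + ((?T \<omega>)\<^sup>2) powr t)" by (intro ennreal_leI) simp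
      then show "ennreal ((?T \<omega>)\<^sup>2) \<le> 1 + ennreal (((?T \<omega>)\<^sup>2) powr t)" by (simp add: ennreal_plus)
    qed
    also have "\<dots> = 1 + (\<integral>\<^sup>+\<omega>. ennreal (((?T \<omega>)\<^sup>2) powr t) \<partial>M)"
      by (subst nn_integral_add) (simp_all add: emeasure_space_1)
    also have "\<dots> < \<infinity>" using mf by simp
    finally show ?thesis by (rule integrable_of_square(2)[rotated]) measurable
  qed
  \<comment> \<open>\<open>S / N = S + S * (1 - N) / N\<close>, where \<open>S\<close> is integrable by assumption\<close>
  have iSN: "integrable M (\<lambda>\<omega>. ?S \<omega> * inverse (?N \<omega>))"
  proof (rule integrable_cong_AE_imp[OF Bochner_Integration.integrable_add[OF S0_integrable iB(2)]])
    show "AE \<omega> in M. ?S \<omega> + B \<omega> = ?S \<omega> * inverse (?N \<omega>)"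
      using nz' by eventually_elim (simp add: B_def field_simps)
  qed measurable
  have w: "ibp_weight M ?Y weight"
    by (rule ibp_weight_F[OF Y nz' iT iSN iC(2)[unfolded C_def[abs_def]]])
  have ABC: "AE \<omega> in M. ?Y \<omega> - weight \<omega> = A \<omega> - B \<omega> - C \<omega>"
    using nz' by eventually_elim (simp add: weight_def A_def B_def C_def field_simps)
  have sq3: "(x - y - z)\<^sup>2 \<le> 3 * x\<^sup>2 + 3 * y\<^sup>2 + 3 * z\<^sup>2" for x y z :: real
  proof -
    have "3 * x\<^sup>2 + 3 * y\<^sup>2 + 3 * z\<^sup>2 - (x - y - z)\<^sup>2 = (x + y)\<^sup>2 + (x + z)\<^sup>2 + (y - z)\<^sup>2"
      by (simp add: power2_eq_square algebra_simps)
    also have "\<dots> \<ge> 0" by simp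
    finally show ?thesis by simp
  qed
  have [measurable]: "weight \<in> borel_measurable M" unfolding weight_def[abs_def] by measurable
  have le: "(\<integral>\<^sup>+\<omega>. ennreal ((?Y \<omega> - weight \<omega>)\<^sup>2) \<partial>M) \<le> 3 * ?a + 3 * ?b + 3 * ?c"
  proof -
    have "(\<integral>\<^sup>+\<omega>. ennreal ((?Y \<omega> - weight \<omega>)\<^sup>2) \<partial>M)
      \<le> (\<integral>\<^sup>+\<omega>. 3 * ennreal ((A \<omega>)\<^sup>2) + 3 * ennreal ((B \<omega>)\<^sup>2) + 3 * ennreal ((C \<omega>)\<^sup>2) \<partial>M)"
    proof (rule nn_integral_mono_AE, use ABC in eventually_elim)
      fix \<omega> assume eq: "?Y \<omega> - weight \<omega> = A \<omega> - B \<omega> - C \<omega>"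
      have "ennreal ((?Y \<omega> - weight \<omega>)\<^sup>2) \<le> ennreal (3 * (A \<omega>)\<^sup>2 + 3 * (B \<omega>)\<^sup>2 + 3 * (C \<omega>)\<^sup>2)"
        unfolding eq by (rule ennreal_leI[OF sq3])
      then show "ennreal ((?Y \<omega> - weight \<omega>)\<^sup>2) \<le> 3 * ennreal ((A \<omega>)\<^sup>2) + 3 * ennreal ((B \<omega>)\<^sup>2) + 3 * ennreal ((C \<omega>)\<^sup>2)"
        by (simp add: ennreal_plus ennreal_mult)
    qed
    also have "\<dots> = 3 * (\<integral>\<^sup>+\<omega>. ennreal ((A \<omega>)\<^sup>2) \<partial>M) + 3 * (\<integral>\<^sup>+\<omega>. ennreal ((B \<omega>)\<^sup>2) \<partial>M) + 3 * (\<integral>\<^sup>+\<omega>. ennreal ((C \<omega>)\<^sup>2) \<partial>M)"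
      by (simp add: nn_integral_add nn_integral_cmult)
    also have "\<dots> \<le> 3 * ?a + 3 * ?b + 3 * ?c"
      by (intro add_mono mult_left_mono A2 B2 C2) simp_all
    finally show ?thesis .
  qed
  have "integrable M (\<lambda>\<omega>. (?Y \<omega> - weight \<omega>)\<^sup>2)"
  proof (rule integrableI_nonneg)
    have "3 * ?a + 3 * ?b + 3 * ?c < \<infinity>"
      using \<open>?a < \<infinity>\<close> \<open>?b < \<infinity>\<close> \<open>?c < \<infinity>\<close> by (simp add: ennreal_mult_less_top)
    with le show "(\<integral>\<^sup>+\<omega>. ennreal ((?Y \<omega> - weight \<omega>)\<^sup>2) \<partial>M) < \<infinity>" by (rule le_less_trans)
  qed simp_all
  from ibp_weight_fisher_distance_le[OF w iY this] obtain d\<^sub>F where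
    dF: "has_ac_density M ?Y d\<^sub>F" "fisher_distance M ?Y d\<^sub>F \<le> (\<integral>\<^sup>+\<omega>. ennreal ((?Y \<omega> - weight \<omega>)\<^sup>2) \<partial>M)"
    by blast
  have "fisher_distance M ?Y d\<^sub>F \<le> 3 * ?a + 3 * ?b + 3 * ?c" using dF(2) le by (rule order_trans)
  then show ?thesis
    unfolding L1 L2 L3 L4 L5 using dF(1) by (intro exI[of _ d\<^sub>F]) (simp add: mult.assoc)
qed

end

section \<open>The bound for the Fisher information distance\<close>

theorem theorem3p2:
  fixes M :: "'a measure"
    and X :: "'n::finite \<Rightarrow> 'a \<Rightarrow> real"
    and I :: "'n \<Rightarrow> real set"
    and d :: "'n \<Rightarrow> real \<Rightarrow> real"
    and F :: "real ^ 'n \<Rightarrow> real"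
    and g :: "'n \<Rightarrow> real \<Rightarrow> real"
    and p q r s t :: real
  assumes prob: "prob_space M"
    and indep: "prob_space.indep_vars M (\<lambda>_. borel) X UNIV"
    and X_integrable: "\<And>k. integrable M (X k)" "\<And>k. integrable M (\<lambda>\<omega>. (X k \<omega>)\<^sup>2)"
    and X_mean: "\<And>k. prob_space.expectation M (X k) = 0"
    and X_var: "\<And>k. prob_space.variance M (X k) = 1"
    and I_interval: "\<And>k. open (I k)" "\<And>k. connected (I k)"
    and X_density: "\<And>k. distributed M lborel (X k) (\<lambda>x. ennreal (d k x))"
    and d_pos: "\<And>k x. x \<in> I k \<Longrightarrow> 0 < d k x"
    and d_zero: "\<And>k x. x \<notin> I k \<Longrightarrow> d k x = 0"
    and d_diff: "\<And>k x. x \<in> I k \<Longrightarrow> d k differentiable (at x)"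
    and F_C2: "Ck_on 2 (prod_range I) F"
    and F_rv: "(\<lambda>\<omega>. F (rvec X \<omega>)) \<in> borel_measurable M"
    and F_L2: "Lp_norm M 2 (\<lambda>\<omega>. F (rvec X \<omega>)) < \<infinity>"
    and F_mean: "prob_space.expectation M (\<lambda>\<omega>. F (rvec X \<omega>)) = 0"
    and F_var: "prob_space.variance M (\<lambda>\<omega>. F (rvec X \<omega>)) = 1"
    and exponents: "p > 1" "q > 1" "r > 1" "s > 1" "t > 1"
      "1 / p + 1 / q + 1 / r = 1" "1 / s + 1 / t = 1"
    and g_cont: "\<And>k. continuous_on (I k) (g k)"
    and g_integrable: "\<And>k. integrable M (\<lambda>\<omega>. g k (X k \<omega>))"
    and g_mean: "\<And>k. prob_space.expectation M (\<lambda>\<omega>. g k (X k \<omega>)) = 0"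
    and nabla_nz: "AE \<omega> in M. nabla d g F (rvec X \<omega>) \<noteq> 0"
    and finite_norms:
      "Lp_norm M 2 (\<lambda>\<omega>. F (rvec X \<omega>) - (\<Sum>k\<in>UNIV. g k (X k \<omega>))) < \<infinity>"
      "Lp_norm M (2 * p) (\<lambda>\<omega>. \<Sum>k\<in>UNIV. g k (X k \<omega>)) < \<infinity>"
      "Lp_norm M (2 * q) (\<lambda>\<omega>. inverse (nabla d g F (rvec X \<omega>))) < \<infinity>"
      "Lp_norm M (2 * r) (\<lambda>\<omega>. 1 - nabla d g F (rvec X \<omega>)) < \<infinity>"
      "Lp_norm M (4 * s) (\<lambda>\<omega>. inverse (nabla d g F (rvec X \<omega>))) < \<infinity>"
      "Lp_norm M (2 * t) (\<lambda>\<omega>. \<Sum>k\<in>UNIV.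
        partial k (nabla d g F) (rvec X \<omega>) * stein_L (d k) (g k) (X k \<omega>)) < \<infinity>"
  shows "\<exists>d\<^sub>F. has_ac_density M (\<lambda>\<omega>. F (rvec X \<omega>)) d\<^sub>F \<and>
    fisher_distance M (\<lambda>\<omega>. F (rvec X \<omega>)) d\<^sub>F
      \<le> 3 * (Lp_norm M 2 (\<lambda>\<omega>. F (rvec X \<omega>) - (\<Sum>k\<in>UNIV. g k (X k \<omega>)))) ^ 2
      + 3 * (Lp_norm M (2 * p) (\<lambda>\<omega>. \<Sum>k\<in>UNIV. g k (X k \<omega>))) ^ 2
          * (Lp_norm M (2 * q) (\<lambda>\<omega>. inverse (nabla d g F (rvec X \<omega>)))) ^ 2
          * (Lp_norm M (2 * r) (\<lambda>\<omega>. 1 - nabla d g F (rvec X \<omega>))) ^ 2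
      + 3 * (Lp_norm M (4 * s) (\<lambda>\<omega>. inverse (nabla d g F (rvec X \<omega>)))) ^ 4
          * (Lp_norm M (2 * t) (\<lambda>\<omega>. \<Sum>k\<in>UNIV.
              partial k (nabla d g F) (rvec X \<omega>) * stein_L (d k) (g k) (X k \<omega>))) ^ 2"
proof -
  interpret prob_space M by (rule prob)
  interpret stein_setting M X I d g F
    by unfold_locales (fact indep I_interval X_density d_pos d_zero d_diff F_C2 g_cont g_integrable g_mean)+
  show ?thesis
    by (rule fisher_distance_le[OF F_rv nabla_nz exponents finite_norms])
qed

end
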